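(* Let $\mathbf{k}$ be a unitary commutative ring, $\Omega$ a nonempty set and $A$ a commutative ($\mathbf{k}$-)algebra. Let $\mathrm{Sha}_\Omega(A)=A\otimes \mathrm{Sh}(\mathbf{k}\Omega\otimes A)$, with its product $\diamond$ and its linear operators $P_\omega$, $\omega\in\Omega$, be as defined in the context. Then the triple $(\mathrm{Sha}_\Omega(A),\diamond,(P_\omega)_{\omega\in\Omega})$, together with the natural embedding $j_A: A\to \mathrm{Sha}_\Omega(A)$, $a\mapsto a=a\otimes 1$, is the free commutative matching Rota-Baxter algebra of weight zero on $A$. That is, $(\mathrm{Sha}_\Omega(A),\diamond,(P_\omega)_{\omega\in\Omega})$ is a commutative matching Rota-Baxter algebra of weight zero, $j_A$ is an algebra homomorphism, and for every commutative matching Rota-Baxter algebra $(R,(P_{\omega,R})_{\omega\in\Omega})$ of weight zero and every algebra homomorphism $f:A\to R$ there is a unique matching Rota-Baxter algebra homomorphism $\bar f:\mathrm{Sha}_\Omega(A)\to R$ such that $f=\bar f\, j_A$.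
   Context: All modules, algebras, tensor products and linear maps are over a unitary commutative ring $\mathbf{k}$. An algebra is an associative unitary $\mathbf{k}$-algebra; algebra homomorphisms preserve the unit. Matching Rota-Baxter algebra of weight zero (indexed by $\Omega$): a pair $(R,(P_\omega)_{\omega\in\Omega})$ of an algebra $R$ and a family of linear operators $P_\omega:R\to R$ such that $P_\alpha(x)P_\beta(y)=P_\alpha(xP_\beta(y))+P_\beta(P_\alpha(x)y)$ for all $x,y\in R$ and $\alpha,\beta\in\Omega$. It is commutative if $R$ is commutative. A homomorphism $(R,(P_\omega)_{\omega\in\Omega})\to(R',(P'_\omega)_{\omega\in\Omega})$ of matching Rota-Baxter algebras is an algebra homomorphism $f:R\to R'$ with $fP_\omega=P'_\omega f$ for all $\omega\in\Omega$. Shuffle product algebra: for a $\mathbf{k}$-module $V$, $\mathrm{Sh}(V)$ is the module $\bigoplus_{k\ge 0}V^{\otimes k}$ ($V^{\otimes 0}=\mathbf{k}$) with the bilinear shuffle product $\sqcup\!\sqcup$ with unit $1\in\mathbf{k}$, defined recursively, for $\mathfrak a=a_1\otimes\mathfrak a'\in V^{\otimes m}$, $\mathfrak b=b_1\otimes \mathfrak b'\in V^{\otimes n}$, $m,n\ge1$, $\mathfrak a'\in V^{\otimes(m-1)}$, $\mathfrak b'\in V^{\otimes(n-1)}$, by $\mathfrak a\sqcup\!\sqcup\mathfrak b=a_1\otimes(\mathfrak a'\sqcup\!\sqcup\mathfrak b)+b_1\otimes(\mathfrak a\sqcup\!\sqcup\mathfrak b')$, where $\mathfrak a'$ (resp.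 $\mathfrak b'$) is $1\in\mathbf{k}$ (up to a scalar absorbed in $a_1$, resp. $b_1$) if $m=1$ (resp. $n=1$). Construction: $\mathbf{k}\Omega$ is the free $\mathbf{k}$-module on $\Omega$. $\mathrm{Sha}_\Omega(A):=A\otimes\mathrm{Sh}(\mathbf{k}\Omega\otimes A)=\bigoplus_{k\ge0}A\otimes(\mathbf{k}\Omega\otimes A)^{\otimes k}$ is the tensor product algebra, with product $(a_0\otimes\bar{\mathfrak a})\diamond(b_0\otimes\bar{\mathfrak b})=a_0b_0\otimes(\bar{\mathfrak a}\sqcup\!\sqcup\bar{\mathfrak b})$ for $a_0,b_0\in A$ and $\bar{\mathfrak a},\bar{\mathfrak b}\in\mathrm{Sh}(\mathbf{k}\Omega\otimes A)$. For $\omega\in\Omega$, $P_\omega:\mathrm{Sha}_\Omega(A)\to\mathrm{Sha}_\Omega(A)$ is the linear map with $P_\omega(a_0\otimes\bar{\mathfrak a})=1\otimes(\omega\otimes a_0)\otimes\bar{\mathfrak a}$ for $a_0\in A$ and $\bar{\mathfrak a}\in(\mathbf{k}\Omega\otimes A)^{\otimes m}$, $m\ge 0$ (so $P_\omega(a_0)=1\otimes(\omega\otimes a_0)$ when $m=0$, $\bar{\mathfrak a}=1$). *)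

theory Defs
  imports "HOL-Algebra.Module" "HOL-Algebra.QuotRing" "HOL-Library.Multiset"
begin

section \<open>Free modules, algebras with a prescribed product on the basis, quotients\<close>

text \<open>
  The module record of HOL-Algebra extends the ring record. For a structure that is only used
  as a module, the fields for the product and the unit carry no meaning.
  The locale \<^locale>\<open>algebra\<close> is that of commutative, associative, unitary algebras.
\<close>

definition free_module :: "('k, 'm) ring_scheme \<Rightarrow> 's set \<Rightarrow> ('k, 's \<Rightarrow> 'k) module"
  where "free_module k S =
    \<lparr>carrier = {p. (\<forall>s\<in>S. p s \<in> carrier k) \<and> (\<forall>s. s \<notin> S \<longrightarrow> p s = \<zero>\<^bsub>k\<^esub>)
                 \<and> finite {s. p s \<noteq> \<zero>\<^bsub>k\<^esub>}},
     monoid.mult = undefined, one = undefined,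
     zero = (\<lambda>s. \<zero>\<^bsub>k\<^esub>), add = (\<lambda>p q s. p s \<oplus>\<^bsub>k\<^esub> q s),
     smult = (\<lambda>c p s. c \<otimes>\<^bsub>k\<^esub> p s)\<rparr>"

definition basis_elem :: "('k, 'm) ring_scheme \<Rightarrow> 's \<Rightarrow> 's \<Rightarrow> 'k"
  where "basis_elem k s = (\<lambda>t. if t = s then \<one>\<^bsub>k\<^esub> else \<zero>\<^bsub>k\<^esub>)"

text \<open>
  The bilinear product on the free module on \<open>S\<close> for which the product of the basis elements
  \<open>u\<close> and \<open>v\<close> is the sum of the basis elements in the finite multiset \<open>mul u v\<close>; the unit is the
  basis element \<open>e\<close>.
\<close>

definition free_algebra ::
    "('k, 'm) ring_scheme \<Rightarrow> 's set \<Rightarrow> ('s \<Rightarrow> 's \<Rightarrow> 's multiset) \<Rightarrow> 's \<Rightarrow> ('k, 's \<Rightarrow> 'k) module"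
  where "free_algebra k S mul e = (free_module k S)
    \<lparr>monoid.mult := (\<lambda>p q s. \<Oplus>\<^bsub>k\<^esub>uv \<in> {u. p u \<noteq> \<zero>\<^bsub>k\<^esub>} \<times> {v. q v \<noteq> \<zero>\<^bsub>k\<^esub>}.
                [count (mul (fst uv) (snd uv)) s] \<cdot>\<^bsub>k\<^esub> (p (fst uv) \<otimes>\<^bsub>k\<^esub> q (snd uv))),
     one := basis_elem k e\<rparr>"

definition generated_submodule ::
    "('k, 'm) ring_scheme \<Rightarrow> ('k, 'v, 'n) module_scheme \<Rightarrow> 'v set \<Rightarrow> 'v set"
  where "generated_submodule k M X = \<Inter>{H. submodule H k M \<and> X \<subseteq> H}"

text \<open>The factor ring \<open>M Quot I\<close> of the library, with the induced scalar multiplication.\<close>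

definition quotient_module :: "('k, 'v, 'n) module_scheme \<Rightarrow> 'v set \<Rightarrow> ('k, 'v set) module"
  where "quotient_module M I =
    \<lparr>carrier = carrier (M Quot I), monoid.mult = monoid.mult (M Quot I), one = one (M Quot I),
     zero = zero (M Quot I), add = add (M Quot I),
     smult = (\<lambda>c X. \<Union>x\<in>X. I +>\<^bsub>M\<^esub> (c \<odot>\<^bsub>M\<^esub> x))\<rparr>"

section \<open>Tensor product\<close>

text \<open>
  The tensor product of \<open>M\<close> and \<open>N\<close> is the free module on \<open>M \<times> N\<close> modulo the relations of
  bilinearity. If \<open>M\<close> and \<open>N\<close> are algebras, its product is the one induced by
  \<open>(m, n) (m', n') = (m m', n n')\<close>.
\<close>

definition pairs_algebra ::
    "('k, 'm) ring_scheme \<Rightarrow> ('k, 'a, 'n) module_scheme \<Rightarrow> ('k, 'b, 'l) module_scheme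
      \<Rightarrow> ('k, 'a \<times> 'b \<Rightarrow> 'k) module"
  where "pairs_algebra k M N = free_algebra k (carrier M \<times> carrier N)
    (\<lambda>u v. {#(fst u \<otimes>\<^bsub>M\<^esub> fst v, snd u \<otimes>\<^bsub>N\<^esub> snd v)#}) (\<one>\<^bsub>M\<^esub>, \<one>\<^bsub>N\<^esub>)"

definition tensor_relations ::
    "('k, 'm) ring_scheme \<Rightarrow> ('k, 'a, 'n) module_scheme \<Rightarrow> ('k, 'b, 'l) module_scheme
      \<Rightarrow> ('a \<times> 'b \<Rightarrow> 'k) set"
  where "tensor_relations k M N =
    (let F = pairs_algebra k M N; e = basis_elem k in generated_submodule k F
      ({e (x \<oplus>\<^bsub>M\<^esub> x', y) \<ominus>\<^bsub>F\<^esub> (e (x, y) \<oplus>\<^bsub>F\<^esub> e (x', y)) | x x' y.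
          x \<in> carrier M \<and> x' \<in> carrier M \<and> y \<in> carrier N} \<union>
       {e (x, y \<oplus>\<^bsub>N\<^esub> y') \<ominus>\<^bsub>F\<^esub> (e (x, y) \<oplus>\<^bsub>F\<^esub> e (x, y')) | x y y'.
          x \<in> carrier M \<and> y \<in> carrier N \<and> y' \<in> carrier N} \<union>
       {e (c \<odot>\<^bsub>M\<^esub> x, y) \<ominus>\<^bsub>F\<^esub> (c \<odot>\<^bsub>F\<^esub> e (x, y)) | c x y.
          c \<in> carrier k \<and> x \<in> carrier M \<and> y \<in> carrier N} \<union>
       {e (x, c \<odot>\<^bsub>N\<^esub> y) \<ominus>\<^bsub>F\<^esub> (c \<odot>\<^bsub>F\<^esub> e (x, y)) | c x y.
          c \<in> carrier k \<and> x \<in> carrier M \<and> y \<in> carrier N}))"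

definition tensor_product ::
    "('k, 'm) ring_scheme \<Rightarrow> ('k, 'a, 'n) module_scheme \<Rightarrow> ('k, 'b, 'l) module_scheme
      \<Rightarrow> ('k, ('a \<times> 'b \<Rightarrow> 'k) set) module"
  where "tensor_product k M N = quotient_module (pairs_algebra k M N) (tensor_relations k M N)"

definition tensor ::
    "('k, 'm) ring_scheme \<Rightarrow> ('k, 'a, 'n) module_scheme \<Rightarrow> ('k, 'b, 'l) module_scheme
      \<Rightarrow> 'a \<Rightarrow> 'b \<Rightarrow> ('a \<times> 'b \<Rightarrow> 'k) set"
  where "tensor k M N x y =
    tensor_relations k M N +>\<^bsub>pairs_algebra k M N\<^esub> basis_elem k (x, y)"

section \<open>Shuffle product algebra\<close>

text \<open>
  The direct sum of the tensor powers of \<open>V\<close> is built in one step, as the free module on all words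
  over \<open>V\<close> modulo the relations of multilinearity in the letters. All these relations are
  homogeneous in the length of the words, so the classes of the combinations of words of length
  \<open>n\<close> form the \<open>n\<close>-th tensor power (the ring \<open>k\<close> itself for \<open>n = 0\<close>), and the quotient is the direct
  sum of these. The word \<open>[v\<^sub>1, \<dots>, v\<^sub>n]\<close> represents \<open>v\<^sub>1 \<otimes> \<dots> \<otimes> v\<^sub>n\<close>.
\<close>

fun shuffle :: "'v list \<Rightarrow> 'v list \<Rightarrow> 'v list multiset"
  where
    "shuffle [] ys = {#ys#}"
  | "shuffle (x # xs) [] = {#x # xs#}"
  | "shuffle (x # xs) (y # ys) =
       image_mset ((#) x) (shuffle xs (y # ys)) + image_mset ((#) y) (shuffle (x # xs) ys)"

definition words_algebra ::
    "('k, 'm) ring_scheme \<Rightarrow> ('k, 'v, 'n) module_scheme \<Rightarrow> ('k, 'v list \<Rightarrow> 'k) module"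
  where "words_algebra k V = free_algebra k (lists (carrier V)) shuffle []"

definition multilinear_relations ::
    "('k, 'm) ring_scheme \<Rightarrow> ('k, 'v, 'n) module_scheme \<Rightarrow> ('v list \<Rightarrow> 'k) set"
  where "multilinear_relations k V =
    (let F = words_algebra k V; e = basis_elem k in generated_submodule k F
      ({e (us @ [x \<oplus>\<^bsub>V\<^esub> y] @ vs) \<ominus>\<^bsub>F\<^esub> (e (us @ [x] @ vs) \<oplus>\<^bsub>F\<^esub> e (us @ [y] @ vs)) | us vs x y.
          us \<in> lists (carrier V) \<and> vs \<in> lists (carrier V) \<and> x \<in> carrier V \<and> y \<in> carrier V} \<union>
       {e (us @ [c \<odot>\<^bsub>V\<^esub> x] @ vs) \<ominus>\<^bsub>F\<^esub> (c \<odot>\<^bsub>F\<^esub> e (us @ [x] @ vs)) | us vs c x.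
          us \<in> lists (carrier V) \<and> vs \<in> lists (carrier V) \<and> c \<in> carrier k \<and> x \<in> carrier V}))"

definition Sh ::
    "('k, 'm) ring_scheme \<Rightarrow> ('k, 'v, 'n) module_scheme \<Rightarrow> ('k, ('v list \<Rightarrow> 'k) set) module"
  where "Sh k V = quotient_module (words_algebra k V) (multilinear_relations k V)"

definition word_tensor ::
    "('k, 'm) ring_scheme \<Rightarrow> ('k, 'v, 'n) module_scheme \<Rightarrow> 'v list \<Rightarrow> ('v list \<Rightarrow> 'k) set"
  where "word_tensor k V w = multilinear_relations k V +>\<^bsub>words_algebra k V\<^esub> basis_elem k w"

section \<open>Matching Rota-Baxter algebras of weight zero\<close>

definition linear_maps ::
    "('k, 'm) ring_scheme \<Rightarrow> ('k, 'a, 'n) module_scheme \<Rightarrow> ('k, 'b, 'l) module_scheme \<Rightarrow> ('a \<Rightarrow> 'b) set"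
  where "linear_maps k M N =
    {h \<in> carrier M \<rightarrow> carrier N.
      (\<forall>x\<in>carrier M. \<forall>y\<in>carrier M. h (x \<oplus>\<^bsub>M\<^esub> y) = h x \<oplus>\<^bsub>N\<^esub> h y) \<and>
      (\<forall>c\<in>carrier k. \<forall>x\<in>carrier M. h (c \<odot>\<^bsub>M\<^esub> x) = c \<odot>\<^bsub>N\<^esub> h x)}"

definition algebra_homs ::
    "('k, 'm) ring_scheme \<Rightarrow> ('k, 'a, 'n) module_scheme \<Rightarrow> ('k, 'b, 'l) module_scheme \<Rightarrow> ('a \<Rightarrow> 'b) set"
  where "algebra_homs k A B = ring_hom A B \<inter> linear_maps k A B"

locale comm_matching_rota_baxter_algebra = algebra k R
  for k (structure) and \<Omega> :: "'w set" and R (structure) and P :: "'w \<Rightarrow> 'a \<Rightarrow> 'a" +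
  assumes operator_linear: "\<omega> \<in> \<Omega> \<Longrightarrow> P \<omega> \<in> linear_maps k R R"
    and matching_rota_baxter:
      "\<lbrakk>\<alpha> \<in> \<Omega>; \<beta> \<in> \<Omega>; x \<in> carrier R; y \<in> carrier R\<rbrakk> \<Longrightarrow>
        P \<alpha> x \<otimes>\<^bsub>R\<^esub> P \<beta> y = P \<alpha> (x \<otimes>\<^bsub>R\<^esub> P \<beta> y) \<oplus>\<^bsub>R\<^esub> P \<beta> (P \<alpha> x \<otimes>\<^bsub>R\<^esub> y)"

definition matching_rota_baxter_homs ::
    "('k, 'm) ring_scheme \<Rightarrow> 'w set \<Rightarrow> ('k, 'a, 'n) module_scheme \<Rightarrow> ('w \<Rightarrow> 'a \<Rightarrow> 'a)
      \<Rightarrow> ('k, 'b, 'l) module_scheme \<Rightarrow> ('w \<Rightarrow> 'b \<Rightarrow> 'b) \<Rightarrow> ('a \<Rightarrow> 'b) set"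
  where "matching_rota_baxter_homs k \<Omega> R P R' P' =
    {h \<in> algebra_homs k R R'. \<forall>\<omega>\<in>\<Omega>. \<forall>x\<in>carrier R. h (P \<omega> x) = P' \<omega> (h x)}"

section \<open>The free object\<close>

text \<open>An element \<open>\<omega>\<close> of \<open>\<Omega>\<close> is regarded as the element \<open>basis_elem k \<omega>\<close> of \<open>k\<Omega>\<close>.\<close>

type_synonym ('k, 'w, 'a) sha_letter = "(('w \<Rightarrow> 'k) \<times> 'a \<Rightarrow> 'k) set"

type_synonym ('k, 'w, 'a) sha = "('a \<times> (('k, 'w, 'a) sha_letter list \<Rightarrow> 'k) set \<Rightarrow> 'k) set"

definition sha_letters ::
    "('k, 'm) ring_scheme \<Rightarrow> 'w set \<Rightarrow> ('k, 'a, 'n) module_scheme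
      \<Rightarrow> ('k, ('k, 'w, 'a) sha_letter) module"
  where "sha_letters k \<Omega> A = tensor_product k (free_module k \<Omega>) A"

definition Sha ::
    "('k, 'm) ring_scheme \<Rightarrow> 'w set \<Rightarrow> ('k, 'a, 'n) module_scheme \<Rightarrow> ('k, ('k, 'w, 'a) sha) module"
  where "Sha k \<Omega> A = tensor_product k A (Sh k (sha_letters k \<Omega> A))"

definition sha_tensor ::
    "('k, 'm) ring_scheme \<Rightarrow> 'w set \<Rightarrow> ('k, 'a, 'n) module_scheme
      \<Rightarrow> 'a \<Rightarrow> ('k, 'w, 'a) sha_letter list \<Rightarrow> ('k, 'w, 'a) sha"
  where "sha_tensor k \<Omega> A a vs =
    tensor k A (Sh k (sha_letters k \<Omega> A)) a (word_tensor k (sha_letters k \<Omega> A) vs)"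

text \<open>
  The linear operator that sends \<open>a \<otimes> v\<^sub>1 \<otimes> \<dots> \<otimes> v\<^sub>m\<close> to \<open>1 \<otimes> (\<omega> \<otimes> a) \<otimes> v\<^sub>1 \<otimes> \<dots> \<otimes> v\<^sub>m\<close>,
  normalised to be \<open>undefined\<close> outside the carrier so that it is unique as a HOL function.
\<close>

definition sha_operator ::
    "('k, 'm) ring_scheme \<Rightarrow> 'w set \<Rightarrow> ('k, 'a, 'n) module_scheme
      \<Rightarrow> 'w \<Rightarrow> ('k, 'w, 'a) sha \<Rightarrow> ('k, 'w, 'a) sha"
  where "sha_operator k \<Omega> A \<omega> =
    (THE P. P \<in> extensional (carrier (Sha k \<Omega> A)) \<and>
       P \<in> linear_maps k (Sha k \<Omega> A) (Sha k \<Omega> A) \<and>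
       (\<forall>a\<in>carrier A. \<forall>vs\<in>lists (carrier (sha_letters k \<Omega> A)).
          P (sha_tensor k \<Omega> A a vs) =
            sha_tensor k \<Omega> A \<one>\<^bsub>A\<^esub> (tensor k (free_module k \<Omega>) A (basis_elem k \<omega>) a # vs)))"

definition sha_embedding ::
    "('k, 'm) ring_scheme \<Rightarrow> 'w set \<Rightarrow> ('k, 'a, 'n) module_scheme \<Rightarrow> 'a \<Rightarrow> ('k, 'w, 'a) sha"
  where "sha_embedding k \<Omega> A a =
    tensor k A (Sh k (sha_letters k \<Omega> A)) a \<one>\<^bsub>Sh k (sha_letters k \<Omega> A)\<^esub>"

end

theory Submission
  imports Defs
begin

text \<open>
  Write \<open>v\<cdot>s\<close> for the element of the shuffle algebra obtained from \<open>s\<close> by putting the letter \<open>v\<close> in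
  front. The recursion of the shuffle product says
  \<open>v\<cdot>s * w\<cdot>t = v\<cdot>(s * w\<cdot>t) + w\<cdot>(v\<cdot>s * t)\<close> (lemma \<open>Sh_cons_shuffle\<close>), and this is the matching
  Rota-Baxter identity for the operators \<open>s \<mapsto> v\<cdot>s\<close>. Since \<open>P\<^sub>\<omega> (a \<otimes> s) = 1 \<otimes> (\<omega> \<otimes> a)\<cdot>s\<close>, the identity
  for the operators \<open>P\<^sub>\<omega>\<close> follows at once.

  For the universal property, let \<open>f : A \<rightarrow> R\<close> be given. Uniqueness holds because
  \<open>a \<otimes> s = j a \<diamond> (1 \<otimes> s)\<close> and \<open>1 \<otimes> (\<omega> \<otimes> a)\<cdot>s = P\<^sub>\<omega> (j a \<diamond> (1 \<otimes> s))\<close>: a homomorphism is determined on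
  words by recursion on their length (lemma \<open>Sha_hom_unique\<close>). For existence, the recursion forces
  \<open>\<omega> \<otimes> a\<close> to act on \<open>R\<close> by \<open>r \<mapsto> P\<^sub>\<omega> (f a r)\<close>. This extends to a bilinear action \<open>B\<close> of all letters
  (lemma \<open>letter_action_exists\<close>), which again satisfies
  \<open>B u x B v y = B u (x B v y) + B v (B u x y)\<close>; comparing this with the shuffle recursion shows that
  \<open>v\<^sub>1 \<dots> v\<^sub>n \<mapsto> B v\<^sub>1 (\<dots> (B v\<^sub>n 1))\<close> is multiplicative (lemma \<open>Sh_fold_hom\<close>). The homomorphism sought is
  \<open>a \<otimes> s \<mapsto> f a h s\<close>, where \<open>h\<close> is this map on the shuffle algebra.

  A letter is an arbitrary element of \<open>k\<Omega> \<otimes> A\<close>, not only some \<open>\<omega> \<otimes> a\<close>, and all elements are cosets.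
  Hence every identity is checked on generators and extended by (bi)linearity
  (lemma \<open>bilinear_maps_eq_on_generators\<close>), and every map out of a tensor product or a shuffle algebra
  is obtained from its values on generators (lemma \<open>presented_universal\<close>). To this end both
  constructions are seen as instances of one: a free module on a set with a product prescribed on the
  basis, modulo the submodule generated by some relations. That the product survives in the quotient
  is immediate for tensor products. For shuffles it holds because shuffling a word into
  \<open>us @ [z] @ vs\<close> only puts \<open>z\<close> into contexts that do not depend on \<open>z\<close>
  (lemma \<open>shuffle_insert_letter\<close>), so that the result is still linear in \<open>z\<close>.
\<close>

section \<open>Linear and bilinear maps determined by generators\<close>

definition bilinear_maps ::
    "('k, 'm) ring_scheme \<Rightarrow> ('k, 'a, 'n) module_scheme \<Rightarrow> ('k, 'b, 'l) module_scheme
      \<Rightarrow> ('k, 'c, 'p) module_scheme \<Rightarrow> ('a \<Rightarrow> 'b \<Rightarrow> 'c) set"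
  where "bilinear_maps k M N Q =
    {B. (\<forall>x\<in>carrier M. B x \<in> linear_maps k N Q) \<and>
        (\<forall>y\<in>carrier N. (\<lambda>x. B x y) \<in> linear_maps k M Q)}"

text \<open>
  The inclusion \<open>\<subseteq>\<close> suffices, since the generated submodule of a subset of \<open>M\<close> is contained in \<open>M\<close>.
\<close>

definition generates ::
    "('k, 'm) ring_scheme \<Rightarrow> ('k, 'a, 'n) module_scheme \<Rightarrow> 'a set \<Rightarrow> bool"
  where "generates k M X \<longleftrightarrow> X \<subseteq> carrier M \<and> carrier M \<subseteq> generated_submodule k M X"

lemma linear_mapsI:
  assumes "\<And>x. x \<in> carrier M \<Longrightarrow> h x \<in> carrier N"
    and "\<And>x y. x \<in> carrier M \<Longrightarrow> y \<in> carrier M \<Longrightarrow> h (x \<oplus>\<^bsub>M\<^esub> y) = h x \<oplus>\<^bsub>N\<^esub> h y"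
    and "\<And>c x. c \<in> carrier k \<Longrightarrow> x \<in> carrier M \<Longrightarrow> h (c \<odot>\<^bsub>M\<^esub> x) = c \<odot>\<^bsub>N\<^esub> h x"
  shows "h \<in> linear_maps k M N"
  using assms unfolding linear_maps_def by auto

lemma linear_maps_closed: "h \<in> linear_maps k M N \<Longrightarrow> x \<in> carrier M \<Longrightarrow> h x \<in> carrier N"
  unfolding linear_maps_def by auto

lemma linear_maps_add:
  "h \<in> linear_maps k M N \<Longrightarrow> x \<in> carrier M \<Longrightarrow> y \<in> carrier M \<Longrightarrow> h (x \<oplus>\<^bsub>M\<^esub> y) = h x \<oplus>\<^bsub>N\<^esub> h y"
  unfolding linear_maps_def by auto

lemma linear_maps_smult:
  "h \<in> linear_maps k M N \<Longrightarrow> c \<in> carrier k \<Longrightarrow> x \<in> carrier M \<Longrightarrow> h (c \<odot>\<^bsub>M\<^esub> x) = c \<odot>\<^bsub>N\<^esub> h x"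
  unfolding linear_maps_def by auto

lemma linear_maps_cong:
  assumes "h \<in> linear_maps k M N" "module k M" "\<And>x. x \<in> carrier M \<Longrightarrow> g x = h x"
  shows "g \<in> linear_maps k M N"
proof -
  interpret M: module k M by fact
  show ?thesis
    using assms(1,3) by (intro linear_mapsI) (auto simp: linear_maps_def)
qed

lemma linear_maps_zero:
  assumes "h \<in> linear_maps k M N" "module k M" "module k N"
  shows "h \<zero>\<^bsub>M\<^esub> = \<zero>\<^bsub>N\<^esub>"
proof -
  interpret M: module k M by fact
  interpret N: module k N by fact
  have "h (\<zero>\<^bsub>k\<^esub> \<odot>\<^bsub>M\<^esub> \<zero>\<^bsub>M\<^esub>) = \<zero>\<^bsub>k\<^esub> \<odot>\<^bsub>N\<^esub> h \<zero>\<^bsub>M\<^esub>"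
    by (rule linear_maps_smult[OF assms(1)]) auto
  then show ?thesis
    using linear_maps_closed[OF assms(1) M.zero_closed] by simp
qed

lemma linear_maps_minus:
  assumes "h \<in> linear_maps k M N" "module k M" "module k N" "x \<in> carrier M" "y \<in> carrier M"
  shows "h (x \<ominus>\<^bsub>M\<^esub> y) = h x \<ominus>\<^bsub>N\<^esub> h y"
proof -
  interpret M: module k M by fact
  interpret N: module k N by fact
  note closed = linear_maps_closed[OF assms(1)]
  have "h (x \<ominus>\<^bsub>M\<^esub> y) \<oplus>\<^bsub>N\<^esub> h y = h x"
    using assms(4,5)
    by (simp flip: linear_maps_add[OF assms(1)] add: M.minus_eq M.a_assoc M.l_neg)
  then show ?thesis
    using assms(4,5) closed by (metis M.minus_closed N.add.inv_solve_right N.minus_eq)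
qed

lemma linear_maps_id: "(\<lambda>x. x) \<in> linear_maps k M M"
  by (rule linear_mapsI) auto

lemma linear_maps_compose:
  "g \<in> linear_maps k N Q \<Longrightarrow> f \<in> linear_maps k M N \<Longrightarrow> (\<lambda>x. g (f x)) \<in> linear_maps k M Q"
  unfolding linear_maps_def by (auto simp: Pi_iff)

lemma linear_maps_plus:
  assumes "f \<in> linear_maps k M N" "g \<in> linear_maps k M N" "module k N"
  shows "(\<lambda>x. f x \<oplus>\<^bsub>N\<^esub> g x) \<in> linear_maps k M N"
proof -
  interpret N: module k N by fact
  show ?thesis
    using assms(1,2) unfolding linear_maps_def
    by (auto simp: N.smult_r_distr N.a_ac Pi_iff)
qed

lemma linear_maps_scale:
  assumes "f \<in> linear_maps k M N" "module k N" "c \<in> carrier k"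
  shows "(\<lambda>x. c \<odot>\<^bsub>N\<^esub> f x) \<in> linear_maps k M N"
proof -
  interpret N: module k N by fact
  show ?thesis
    using assms(1,3) unfolding linear_maps_def
    by (auto simp: N.smult_r_distr N.R.m_comm Pi_iff simp flip: N.smult_assoc1)
qed

lemma bilinear_mapsI:
  assumes "\<And>x. x \<in> carrier M \<Longrightarrow> B x \<in> linear_maps k N Q"
    and "\<And>y. y \<in> carrier N \<Longrightarrow> (\<lambda>x. B x y) \<in> linear_maps k M Q"
  shows "B \<in> bilinear_maps k M N Q"
  using assms unfolding bilinear_maps_def by auto

lemma bilinear_maps_right:
  "B \<in> bilinear_maps k M N Q \<Longrightarrow> x \<in> carrier M \<Longrightarrow> B x \<in> linear_maps k N Q"
  unfolding bilinear_maps_def by auto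

lemma bilinear_maps_left:
  "B \<in> bilinear_maps k M N Q \<Longrightarrow> y \<in> carrier N \<Longrightarrow> (\<lambda>x. B x y) \<in> linear_maps k M Q"
  unfolding bilinear_maps_def by auto

lemma bilinear_maps_closed:
  "B \<in> bilinear_maps k M N Q \<Longrightarrow> x \<in> carrier M \<Longrightarrow> y \<in> carrier N \<Longrightarrow> B x y \<in> carrier Q"
  by (rule linear_maps_closed[OF bilinear_maps_right])

lemma bilinear_maps_flip:
  "B \<in> bilinear_maps k M N Q \<Longrightarrow> (\<lambda>y x. B x y) \<in> bilinear_maps k N M Q"
  by (simp add: bilinear_maps_def)

lemma bilinear_maps_mult:
  assumes "algebra k R"
  shows "monoid.mult R \<in> bilinear_maps k R R R"
proof -
  interpret algebra k R by fact
  have smult_assoc2': "x \<otimes>\<^bsub>R\<^esub> (c \<odot>\<^bsub>R\<^esub> y) = c \<odot>\<^bsub>R\<^esub> (x \<otimes>\<^bsub>R\<^esub> y)"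
    if "c \<in> carrier k" "x \<in> carrier R" "y \<in> carrier R" for c x y
    using that smult_assoc2[of c y x] m_comm[of x] by simp
  show ?thesis
    by (intro bilinear_mapsI linear_mapsI)
       (auto simp: l_distr r_distr smult_assoc2 smult_assoc2')
qed

lemma generated_submodule_submodule:
  assumes "module k M" "X \<subseteq> carrier M"
  shows "submodule (generated_submodule k M X) k M"
proof -
  interpret M: module k M by fact
  have H: "submodule (carrier M) k M \<and> X \<subseteq> carrier M"
    using assms(2) M.carrier_is_submodule by simp
  show ?thesis
    unfolding generated_submodule_def
  proof (rule M.submoduleI, goal_cases)
    case 1
    then show ?case using H by blast
  next
    case 2
    have "\<zero>\<^bsub>M\<^esub> \<in> H" if "submodule H k M" for H
      using subgroup.one_closed[OF submodule.axioms(1)[OF that]] by simp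
    then show ?case by blast
  next
    case (3 a)
    then show ?case using M.submoduleE(3) by auto
  next
    case (4 a b)
    then show ?case using M.submoduleE(5) by auto
  next
    case (5 c a)
    then show ?case using M.submoduleE(4) by auto
  qed
qed

lemma subset_generated_submodule: "X \<subseteq> generated_submodule k M X"
  unfolding generated_submodule_def by blast

lemma generated_submodule_minimal:
  "submodule H k M \<Longrightarrow> X \<subseteq> H \<Longrightarrow> generated_submodule k M X \<subseteq> H"
  unfolding generated_submodule_def by blast

lemma generated_submodule_induct:
  assumes "x \<in> generated_submodule k M X" "module k M" "X \<subseteq> carrier M"
    and zero: "P \<zero>\<^bsub>M\<^esub>"
    and add: "\<And>a b. a \<in> carrier M \<Longrightarrow> b \<in> carrier M \<Longrightarrow> P a \<Longrightarrow> P b \<Longrightarrow> P (a \<oplus>\<^bsub>M\<^esub> b)"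
    and smult: "\<And>c a. c \<in> carrier k \<Longrightarrow> a \<in> carrier M \<Longrightarrow> P a \<Longrightarrow> P (c \<odot>\<^bsub>M\<^esub> a)"
    and gen: "\<And>a. a \<in> X \<Longrightarrow> P a"
  shows "P x"
proof -
  interpret M: module k M by fact
  \<comment> \<open>closure under negation comes from the scalar \<open>-1\<close>\<close>
  have "\<ominus>\<^bsub>M\<^esub> a = (\<ominus>\<^bsub>k\<^esub> \<one>\<^bsub>k\<^esub>) \<odot>\<^bsub>M\<^esub> a" if "a \<in> carrier M" for a
    using that by (simp add: M.smult_l_minus)
  then have "submodule {a \<in> carrier M. P a} k M"
    using zero add smult by (intro M.submoduleI) auto
  then have "generated_submodule k M X \<subseteq> {a \<in> carrier M. P a}"
    by (rule generated_submodule_minimal) (use assms(3) gen in auto)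
  then show ?thesis using assms(1) by auto
qed

lemma generates_carrier: "generates k M (carrier M)"
  by (simp add: generates_def subset_generated_submodule)

lemma generates_induct [consumes 3, case_names zero add smult gen]:
  assumes "generates k M X" "module k M" "x \<in> carrier M"
    and "P \<zero>\<^bsub>M\<^esub>"
    and "\<And>a b. a \<in> carrier M \<Longrightarrow> b \<in> carrier M \<Longrightarrow> P a \<Longrightarrow> P b \<Longrightarrow> P (a \<oplus>\<^bsub>M\<^esub> b)"
    and "\<And>c a. c \<in> carrier k \<Longrightarrow> a \<in> carrier M \<Longrightarrow> P a \<Longrightarrow> P (c \<odot>\<^bsub>M\<^esub> a)"
    and "\<And>a. a \<in> X \<Longrightarrow> P a"
  shows "P x"
proof (rule generated_submodule_induct[OF _ assms(2)])
  show "x \<in> generated_submodule k M X" "X \<subseteq> carrier M"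
    using assms(1,3) unfolding generates_def by auto
qed (fact assms)+

lemma linear_maps_vanish_generated:
  assumes "h \<in> linear_maps k M N" "module k M" "module k N" "X \<subseteq> carrier M"
    and "\<And>x. x \<in> X \<Longrightarrow> h x = \<zero>\<^bsub>N\<^esub>" "x \<in> generated_submodule k M X"
  shows "h x = \<zero>\<^bsub>N\<^esub>"
proof -
  interpret N: module k N by fact
  show ?thesis
    by (rule generated_submodule_induct[OF assms(6,2,4)])
       (auto simp: linear_maps_zero[OF assms(1-3)] linear_maps_add[OF assms(1)]
        linear_maps_smult[OF assms(1)] assms(5))
qed

lemma linear_maps_eq_on_generators:
  assumes "generates k M X" "module k M" "module k N"
    and "g \<in> linear_maps k M N" "h \<in> linear_maps k M N"
    and "\<And>x. x \<in> X \<Longrightarrow> g x = h x" "x \<in> carrier M"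
  shows "g x = h x"
  using assms(1,2,7)
proof (induction x rule: generates_induct)
  case zero
  then show ?case using linear_maps_zero[OF _ assms(2,3)] assms(4,5) by metis
next
  case (add a b)
  then show ?case using linear_maps_add[OF assms(4)] linear_maps_add[OF assms(5)] by simp
next
  case (smult c a)
  then show ?case using linear_maps_smult[OF assms(4)] linear_maps_smult[OF assms(5)] by simp
qed (rule assms(6))

lemma bilinear_maps_eq_on_generators:
  assumes "generates k M X" "generates k N Y" "module k M" "module k N" "module k Q"
    and B: "B \<in> bilinear_maps k M N Q" and B': "B' \<in> bilinear_maps k M N Q"
    and eq: "\<And>x y. x \<in> X \<Longrightarrow> y \<in> Y \<Longrightarrow> B x y = B' x y"
    and "x \<in> carrier M" "y \<in> carrier N"
  shows "B x y = B' x y"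
proof -
  have X: "X \<subseteq> carrier M" using assms(1) unfolding generates_def by simp
  have "B a y = B' a y" if "a \<in> X" for a
  proof (rule linear_maps_eq_on_generators[OF assms(2,4,5) _ _ _ assms(10), of "B a" "B' a"])
    show "B a \<in> linear_maps k N Q" "B' a \<in> linear_maps k N Q"
      using X that bilinear_maps_right[OF B] bilinear_maps_right[OF B'] by auto
  qed (rule eq[OF that])
  then show ?thesis
    using linear_maps_eq_on_generators[OF assms(1,3,5) bilinear_maps_left[OF B assms(10)]
        bilinear_maps_left[OF B' assms(10)] _ assms(9)] by simp
qed

text \<open>
  The elements \<open>x\<close> for which \<open>B x\<close> is linear form a submodule when \<open>B\<close> is linear in \<open>x\<close>. This is how the
  bilinear maps below arise: they are constructed by a universal property in one variable, with
  the other one fixed, and are known explicitly only on generators.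
\<close>

lemma bilinear_maps_from_generators:
  assumes "generates k M X" "module k M" "module k N" "module k Q"
    and left: "\<And>y. y \<in> carrier N \<Longrightarrow> (\<lambda>x. B x y) \<in> linear_maps k M Q"
    and gen: "\<And>x. x \<in> X \<Longrightarrow> B x \<in> linear_maps k N Q"
  shows "B \<in> bilinear_maps k M N Q"
proof (rule bilinear_mapsI)
  interpret M: module k M by fact
  interpret N: module k N by fact
  interpret Q: module k Q by fact
  fix x assume "x \<in> carrier M"
  with assms(1,2) show "B x \<in> linear_maps k N Q"
  proof (induction x rule: generates_induct)
    case zero
    have "(\<lambda>y. \<zero>\<^bsub>Q\<^esub>) \<in> linear_maps k N Q" by (rule linear_mapsI) auto
    then show ?case
      by (rule linear_maps_cong[OF _ assms(3)]) (use linear_maps_zero[OF left assms(2,4)] in simp)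
  next
    case (add a b)
    show ?case
      by (rule linear_maps_cong[OF linear_maps_plus[OF add(3,4) assms(4)] assms(3)])
         (use linear_maps_add[OF left] add in simp)
  next
    case (smult c a)
    show ?case
      by (rule linear_maps_cong[OF linear_maps_scale[OF smult(3) assms(4) smult(1)] assms(3)])
         (use linear_maps_smult[OF left] smult in simp)
  qed (rule gen)
qed (rule left)

lemma algebra_homs_from_generators:
  assumes "algebra k Q" "algebra k R" "generates k Q X" "g \<in> linear_maps k Q R"
    and "g \<one>\<^bsub>Q\<^esub> = \<one>\<^bsub>R\<^esub>"
    and "\<And>x y. x \<in> X \<Longrightarrow> y \<in> X \<Longrightarrow> g (x \<otimes>\<^bsub>Q\<^esub> y) = g x \<otimes>\<^bsub>R\<^esub> g y"
  shows "g \<in> algebra_homs k Q R"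
proof -
  interpret Q: algebra k Q by fact
  interpret R: algebra k R by fact
  note bil = bilinear_maps_mult[OF assms(1)] and bil' = bilinear_maps_mult[OF assms(2)]
  note closed = linear_maps_closed[OF assms(4)]
  have bil1: "(\<lambda>x y. g (x \<otimes>\<^bsub>Q\<^esub> y)) \<in> bilinear_maps k Q Q R"
    by (intro bilinear_mapsI linear_maps_compose[OF assms(4)] bilinear_maps_right[OF bil]
        bilinear_maps_left[OF bil])
  have bil2: "(\<lambda>x y. g x \<otimes>\<^bsub>R\<^esub> g y) \<in> bilinear_maps k Q Q R"
    by (intro bilinear_mapsI linear_maps_compose[OF bilinear_maps_right[OF bil'] assms(4)]
        linear_maps_compose[OF bilinear_maps_left[OF bil'] assms(4)] closed)
  have "g (x \<otimes>\<^bsub>Q\<^esub> y) = g x \<otimes>\<^bsub>R\<^esub> g y" if "x \<in> carrier Q" "y \<in> carrier Q" for x y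
    by (rule bilinear_maps_eq_on_generators[OF assms(3,3) Q.module Q.module R.module bil1 bil2
          assms(6) that])
  then have "g \<in> ring_hom Q R"
    using assms(5) closed linear_maps_add[OF assms(4)] by (intro ring_hom_memI) auto
  then show ?thesis using assms(4) by (simp add: algebra_homs_def)
qed

text \<open>
  Both sides of the identity are bilinear in \<open>x\<close> and \<open>y\<close>. The identity occurs for two kinds of operators:
  the \<open>P\<^sub>\<omega>\<close>, and those that put a letter in front of the words of the shuffle algebra.
\<close>

lemma rota_baxter_from_generators:
  assumes "algebra k R" "generates k R X" "p \<in> linear_maps k R R" "q \<in> linear_maps k R R"
    and "\<And>x y. x \<in> X \<Longrightarrow> y \<in> X \<Longrightarrow> p x \<otimes>\<^bsub>R\<^esub> q y = p (x \<otimes>\<^bsub>R\<^esub> q y) \<oplus>\<^bsub>R\<^esub> q (p x \<otimes>\<^bsub>R\<^esub> y)"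
    and "x \<in> carrier R" "y \<in> carrier R"
  shows "p x \<otimes>\<^bsub>R\<^esub> q y = p (x \<otimes>\<^bsub>R\<^esub> q y) \<oplus>\<^bsub>R\<^esub> q (p x \<otimes>\<^bsub>R\<^esub> y)"
proof -
  interpret R: algebra k R by fact
  note R = R.module
  note mult = bilinear_maps_mult[OF assms(1)]
  have bil1: "(\<lambda>s t. p s \<otimes>\<^bsub>R\<^esub> q t) \<in> bilinear_maps k R R R"
    by (intro bilinear_mapsI linear_maps_compose[OF bilinear_maps_right[OF mult] assms(4)]
        linear_maps_compose[OF bilinear_maps_left[OF mult] assms(3)] linear_maps_closed[OF assms(3)]
        linear_maps_closed[OF assms(4)])
  have bil2: "(\<lambda>s t. p (s \<otimes>\<^bsub>R\<^esub> q t)) \<in> bilinear_maps k R R R"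
    by (intro bilinear_mapsI linear_maps_compose[OF assms(3)]
        linear_maps_compose[OF bilinear_maps_right[OF mult] assms(4)] bilinear_maps_left[OF mult]
        linear_maps_closed[OF assms(4)])
  have bil3: "(\<lambda>s t. q (p s \<otimes>\<^bsub>R\<^esub> t)) \<in> bilinear_maps k R R R"
    by (intro bilinear_mapsI linear_maps_compose[OF assms(4)] bilinear_maps_right[OF mult]
        linear_maps_compose[OF bilinear_maps_left[OF mult] assms(3)] linear_maps_closed[OF assms(3)])
  have bil4: "(\<lambda>s t. p (s \<otimes>\<^bsub>R\<^esub> q t) \<oplus>\<^bsub>R\<^esub> q (p s \<otimes>\<^bsub>R\<^esub> t)) \<in> bilinear_maps k R R R"
    by (intro bilinear_mapsI linear_maps_plus R bilinear_maps_right[OF bil2] bilinear_maps_right[OF bil3]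
        bilinear_maps_left[OF bil2] bilinear_maps_left[OF bil3])
  show ?thesis
    by (rule bilinear_maps_eq_on_generators[OF assms(2,2) R R R bil1 bil4 assms(5-7)])
qed

section \<open>Free modules\<close>

definition linear_extension ::
    "('k, 'm) ring_scheme \<Rightarrow> ('k, 'a, 'n) module_scheme \<Rightarrow> ('s \<Rightarrow> 'a) \<Rightarrow> ('s \<Rightarrow> 'k) \<Rightarrow> 'a"
  where "linear_extension k M \<phi> p = (\<Oplus>\<^bsub>M\<^esub>s \<in> {s. p s \<noteq> \<zero>\<^bsub>k\<^esub>}. p s \<odot>\<^bsub>M\<^esub> \<phi> s)"

text \<open>
  The sum of the basis elements in a multiset, which is what the product of two basis elements is.
\<close>

definition mset_vector :: "('k, 'm) ring_scheme \<Rightarrow> 's multiset \<Rightarrow> 's \<Rightarrow> 'k"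
  where "mset_vector k m = (\<lambda>s. [count m s] \<cdot>\<^bsub>k\<^esub> \<one>\<^bsub>k\<^esub>)"

text \<open>
  Replacing the product of an algebra does not affect the module structure, so that everything about
  \<open>free_module\<close> carries over to \<open>free_algebra\<close>.
\<close>

lemma module_cong:
  assumes "module k M" "carrier N = carrier M" "add N = add M" "zero N = zero M"
    "smult N = smult M"
  shows "module k N"
proof -
  interpret M: module k M by fact
  have "abelian_group N"
  proof (rule abelian_groupI)
    fix x assume "x \<in> carrier N"
    then show "\<exists>y\<in>carrier N. y \<oplus>\<^bsub>N\<^esub> x = \<zero>\<^bsub>N\<^esub>"
      using M.l_neg M.a_inv_closed unfolding assms by blast
  qed (auto simp: assms M.a_ac)
  then show ?thesis
    by (intro moduleI)
       (auto simp: assms M.R.is_cring M.smult_l_distr M.smult_r_distr M.smult_assoc1)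
qed

lemma generates_cong:
  assumes "generates k M X" "carrier N = carrier M" "add N = add M" "zero N = zero M"
    "smult N = smult M"
  shows "generates k N X"
proof -
  have "submodule H k N = submodule H k M" for H
    by (simp add: submodule_def submodule_axioms_def subgroup_def assms(2-5) m_inv_def)
  then show ?thesis
    using assms(1) by (simp add: generates_def generated_submodule_def assms(2))
qed

context
  fixes k :: "('k, 'm) ring_scheme" and S :: "'s set"
  assumes k: "cring k"
begin

interpretation K: cring k by (rule k)

lemma free_module_simps:
  "carrier (free_module k S) = {p. (\<forall>s\<in>S. p s \<in> carrier k) \<and> (\<forall>s. s \<notin> S \<longrightarrow> p s = \<zero>\<^bsub>k\<^esub>)
     \<and> finite {s. p s \<noteq> \<zero>\<^bsub>k\<^esub>}}"
  "\<zero>\<^bsub>free_module k S\<^esub> = (\<lambda>s. \<zero>\<^bsub>k\<^esub>)"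
  "p \<oplus>\<^bsub>free_module k S\<^esub> q = (\<lambda>s. p s \<oplus>\<^bsub>k\<^esub> q s)"
  "c \<odot>\<^bsub>free_module k S\<^esub> p = (\<lambda>s. c \<otimes>\<^bsub>k\<^esub> p s)"
  by (simp_all add: free_module_def)

lemma free_module_in_ring: "p \<in> carrier (free_module k S) \<Longrightarrow> p s \<in> carrier k"
  by (cases "s \<in> S") (auto simp: free_module_simps)

lemma free_module_support_subset: "p \<in> carrier (free_module k S) \<Longrightarrow> {s. p s \<noteq> \<zero>\<^bsub>k\<^esub>} \<subseteq> S"
  by (auto simp: free_module_simps)

lemma free_module_finite_support: "p \<in> carrier (free_module k S) \<Longrightarrow> finite {s. p s \<noteq> \<zero>\<^bsub>k\<^esub>}"
  by (auto simp: free_module_simps)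

lemma module_free_module: "module k (free_module k S)"
proof -
  let ?F = "free_module k S"
  have add: "p \<oplus>\<^bsub>?F\<^esub> q \<in> carrier ?F" if "p \<in> carrier ?F" "q \<in> carrier ?F" for p q
  proof -
    have "finite ({s. p s \<noteq> \<zero>\<^bsub>k\<^esub>} \<union> {s. q s \<noteq> \<zero>\<^bsub>k\<^esub>})"
      using that by (simp add: free_module_finite_support)
    then have "finite {s. p s \<oplus>\<^bsub>k\<^esub> q s \<noteq> \<zero>\<^bsub>k\<^esub>}"
      by (rule rev_finite_subset) auto
    then show ?thesis using that by (simp add: free_module_simps)
  qed
  have smult: "c \<odot>\<^bsub>?F\<^esub> p \<in> carrier ?F" if "c \<in> carrier k" "p \<in> carrier ?F" for c p
  proof -
    have "finite {s. c \<otimes>\<^bsub>k\<^esub> p s \<noteq> \<zero>\<^bsub>k\<^esub>}"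
      by (rule rev_finite_subset[OF free_module_finite_support[OF that(2)]]) (use that in auto)
    then show ?thesis using that by (simp add: free_module_simps)
  qed
  note ring = free_module_in_ring
  have "abelian_group ?F"
  proof (rule abelian_groupI)
    fix p assume p: "p \<in> carrier ?F"
    have "(\<ominus>\<^bsub>k\<^esub> \<one>\<^bsub>k\<^esub>) \<odot>\<^bsub>?F\<^esub> p \<oplus>\<^bsub>?F\<^esub> p = \<zero>\<^bsub>?F\<^esub>"
      using ring[OF p] by (auto simp: free_module_simps K.l_minus K.l_neg)
    then show "\<exists>q\<in>carrier ?F. q \<oplus>\<^bsub>?F\<^esub> p = \<zero>\<^bsub>?F\<^esub>"
      using smult[OF _ p, of "\<ominus>\<^bsub>k\<^esub> \<one>\<^bsub>k\<^esub>"] by auto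
  next
    fix p q r assume "p \<in> carrier ?F" "q \<in> carrier ?F" "r \<in> carrier ?F"
    note pqr = ring[OF this(1)] ring[OF this(2)] ring[OF this(3)]
    show "p \<oplus>\<^bsub>?F\<^esub> q \<oplus>\<^bsub>?F\<^esub> r = p \<oplus>\<^bsub>?F\<^esub> (q \<oplus>\<^bsub>?F\<^esub> r)"
      using pqr by (simp add: free_module_simps(3) K.a_assoc)
  next
    fix p q assume "p \<in> carrier ?F" "q \<in> carrier ?F"
    note pq = ring[OF this(1)] ring[OF this(2)]
    show "p \<oplus>\<^bsub>?F\<^esub> q = q \<oplus>\<^bsub>?F\<^esub> p"
      using pq by (simp add: free_module_simps(3) K.a_comm)
  next
    fix p assume "p \<in> carrier ?F"
    then show "\<zero>\<^bsub>?F\<^esub> \<oplus>\<^bsub>?F\<^esub> p = p"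
      using ring[OF \<open>p \<in> carrier ?F\<close>] by (simp add: free_module_simps(2,3))
  qed (simp_all add: add, simp add: free_module_simps)
  then show ?thesis
  proof (rule moduleI[OF k _ smult])
    fix a b p assume "a \<in> carrier k" "b \<in> carrier k" "p \<in> carrier ?F"
    note p = this(1,2) ring[OF this(3)]
    show "(a \<oplus>\<^bsub>k\<^esub> b) \<odot>\<^bsub>?F\<^esub> p = a \<odot>\<^bsub>?F\<^esub> p \<oplus>\<^bsub>?F\<^esub> b \<odot>\<^bsub>?F\<^esub> p"
      "(a \<otimes>\<^bsub>k\<^esub> b) \<odot>\<^bsub>?F\<^esub> p = a \<odot>\<^bsub>?F\<^esub> (b \<odot>\<^bsub>?F\<^esub> p)"
      using p by (simp_all add: free_module_simps(3,4) K.l_distr K.m_assoc)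
  next
    fix a p q assume "a \<in> carrier k" "p \<in> carrier ?F" "q \<in> carrier ?F"
    note p = this(1) ring[OF this(2)] ring[OF this(3)]
    show "a \<odot>\<^bsub>?F\<^esub> (p \<oplus>\<^bsub>?F\<^esub> q) = a \<odot>\<^bsub>?F\<^esub> p \<oplus>\<^bsub>?F\<^esub> a \<odot>\<^bsub>?F\<^esub> q"
      using p by (simp add: free_module_simps(3,4) K.r_distr)
  next
    fix p assume "p \<in> carrier ?F"
    then show "\<one>\<^bsub>k\<^esub> \<odot>\<^bsub>?F\<^esub> p = p"
      using ring[OF \<open>p \<in> carrier ?F\<close>] by (simp add: free_module_simps(4))
  qed
qed

lemma basis_elem_closed: "s \<in> S \<Longrightarrow> basis_elem k s \<in> carrier (free_module k S)"
  by (auto simp: free_module_simps basis_elem_def intro!: finite_subset[of _ "{s}"])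

text \<open>
  Induction on a finite set that contains the support: a basis element is split off from the
  function at each step.
\<close>

lemma generates_free_module: "generates k (free_module k S) (basis_elem k ` S)"
proof -
  let ?F = "free_module k S"
  interpret F: module k ?F by (rule module_free_module)
  have X: "basis_elem k ` S \<subseteq> carrier ?F" by (auto simp: basis_elem_closed)
  let ?H = "generated_submodule k ?F (basis_elem k ` S)"
  have H: "submodule ?H k ?F"
    by (rule generated_submodule_submodule[OF module_free_module X])
  have "\<And>p. p \<in> carrier ?F \<Longrightarrow> {s. p s \<noteq> \<zero>\<^bsub>k\<^esub>} \<subseteq> T \<Longrightarrow> p \<in> ?H" if "finite T" for T
    using that
  proof (induction T)
    case empty
    then have "p = \<zero>\<^bsub>?F\<^esub>" by (auto simp: free_module_simps)
    then show ?case using subgroup.one_closed[OF submodule.axioms(1)[OF H]] by simp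
  next
    case (insert t T)
    show ?case
    proof (cases "t \<in> S")
      case True
      have fin: "finite {s. s \<noteq> t \<and> p s \<noteq> \<zero>\<^bsub>k\<^esub>}"
        by (rule rev_finite_subset[OF free_module_finite_support[OF insert(4)]]) auto
      have "p(t := \<zero>\<^bsub>k\<^esub>) \<in> ?H"
        by (rule insert.IH) (use insert(4,5) True fin in \<open>auto simp: free_module_simps cong: conj_cong\<close>)
      moreover have "p t \<odot>\<^bsub>?F\<^esub> basis_elem k t \<in> ?H"
        using True insert(4) subset_generated_submodule[of "basis_elem k ` S" k ?F]
        by (intro F.submoduleE(4)[OF H] free_module_in_ring) auto
      moreover have "p = p(t := \<zero>\<^bsub>k\<^esub>) \<oplus>\<^bsub>?F\<^esub> p t \<odot>\<^bsub>?F\<^esub> basis_elem k t"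
        using free_module_in_ring[OF insert(4)]
        by (auto simp: free_module_simps basis_elem_def)
      ultimately show ?thesis using F.submoduleE(5)[OF H] by metis
    next
      case False
      then have "p t = \<zero>\<^bsub>k\<^esub>" using insert(4) by (auto simp: free_module_simps)
      then show ?thesis using insert(4,5) by (intro insert.IH) auto
    qed
  qed
  then have "p \<in> ?H" if "p \<in> carrier ?F" for p
    using free_module_finite_support[OF that] that by blast
  then show ?thesis
    using X unfolding generates_def by blast
qed

text \<open>
  Two functions have different supports, so the sums over the supports can only be compared after
  extending both to a common index set.
\<close>

lemma linear_extension_superset:
  assumes "module k M" "\<phi> \<in> S \<rightarrow> carrier M" "p \<in> carrier (free_module k S)"
    and "finite T" "T \<subseteq> S" "{s. p s \<noteq> \<zero>\<^bsub>k\<^esub>} \<subseteq> T"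
  shows "linear_extension k M \<phi> p = (\<Oplus>\<^bsub>M\<^esub>s \<in> T. p s \<odot>\<^bsub>M\<^esub> \<phi> s)"
proof -
  interpret M: module k M by fact
  show ?thesis
    unfolding linear_extension_def
    using assms free_module_in_ring[OF assms(3)]
    by (intro M.add.finprod_mono_neutral_cong_left) (auto simp: Pi_iff subset_iff)
qed

lemma linear_extension_linear:
  assumes "module k M" "\<phi> \<in> S \<rightarrow> carrier M"
  shows "linear_extension k M \<phi> \<in> linear_maps k (free_module k S) M"
proof -
  interpret M: module k M by fact
  interpret F: module k "free_module k S" by (rule module_free_module)
  note ring = free_module_in_ring and supp = free_module_support_subset
    and fin = free_module_finite_support and ext = linear_extension_superset[OF assms]
  show ?thesis
  proof (rule linear_mapsI, goal_cases)
    case (1 p)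
    then show ?case
      using assms(2) supp[OF 1] ring[OF 1] unfolding linear_extension_def
      by (intro M.finsum_closed) (auto simp: Pi_iff subset_iff)
  next
    case (2 p q)
    let ?T = "{s. p s \<noteq> \<zero>\<^bsub>k\<^esub>} \<union> {s. q s \<noteq> \<zero>\<^bsub>k\<^esub>}"
    have T: "finite ?T" "?T \<subseteq> S" using 2 supp fin by auto
    have "(\<Oplus>\<^bsub>M\<^esub>s \<in> ?T. (p s \<oplus>\<^bsub>k\<^esub> q s) \<odot>\<^bsub>M\<^esub> \<phi> s)
        = (\<Oplus>\<^bsub>M\<^esub>s \<in> ?T. p s \<odot>\<^bsub>M\<^esub> \<phi> s \<oplus>\<^bsub>M\<^esub> q s \<odot>\<^bsub>M\<^esub> \<phi> s)"
      using T(2) assms(2) ring[OF 2(1)] ring[OF 2(2)]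
      by (intro M.finsum_cong') (auto simp: Pi_iff subset_iff M.smult_l_distr)
    also have "\<dots> = (\<Oplus>\<^bsub>M\<^esub>s \<in> ?T. p s \<odot>\<^bsub>M\<^esub> \<phi> s) \<oplus>\<^bsub>M\<^esub> (\<Oplus>\<^bsub>M\<^esub>s \<in> ?T. q s \<odot>\<^bsub>M\<^esub> \<phi> s)"
      using T(2) assms(2) ring[OF 2(1)] ring[OF 2(2)]
      by (intro M.finsum_addf) (auto simp: Pi_iff subset_iff)
    moreover have "linear_extension k M \<phi> (p \<oplus>\<^bsub>free_module k S\<^esub> q)
        = (\<Oplus>\<^bsub>M\<^esub>s \<in> ?T. (p \<oplus>\<^bsub>free_module k S\<^esub> q) s \<odot>\<^bsub>M\<^esub> \<phi> s)"
      using 2 T by (intro ext F.add.m_closed) (auto simp: free_module_simps(3))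
    ultimately show ?case
      using ext[OF 2(1) T] ext[OF 2(2) T] by (simp add: free_module_simps(3))
  next
    case (3 c p)
    let ?T = "{s. p s \<noteq> \<zero>\<^bsub>k\<^esub>}"
    have "c \<odot>\<^bsub>M\<^esub> (\<Oplus>\<^bsub>M\<^esub>s \<in> ?T. p s \<odot>\<^bsub>M\<^esub> \<phi> s) = (\<Oplus>\<^bsub>M\<^esub>s \<in> ?T. c \<odot>\<^bsub>M\<^esub> (p s \<odot>\<^bsub>M\<^esub> \<phi> s))"
      using 3(1) assms(2) ring[OF 3(2)] supp[OF 3(2)]
      by (intro M.finsum_smult_ldistr fin[OF 3(2)]) (auto simp: Pi_iff subset_iff)
    also have "\<dots> = (\<Oplus>\<^bsub>M\<^esub>s \<in> ?T. (c \<otimes>\<^bsub>k\<^esub> p s) \<odot>\<^bsub>M\<^esub> \<phi> s)"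
      using 3(1) assms(2) ring[OF 3(2)] supp[OF 3(2)]
      by (intro M.finsum_cong') (auto simp: Pi_iff subset_iff M.smult_assoc1)
    moreover have "linear_extension k M \<phi> (c \<odot>\<^bsub>free_module k S\<^esub> p)
        = (\<Oplus>\<^bsub>M\<^esub>s \<in> ?T. (c \<odot>\<^bsub>free_module k S\<^esub> p) s \<odot>\<^bsub>M\<^esub> \<phi> s)"
      using 3 fin[OF 3(2)] supp[OF 3(2)]
      by (intro ext F.smult_closed) (auto simp: free_module_simps(4))
    ultimately show ?case
      using ext[OF 3(2) fin[OF 3(2)] supp[OF 3(2)]] by (simp add: free_module_simps(4))
  qed
qed

lemma linear_extension_basis_elem:
  assumes "module k M" "\<phi> \<in> S \<rightarrow> carrier M" "s \<in> S"
  shows "linear_extension k M \<phi> (basis_elem k s) = \<phi> s"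
proof -
  interpret M: module k M by fact
  have "linear_extension k M \<phi> (basis_elem k s) = (\<Oplus>\<^bsub>M\<^esub>t \<in> {s}. basis_elem k s t \<odot>\<^bsub>M\<^esub> \<phi> t)"
    by (rule linear_extension_superset[OF assms(1,2) basis_elem_closed])
       (use assms(3) in \<open>auto simp: basis_elem_def\<close>)
  also have "\<dots> = \<phi> s"
    using assms(2,3) M.finsum_insert[of "{}" s "\<lambda>t. basis_elem k s t \<odot>\<^bsub>M\<^esub> \<phi> t"]
    by (auto simp: basis_elem_def Pi_iff)
  finally show ?thesis .
qed

section \<open>The bilinear product with prescribed values on the basis\<close>

lemma free_algebra_simps:
  "carrier (free_algebra k S mul e) = carrier (free_module k S)"
  "add (free_algebra k S mul e) = add (free_module k S)"
  "zero (free_algebra k S mul e) = zero (free_module k S)"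
  "smult (free_algebra k S mul e) = smult (free_module k S)"
  "one (free_algebra k S mul e) = basis_elem k e"
  by (simp_all add: free_algebra_def)

lemma module_free_algebra: "module k (free_algebra k S mul e)"
  by (rule module_cong[OF module_free_module]) (simp_all add: free_algebra_simps)

lemma generates_free_algebra: "generates k (free_algebra k S mul e) (basis_elem k ` S)"
  by (rule generates_cong[OF generates_free_module]) (simp_all add: free_algebra_simps)

lemma linear_maps_free_algebra:
  "linear_maps k (free_algebra k S mul e) M = linear_maps k (free_module k S) M"
  by (simp add: linear_maps_def free_algebra_simps)

lemma mset_vector_closed:
  assumes "set_mset m \<subseteq> S"
  shows "mset_vector k m \<in> carrier (free_module k S)"
proof -
  have "count m s = 0" if "s \<notin> S" for s
    using assms that by (auto simp: count_eq_zero_iff)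
  moreover have "[count m s] \<cdot>\<^bsub>k\<^esub> \<one>\<^bsub>k\<^esub> = \<zero>\<^bsub>k\<^esub>" if "s \<notin># m" for s
    using that by (simp add: not_in_iff)
  then have "finite {s. [count m s] \<cdot>\<^bsub>k\<^esub> \<one>\<^bsub>k\<^esub> \<noteq> \<zero>\<^bsub>k\<^esub>}"
    by (intro finite_subset[OF _ finite_set_mset[of m]] subsetI) (use \<open>\<And>s. s \<notin># m \<Longrightarrow> [count m s] \<cdot>\<^bsub>k\<^esub> \<one>\<^bsub>k\<^esub> = \<zero>\<^bsub>k\<^esub>\<close> in blast)
  ultimately show ?thesis
    by (simp add: free_module_simps mset_vector_def)
qed

lemma mset_vector_single: "mset_vector k {#s#} = basis_elem k s"
  by (auto simp: mset_vector_def basis_elem_def)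

lemma mset_vector_add:
  "mset_vector k (m + m') = mset_vector k m \<oplus>\<^bsub>free_module k S\<^esub> mset_vector k m'"
  by (auto simp: mset_vector_def free_module_simps K.add.nat_pow_mult)

lemma mset_vector_empty: "mset_vector k {#} = \<zero>\<^bsub>free_module k S\<^esub>"
  by (auto simp: mset_vector_def free_module_simps)

text \<open>
  As for \<open>linear_extension_superset\<close>, this makes bilinearity accessible. The multiplicities are turned
  into ring elements, so that only ring arithmetic is left.
\<close>

lemma free_algebra_mult_superset:
  assumes "p \<in> carrier (free_module k S)" "q \<in> carrier (free_module k S)"
    and "finite U" "finite V" "{s. p s \<noteq> \<zero>\<^bsub>k\<^esub>} \<subseteq> U" "{s. q s \<noteq> \<zero>\<^bsub>k\<^esub>} \<subseteq> V"
  shows "(p \<otimes>\<^bsub>free_algebra k S mul e\<^esub> q) s = (\<Oplus>\<^bsub>k\<^esub>uv \<in> U \<times> V.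
      ([count (mul (fst uv) (snd uv)) s] \<cdot>\<^bsub>k\<^esub> \<one>\<^bsub>k\<^esub>) \<otimes>\<^bsub>k\<^esub> (p (fst uv) \<otimes>\<^bsub>k\<^esub> q (snd uv)))"
proof -
  note ring = free_module_in_ring[OF assms(1)] free_module_in_ring[OF assms(2)]
  have eq: "[n] \<cdot>\<^bsub>k\<^esub> x = ([n] \<cdot>\<^bsub>k\<^esub> \<one>\<^bsub>k\<^esub>) \<otimes>\<^bsub>k\<^esub> x" if "x \<in> carrier k" for x and n :: nat
    using that by (simp add: K.add_pow_ldistr)
  have "(\<Oplus>\<^bsub>k\<^esub>uv \<in> {s. p s \<noteq> \<zero>\<^bsub>k\<^esub>} \<times> {s. q s \<noteq> \<zero>\<^bsub>k\<^esub>}.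
      [count (mul (fst uv) (snd uv)) s] \<cdot>\<^bsub>k\<^esub> (p (fst uv) \<otimes>\<^bsub>k\<^esub> q (snd uv))) = (\<Oplus>\<^bsub>k\<^esub>uv \<in> U \<times> V.
      ([count (mul (fst uv) (snd uv)) s] \<cdot>\<^bsub>k\<^esub> \<one>\<^bsub>k\<^esub>) \<otimes>\<^bsub>k\<^esub> (p (fst uv) \<otimes>\<^bsub>k\<^esub> q (snd uv)))"
    using assms(3-6) ring
    by (intro K.add.finprod_mono_neutral_cong_left) (auto intro!: eq)
  then show ?thesis by (simp add: free_algebra_def)
qed

lemma free_algebra_mult_basis:
  assumes "u \<in> S" "v \<in> S"
  shows "basis_elem k u \<otimes>\<^bsub>free_algebra k S mul e\<^esub> basis_elem k v = mset_vector k (mul u v)"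
proof
  fix s
  have "(basis_elem k u \<otimes>\<^bsub>free_algebra k S mul e\<^esub> basis_elem k v) s = (\<Oplus>\<^bsub>k\<^esub>uv \<in> {u} \<times> {v}.
      ([count (mul (fst uv) (snd uv)) s] \<cdot>\<^bsub>k\<^esub> \<one>\<^bsub>k\<^esub>)
        \<otimes>\<^bsub>k\<^esub> (basis_elem k u (fst uv) \<otimes>\<^bsub>k\<^esub> basis_elem k v (snd uv)))"
    using assms by (intro free_algebra_mult_superset basis_elem_closed) (auto simp: basis_elem_def)
  then show "(basis_elem k u \<otimes>\<^bsub>free_algebra k S mul e\<^esub> basis_elem k v) s = mset_vector k (mul u v) s"
    by (simp add: basis_elem_def mset_vector_def)
qed

lemma free_algebra_mult_closed:
  assumes "\<And>u v. u \<in> S \<Longrightarrow> v \<in> S \<Longrightarrow> set_mset (mul u v) \<subseteq> S"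
    and "p \<in> carrier (free_module k S)" "q \<in> carrier (free_module k S)"
  shows "p \<otimes>\<^bsub>free_algebra k S mul e\<^esub> q \<in> carrier (free_module k S)"
proof -
  let ?UV = "{s. p s \<noteq> \<zero>\<^bsub>k\<^esub>} \<times> {s. q s \<noteq> \<zero>\<^bsub>k\<^esub>}"
  let ?T = "\<Union>uv\<in>?UV. set_mset (mul (fst uv) (snd uv))"
  note ring = free_module_in_ring[OF assms(2)] free_module_in_ring[OF assms(3)]
  have outside: "(p \<otimes>\<^bsub>free_algebra k S mul e\<^esub> q) s = \<zero>\<^bsub>k\<^esub>" if "s \<notin> ?T" for s
  proof -
    have "s \<notin># mul (fst uv) (snd uv)" if "uv \<in> ?UV" for uv
      using that \<open>s \<notin> ?T\<close> by blast
    then have "count (mul (fst uv) (snd uv)) s = 0" if "uv \<in> ?UV" for uv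
      using that by (simp add: count_eq_zero_iff)
    then have "(\<Oplus>\<^bsub>k\<^esub>uv \<in> ?UV. [count (mul (fst uv) (snd uv)) s] \<cdot>\<^bsub>k\<^esub>
        (p (fst uv) \<otimes>\<^bsub>k\<^esub> q (snd uv))) = \<zero>\<^bsub>k\<^esub>"
      by (intro K.add.finprod_one_eqI) simp
    then show ?thesis by (simp add: free_algebra_def)
  qed
  have "?T \<subseteq> S"
    using assms(1) free_module_support_subset[OF assms(2)] free_module_support_subset[OF assms(3)]
    by force
  moreover have "finite ?T"
    using free_module_finite_support[OF assms(2)] free_module_finite_support[OF assms(3)] by auto
  then have "finite {s. (p \<otimes>\<^bsub>free_algebra k S mul e\<^esub> q) s \<noteq> \<zero>\<^bsub>k\<^esub>}"
    by (rule rev_finite_subset) (use outside in blast)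
  moreover have "(p \<otimes>\<^bsub>free_algebra k S mul e\<^esub> q) s \<in> carrier k" for s
    using ring by (auto simp: free_algebra_def)
  moreover have "(p \<otimes>\<^bsub>free_algebra k S mul e\<^esub> q) s = \<zero>\<^bsub>k\<^esub>" if "s \<notin> S" for s
    using outside that \<open>?T \<subseteq> S\<close> by blast
  ultimately show ?thesis
    by (simp add: free_module_simps(1))
qed

lemma free_algebra_mult_bilinear:
  fixes e
  assumes "\<And>u v. u \<in> S \<Longrightarrow> v \<in> S \<Longrightarrow> set_mset (mul u v) \<subseteq> S"
  defines "F \<equiv> free_algebra k S mul e"
  shows "monoid.mult F \<in> bilinear_maps k F F F"
proof -
  interpret F: module k F unfolding F_def by (rule module_free_algebra)
  have F [simp]: "carrier F = carrier (free_module k S)" "add F = add (free_module k S)"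
    "smult F = smult (free_module k S)"
    unfolding F_def by (simp_all add: free_algebra_simps)
  note fin = free_module_finite_support
  note super = free_algebra_mult_superset[of _ _ _ _ mul e, folded F_def]
  have closed: "p \<otimes>\<^bsub>F\<^esub> q \<in> carrier F" if "p \<in> carrier F" "q \<in> carrier F" for p q
    using free_algebra_mult_closed[OF assms(1)] that unfolding F_def by (simp add: free_algebra_simps)
  have coeff: "[n] \<cdot>\<^bsub>k\<^esub> \<one>\<^bsub>k\<^esub> \<in> carrier k" for n :: nat by simp
  show ?thesis
  proof (intro bilinear_mapsI linear_mapsI closed)
    fix p q r assume p: "p \<in> carrier F" and q: "q \<in> carrier F" and r: "r \<in> carrier F"
    let ?U = "{s. p s \<noteq> \<zero>\<^bsub>k\<^esub>}" and ?V = "{s. q s \<noteq> \<zero>\<^bsub>k\<^esub>} \<union> {s. r s \<noteq> \<zero>\<^bsub>k\<^esub>}"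
    have qr: "q \<oplus>\<^bsub>F\<^esub> r \<in> carrier F" using q r by (rule F.M.add.m_closed)
    have UV: "finite ?U" "finite ?V" using p q r fin by auto
    have ring: "p s \<in> carrier k" "q s \<in> carrier k" "r s \<in> carrier k" for s
      using p q r free_module_in_ring by simp_all
    have V: "{s. (q \<oplus>\<^bsub>F\<^esub> r) s \<noteq> \<zero>\<^bsub>k\<^esub>} \<subseteq> ?V" by (auto simp: free_module_simps(3))
    show "p \<otimes>\<^bsub>F\<^esub> (q \<oplus>\<^bsub>F\<^esub> r) = p \<otimes>\<^bsub>F\<^esub> q \<oplus>\<^bsub>F\<^esub> p \<otimes>\<^bsub>F\<^esub> r"
      using p q r qr UV V coeff ring
      by (auto simp: super[where U = ?U and V = ?V] free_module_simps(3) K.r_distr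
          intro!: ext simp flip: K.finsum_addf)
    show "(q \<oplus>\<^bsub>F\<^esub> r) \<otimes>\<^bsub>F\<^esub> p = q \<otimes>\<^bsub>F\<^esub> p \<oplus>\<^bsub>F\<^esub> r \<otimes>\<^bsub>F\<^esub> p"
      using p q r qr UV V coeff ring
      by (auto simp: super[where U = ?V and V = ?U] free_module_simps(3) K.r_distr K.l_distr
          intro!: ext simp flip: K.finsum_addf)
  next
    fix p q c assume p: "p \<in> carrier F" and q: "q \<in> carrier F" and c: "c \<in> carrier k"
    let ?U = "{s. p s \<noteq> \<zero>\<^bsub>k\<^esub>}" and ?V = "{s. q s \<noteq> \<zero>\<^bsub>k\<^esub>}"
    have cq: "c \<odot>\<^bsub>F\<^esub> q \<in> carrier F" using c q by (rule F.smult_closed)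
    have UV: "finite ?U" "finite ?V" using p q fin by auto
    have ring: "p s \<in> carrier k" "q s \<in> carrier k" for s
      using p q free_module_in_ring by simp_all
    have V: "{s. (c \<odot>\<^bsub>F\<^esub> q) s \<noteq> \<zero>\<^bsub>k\<^esub>} \<subseteq> ?V" using c by (auto simp: free_module_simps(4))
    show "p \<otimes>\<^bsub>F\<^esub> (c \<odot>\<^bsub>F\<^esub> q) = c \<odot>\<^bsub>F\<^esub> (p \<otimes>\<^bsub>F\<^esub> q)"
      using p q c cq UV V coeff ring
      by (auto simp: super[where U = ?U and V = ?V] free_module_simps(4) K.finsum_rdistr K.m_lcomm
          Pi_iff intro!: ext K.finsum_cong')
    show "(c \<odot>\<^bsub>F\<^esub> q) \<otimes>\<^bsub>F\<^esub> p = c \<odot>\<^bsub>F\<^esub> (q \<otimes>\<^bsub>F\<^esub> p)"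
      using p q c cq UV V coeff ring
      by (auto simp: super[where U = ?V and V = ?U] free_module_simps(4) K.finsum_rdistr K.m_lcomm
          K.m_assoc Pi_iff intro!: ext K.finsum_cong')
  qed
qed

lemma linear_map_mset_vector:
  assumes "h \<in> linear_maps k (free_module k S) (free_module k S)" "set_mset m \<subseteq> S"
    and "\<And>s. s \<in> S \<Longrightarrow> h (basis_elem k s) = mset_vector k (\<phi> s)"
  shows "h (mset_vector k m) = mset_vector k (\<Sum>\<^sub># (image_mset \<phi> m))"
  using assms(2)
proof (induction m)
  case empty
  show ?case
    using linear_maps_zero[OF assms(1) module_free_module module_free_module]
    by (simp add: mset_vector_empty)
next
  case (add s m)
  have "h (mset_vector k (add_mset s m)) = h (mset_vector k {#s#} \<oplus>\<^bsub>free_module k S\<^esub> mset_vector k m)"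
    by (simp flip: mset_vector_add)
  also have "\<dots> = h (mset_vector k {#s#}) \<oplus>\<^bsub>free_module k S\<^esub> h (mset_vector k m)"
    using add.prems by (intro linear_maps_add[OF assms(1)] mset_vector_closed) auto
  finally show ?case
    using add by (simp add: mset_vector_single assms(3) mset_vector_add)
qed

text \<open>
  The laws are multilinear, so that they follow from those for basis elements, where they are the
  stated identities of multisets.
\<close>

lemma algebra_free_algebra:
  assumes closed: "\<And>u v. u \<in> S \<Longrightarrow> v \<in> S \<Longrightarrow> set_mset (mul u v) \<subseteq> S"
    and comm: "\<And>u v. u \<in> S \<Longrightarrow> v \<in> S \<Longrightarrow> mul u v = mul v u"
    and assoc: "\<And>u v w. u \<in> S \<Longrightarrow> v \<in> S \<Longrightarrow> w \<in> S \<Longrightarrow>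
      \<Sum>\<^sub># (image_mset (\<lambda>a. mul a w) (mul u v)) = \<Sum>\<^sub># (image_mset (mul u) (mul v w))"
    and unit: "e \<in> S" "\<And>u. u \<in> S \<Longrightarrow> mul e u = {#u#}"
  shows "algebra k (free_algebra k S mul e)"
proof -
  let ?F = "free_algebra k S mul e"
  interpret F: module k ?F by (rule module_free_algebra)
  note mod = module_free_algebra[of mul e]
  note gen = generates_free_algebra[of mul e]
  have bil: "monoid.mult ?F \<in> bilinear_maps k ?F ?F ?F"
    by (rule free_algebra_mult_bilinear) (rule closed)
  note cl = bilinear_maps_closed[OF bil]
  note lin = bilinear_maps_right[OF bil] bilinear_maps_left[OF bil]
  have X: "basis_elem k s \<in> carrier ?F" if "s \<in> S" for s
    using that by (simp add: free_algebra_simps basis_elem_closed)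
  have bil': "(\<lambda>p q. q \<otimes>\<^bsub>?F\<^esub> p) \<in> bilinear_maps k ?F ?F ?F"
    by (intro bilinear_mapsI lin)
  have m_comm: "p \<otimes>\<^bsub>?F\<^esub> q = q \<otimes>\<^bsub>?F\<^esub> p" if "p \<in> carrier ?F" "q \<in> carrier ?F" for p q
    by (rule bilinear_maps_eq_on_generators[OF gen gen mod mod mod bil bil' _ that])
       (auto simp: free_algebra_mult_basis comm)
  have mult_vector: "mset_vector k m \<otimes>\<^bsub>?F\<^esub> basis_elem k w = mset_vector k (\<Sum>\<^sub># (image_mset (\<lambda>a. mul a w) m))"
    "basis_elem k w \<otimes>\<^bsub>?F\<^esub> mset_vector k m = mset_vector k (\<Sum>\<^sub># (image_mset (mul w) m))"
    if "set_mset m \<subseteq> S" "w \<in> S" for m w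
    using lin[OF X[OF that(2)]] that
    by (auto intro!: linear_map_mset_vector[where h = "\<lambda>p. p \<otimes>\<^bsub>?F\<^esub> basis_elem k w"]
        linear_map_mset_vector[where h = "\<lambda>p. basis_elem k w \<otimes>\<^bsub>?F\<^esub> p"] free_algebra_mult_basis
        simp: linear_maps_def free_algebra_simps)
  have assoc_basis: "(basis_elem k u \<otimes>\<^bsub>?F\<^esub> basis_elem k v) \<otimes>\<^bsub>?F\<^esub> basis_elem k w
      = basis_elem k u \<otimes>\<^bsub>?F\<^esub> (basis_elem k v \<otimes>\<^bsub>?F\<^esub> basis_elem k w)"
    if "u \<in> S" "v \<in> S" "w \<in> S" for u v w
    using that closed by (simp add: free_algebra_mult_basis mult_vector assoc)
  have assoc_basis': "(basis_elem k u \<otimes>\<^bsub>?F\<^esub> basis_elem k v) \<otimes>\<^bsub>?F\<^esub> r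
      = basis_elem k u \<otimes>\<^bsub>?F\<^esub> (basis_elem k v \<otimes>\<^bsub>?F\<^esub> r)"
    if "u \<in> S" "v \<in> S" "r \<in> carrier ?F" for u v r
    using that
    by (intro linear_maps_eq_on_generators[OF gen mod mod lin(1)
          linear_maps_compose[OF lin(1) lin(1)] _ that(3)])
       (auto intro: cl X simp: assoc_basis)
  have m_assoc: "(p \<otimes>\<^bsub>?F\<^esub> q) \<otimes>\<^bsub>?F\<^esub> r = p \<otimes>\<^bsub>?F\<^esub> (q \<otimes>\<^bsub>?F\<^esub> r)"
    if "p \<in> carrier ?F" "q \<in> carrier ?F" "r \<in> carrier ?F" for p q r
  proof (rule bilinear_maps_eq_on_generators[OF gen gen mod mod mod _ _ _ that(1,2),
        where B = "\<lambda>p q. (p \<otimes>\<^bsub>?F\<^esub> q) \<otimes>\<^bsub>?F\<^esub> r" and B' = "\<lambda>p q. p \<otimes>\<^bsub>?F\<^esub> (q \<otimes>\<^bsub>?F\<^esub> r)"])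
    show "(\<lambda>p q. p \<otimes>\<^bsub>?F\<^esub> q \<otimes>\<^bsub>?F\<^esub> r) \<in> bilinear_maps k ?F ?F ?F"
      using linear_maps_compose[OF lin(2)[OF that(3)]] by (intro bilinear_mapsI) (auto intro: lin)
    show "(\<lambda>p q. p \<otimes>\<^bsub>?F\<^esub> (q \<otimes>\<^bsub>?F\<^esub> r)) \<in> bilinear_maps k ?F ?F ?F"
      using linear_maps_compose[OF lin(1) lin(2)[OF that(3)]] cl that(3)
      by (intro bilinear_mapsI) (auto intro: lin)
  qed (use that(3) in \<open>auto simp: assoc_basis'\<close>)
  have m_one: "\<one>\<^bsub>?F\<^esub> \<otimes>\<^bsub>?F\<^esub> p = p" if "p \<in> carrier ?F" for p
  proof (rule linear_maps_eq_on_generators[OF gen mod mod _ linear_maps_id _ that])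
    show "monoid.mult ?F \<one>\<^bsub>?F\<^esub> \<in> linear_maps k ?F ?F"
      using X[OF unit(1)] by (intro lin(1)) (simp add: free_algebra_simps(5))
  qed (use unit in \<open>auto simp: free_algebra_simps(5) free_algebra_mult_basis mset_vector_single\<close>)
  have "comm_monoid ?F"
  proof (rule comm_monoidI)
    show "\<one>\<^bsub>?F\<^esub> \<in> carrier ?F"
      using X[OF unit(1)] by (simp add: free_algebra_simps(5))
  qed (fact cl m_assoc m_one m_comm)+
  then have "cring ?F"
    by (rule cringI[OF F.M.abelian_group_axioms]) (rule linear_maps_add[OF lin(2)])
  then show ?thesis
    by (rule algebraI[OF k])
       (simp_all add: F.smult_l_distr F.smult_r_distr F.smult_assoc1 linear_maps_smult[OF lin(2)])
qed

end

section \<open>Quotients by generated submodules\<close>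

context
  fixes k :: "('k, 'm) ring_scheme" and M :: "('k, 'v, 'n) module_scheme" and I :: "'v set"
  assumes M: "module k M" and I: "submodule I k M"
begin

interpretation M: module k M by (rule M)

interpretation I: abelian_subgroup I M
  by (intro abelian_subgroupI3 additive_subgroupI submodule.axioms(1)[OF I]
      M.M.abelian_group_axioms)

lemma quotient_carrier: "carrier (quotient_module M I) = (\<lambda>x. I +>\<^bsub>M\<^esub> x) ` carrier M"
  by (simp add: quotient_module_def FactRing_def A_RCOSETS_def' a_r_coset_def' UNION_singleton_eq_range)

lemma quotient_zero: "\<zero>\<^bsub>quotient_module M I\<^esub> = I +>\<^bsub>M\<^esub> \<zero>\<^bsub>M\<^esub>"
  by (simp add: quotient_module_def FactRing_def I.a_subset)

lemma quotient_add:
  "x \<in> carrier M \<Longrightarrow> y \<in> carrier M \<Longrightarrow>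
    (I +>\<^bsub>M\<^esub> x) \<oplus>\<^bsub>quotient_module M I\<^esub> (I +>\<^bsub>M\<^esub> y) = I +>\<^bsub>M\<^esub> (x \<oplus>\<^bsub>M\<^esub> y)"
  by (simp add: quotient_module_def FactRing_def I.a_rcos_sum)

lemma coset_eq_iff:
  assumes "x \<in> carrier M" "y \<in> carrier M"
  shows "I +>\<^bsub>M\<^esub> x = I +>\<^bsub>M\<^esub> y \<longleftrightarrow> x \<ominus>\<^bsub>M\<^esub> y \<in> I"
proof -
  have "x \<in> I +>\<^bsub>M\<^esub> y \<longleftrightarrow> x \<ominus>\<^bsub>M\<^esub> y \<in> I"
    using I.a_rcos_module[OF assms(2,1)] by (simp add: M.minus_eq)
  then show ?thesis
    using assms I.a_rcos_self I.a_repr_independence' by metis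
qed

lemma quotient_smult:
  assumes "c \<in> carrier k" "x \<in> carrier M"
  shows "c \<odot>\<^bsub>quotient_module M I\<^esub> (I +>\<^bsub>M\<^esub> x) = I +>\<^bsub>M\<^esub> (c \<odot>\<^bsub>M\<^esub> x)"
proof -
  have "I +>\<^bsub>M\<^esub> (c \<odot>\<^bsub>M\<^esub> y) = I +>\<^bsub>M\<^esub> (c \<odot>\<^bsub>M\<^esub> x)" if "y \<in> I +>\<^bsub>M\<^esub> x" for y
  proof -
    have y: "y \<in> carrier M" by (rule I.a_elemrcos_carrier[OF assms(2) that])
    have "y \<ominus>\<^bsub>M\<^esub> x \<in> I"
      using that assms y I.a_rcos_module by (simp add: M.minus_eq)
    then have "c \<odot>\<^bsub>M\<^esub> (y \<ominus>\<^bsub>M\<^esub> x) \<in> I"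
      using M.submoduleE(4)[OF I] assms by blast
    moreover have "c \<odot>\<^bsub>M\<^esub> (y \<ominus>\<^bsub>M\<^esub> x) = c \<odot>\<^bsub>M\<^esub> y \<ominus>\<^bsub>M\<^esub> c \<odot>\<^bsub>M\<^esub> x"
      using assms y by (simp add: M.minus_eq M.smult_r_distr M.smult_r_minus)
    ultimately show ?thesis
      using assms y by (simp add: coset_eq_iff)
  qed
  then have "(\<Union>y\<in>I +>\<^bsub>M\<^esub> x. I +>\<^bsub>M\<^esub> (c \<odot>\<^bsub>M\<^esub> y)) = (\<Union>y\<in>I +>\<^bsub>M\<^esub> x. I +>\<^bsub>M\<^esub> (c \<odot>\<^bsub>M\<^esub> x))"
    by (rule SUP_cong[OF refl])
  also have "\<dots> = I +>\<^bsub>M\<^esub> (c \<odot>\<^bsub>M\<^esub> x)"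
    using I.a_rcos_self[OF assms(2)] by (intro SUP_const) blast
  finally show ?thesis by (simp add: quotient_module_def)
qed

lemma module_quotient_module: "module k (quotient_module M I)"
proof -
  have "abelian_group (quotient_module M I)"
  proof (rule abelian_groupI)
    fix X assume "X \<in> carrier (quotient_module M I)"
    then obtain x where x: "x \<in> carrier M" "X = I +>\<^bsub>M\<^esub> x" by (auto simp: quotient_carrier)
    have "(I +>\<^bsub>M\<^esub> (\<ominus>\<^bsub>M\<^esub> x)) \<oplus>\<^bsub>quotient_module M I\<^esub> X = \<zero>\<^bsub>quotient_module M I\<^esub>"
      using x by (simp add: quotient_add quotient_zero M.l_neg)
    then show "\<exists>Y\<in>carrier (quotient_module M I).
        Y \<oplus>\<^bsub>quotient_module M I\<^esub> X = \<zero>\<^bsub>quotient_module M I\<^esub>"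
      using x by (auto simp: quotient_carrier)
  qed (clarsimp simp: quotient_carrier quotient_add quotient_zero M.a_ac)+
  then show ?thesis
  proof (rule moduleI[OF M.R.is_cring])
    fix a b X assume "a \<in> carrier k" "b \<in> carrier k" "X \<in> carrier (quotient_module M I)"
    then show "(a \<oplus>\<^bsub>k\<^esub> b) \<odot>\<^bsub>quotient_module M I\<^esub> X =
        a \<odot>\<^bsub>quotient_module M I\<^esub> X \<oplus>\<^bsub>quotient_module M I\<^esub> b \<odot>\<^bsub>quotient_module M I\<^esub> X"
      "(a \<otimes>\<^bsub>k\<^esub> b) \<odot>\<^bsub>quotient_module M I\<^esub> X =
        a \<odot>\<^bsub>quotient_module M I\<^esub> (b \<odot>\<^bsub>quotient_module M I\<^esub> X)"
      by (clarsimp simp: quotient_carrier quotient_add quotient_smult M.smult_l_distr M.smult_assoc1)+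
  next
    fix a X Y assume "a \<in> carrier k" "X \<in> carrier (quotient_module M I)"
      "Y \<in> carrier (quotient_module M I)"
    then show "a \<odot>\<^bsub>quotient_module M I\<^esub> (X \<oplus>\<^bsub>quotient_module M I\<^esub> Y) =
        a \<odot>\<^bsub>quotient_module M I\<^esub> X \<oplus>\<^bsub>quotient_module M I\<^esub> a \<odot>\<^bsub>quotient_module M I\<^esub> Y"
      by (clarsimp simp: quotient_carrier quotient_add quotient_smult M.smult_r_distr)
  next
    fix a X assume "a \<in> carrier k" "X \<in> carrier (quotient_module M I)"
    then show "a \<odot>\<^bsub>quotient_module M I\<^esub> X \<in> carrier (quotient_module M I)"
      by (clarsimp simp: quotient_carrier quotient_smult)
  next
    fix X assume "X \<in> carrier (quotient_module M I)"
    then show "\<one>\<^bsub>k\<^esub> \<odot>\<^bsub>quotient_module M I\<^esub> X = X"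
      by (clarsimp simp: quotient_carrier quotient_smult)
  qed
qed

lemma generates_quotient_module:
  assumes "generates k M X"
  shows "generates k (quotient_module M I) ((\<lambda>x. I +>\<^bsub>M\<^esub> x) ` X)"
proof -
  let ?Q = "quotient_module M I"
  let ?H = "generated_submodule k ?Q ((\<lambda>x. I +>\<^bsub>M\<^esub> x) ` X)"
  interpret Q: module k ?Q by (rule module_quotient_module)
  have X: "(\<lambda>x. I +>\<^bsub>M\<^esub> x) ` X \<subseteq> carrier ?Q"
    using assms by (auto simp: generates_def quotient_carrier)
  have H: "submodule ?H k ?Q"
    by (rule generated_submodule_submodule[OF module_quotient_module X])
  have "I +>\<^bsub>M\<^esub> x \<in> ?H" if "x \<in> carrier M" for x
    using assms M that
  proof (induction x rule: generates_induct)
    case zero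
    show ?case using subgroup.one_closed[OF submodule.axioms(1)[OF H]] by (simp add: quotient_zero)
  next
    case (add a b)
    then show ?case using Q.submoduleE(5)[OF H] by (simp flip: quotient_add)
  next
    case (smult c a)
    then show ?case using Q.submoduleE(4)[OF H] by (simp flip: quotient_smult)
  next
    case (gen a)
    then show ?case by (intro subset_generated_submodule[THEN subsetD] imageI)
  qed
  then show ?thesis using X by (auto simp: generates_def quotient_carrier)
qed

lemma quotient_module_universal:
  assumes "module k N" "h \<in> linear_maps k M N" "\<And>x. x \<in> I \<Longrightarrow> h x = \<zero>\<^bsub>N\<^esub>"
  obtains g where "g \<in> linear_maps k (quotient_module M I) N"
    "\<And>x. x \<in> carrier M \<Longrightarrow> g (I +>\<^bsub>M\<^esub> x) = h x"
proof
  interpret N: module k N by fact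
  \<comment> \<open>the value does not depend on the representative, since \<open>h\<close> kills \<open>I\<close>\<close>
  define g where "g X = h (SOME x. x \<in> X)" for X
  show g: "g (I +>\<^bsub>M\<^esub> x) = h x" if x: "x \<in> carrier M" for x
  proof -
    define y where "y = (SOME y. y \<in> I +>\<^bsub>M\<^esub> x)"
    have y: "y \<in> I +>\<^bsub>M\<^esub> x"
      unfolding y_def by (rule someI[of _ x]) (rule I.a_rcos_self[OF x])
    then have y': "y \<in> carrier M" using x I.a_elemrcos_carrier by blast
    have "y \<ominus>\<^bsub>M\<^esub> x \<in> I"
      using y y' x I.a_rcos_module by (simp add: M.minus_eq)
    then have "h y \<ominus>\<^bsub>N\<^esub> h x = \<zero>\<^bsub>N\<^esub>"
      using linear_maps_minus[OF assms(2) M assms(1) y' x] assms(3) by metis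
    moreover have "h y = (h y \<ominus>\<^bsub>N\<^esub> h x) \<oplus>\<^bsub>N\<^esub> h x"
      using linear_maps_closed[OF assms(2) x] linear_maps_closed[OF assms(2) y']
      by (simp add: N.minus_eq N.a_assoc N.l_neg)
    ultimately have "h y = h x"
      using linear_maps_closed[OF assms(2) x] by simp
    then show ?thesis by (simp add: g_def y_def)
  qed
  show "g \<in> linear_maps k (quotient_module M I) N"
    by (rule linear_mapsI)
       (auto simp: quotient_carrier quotient_add quotient_smult g linear_maps_closed[OF assms(2)]
        linear_maps_add[OF assms(2)] linear_maps_smult[OF assms(2)])
qed

end

text \<open>
  The ring laws come from the factor ring of the library; only the scalar multiplication is new.
\<close>

lemma algebra_quotient_module:
  assumes "algebra k M" "submodule I k M"
    and "\<And>x y. x \<in> carrier M \<Longrightarrow> y \<in> I \<Longrightarrow> x \<otimes>\<^bsub>M\<^esub> y \<in> I"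
  shows "algebra k (quotient_module M I)"
    and "\<And>x y. x \<in> carrier M \<Longrightarrow> y \<in> carrier M \<Longrightarrow>
      (I +>\<^bsub>M\<^esub> x) \<otimes>\<^bsub>quotient_module M I\<^esub> (I +>\<^bsub>M\<^esub> y) = I +>\<^bsub>M\<^esub> (x \<otimes>\<^bsub>M\<^esub> y)"
    and "\<one>\<^bsub>quotient_module M I\<^esub> = I +>\<^bsub>M\<^esub> \<one>\<^bsub>M\<^esub>"
proof -
  interpret M: algebra k M by fact
  have M: "module k M" by (rule M.module)
  note quot = quotient_carrier[OF M assms(2)] quotient_add[OF M assms(2)]
    quotient_smult[OF M assms(2)]
  have sub: "I \<subseteq> carrier M" by (rule M.submoduleE(1)[OF assms(2)])
  interpret I: ideal I M
  proof (rule idealI)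
    show "ring M" using M.M_cring by (rule cring.axioms(1))
    show "subgroup I (add_monoid M)" by (rule submodule.axioms(1)[OF assms(2)])
    fix a x assume "a \<in> I" "x \<in> carrier M"
    then show "x \<otimes>\<^bsub>M\<^esub> a \<in> I" "a \<otimes>\<^bsub>M\<^esub> x \<in> I"
      using assms(3)[of x a] sub M.m_comm[of x a] by (auto simp: subset_iff)
  qed
  show mult: "(I +>\<^bsub>M\<^esub> x) \<otimes>\<^bsub>quotient_module M I\<^esub> (I +>\<^bsub>M\<^esub> y) = I +>\<^bsub>M\<^esub> (x \<otimes>\<^bsub>M\<^esub> y)"
    if "x \<in> carrier M" "y \<in> carrier M" for x y
    using that by (simp add: quotient_module_def FactRing_def I.rcoset_mult_add)
  show "\<one>\<^bsub>quotient_module M I\<^esub> = I +>\<^bsub>M\<^esub> \<one>\<^bsub>M\<^esub>"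
    by (simp add: quotient_module_def FactRing_def)
  interpret Q: module k "quotient_module M I" by (rule module_quotient_module[OF M assms(2)])
  interpret R: cring "M Quot I" by (rule I.quotient_is_cring[OF M.M_cring])
  have Quot: "carrier (quotient_module M I) = carrier (M Quot I)"
    "monoid.mult (quotient_module M I) = monoid.mult (M Quot I)"
    "add (quotient_module M I) = add (M Quot I)"
    "\<one>\<^bsub>quotient_module M I\<^esub> = \<one>\<^bsub>M Quot I\<^esub>"
    by (simp_all add: quotient_module_def)
  have "comm_monoid (quotient_module M I)"
    by (rule comm_monoidI) (simp_all add: Quot R.m_assoc, rule R.m_comm)
  then have "cring (quotient_module M I)"
    by (rule cringI[OF Q.M.abelian_group_axioms]) (simp add: Quot R.l_distr)
  then show "algebra k (quotient_module M I)"
    by (rule algebraI[OF M.R_cring])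
       (simp_all add: Q.smult_l_distr Q.smult_r_distr Q.smult_assoc1,
        auto simp: quot mult M.smult_assoc2)
qed

text \<open>
  For fixed \<open>y\<close> the elements \<open>x\<close> whose product with \<open>y\<close> lies in a submodule form a submodule, and
  likewise with the two factors exchanged. So it suffices to multiply generators.
\<close>

lemma generated_submodule_ideal:
  assumes "algebra k M" "generates k M Y" "X \<subseteq> carrier M"
    and "\<And>x y. x \<in> X \<Longrightarrow> y \<in> Y \<Longrightarrow> y \<otimes>\<^bsub>M\<^esub> x \<in> generated_submodule k M X"
    and "y \<in> carrier M" "x \<in> generated_submodule k M X"
  shows "y \<otimes>\<^bsub>M\<^esub> x \<in> generated_submodule k M X"
proof -
  interpret M: algebra k M by fact
  have M: "module k M" by (rule M.module)
  let ?I = "generated_submodule k M X"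
  have I: "submodule ?I k M" by (rule generated_submodule_submodule[OF M assms(3)])
  note bil = bilinear_maps_mult[OF assms(1)]
  have zero: "\<zero>\<^bsub>M\<^esub> \<in> ?I" using subgroup.one_closed[OF submodule.axioms(1)[OF I]] by simp
  have X: "y \<otimes>\<^bsub>M\<^esub> a \<in> ?I" if "a \<in> X" for a
  proof -
    have a: "a \<in> carrier M" using that assms(3) by blast
    note lin = bilinear_maps_left[OF bil a]
    show ?thesis
      using assms(2) M assms(5)
    proof (induction y rule: generates_induct)
      case zero
      show ?case using linear_maps_zero[OF lin M M] \<open>\<zero>\<^bsub>M\<^esub> \<in> ?I\<close> by simp
    next
      case (add b c)
      then show ?case using linear_maps_add[OF lin] M.submoduleE(5)[OF I] by simp
    next
      case (smult b c)
      then show ?case using linear_maps_smult[OF lin] M.submoduleE(4)[OF I] by simp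
    qed (rule assms(4)[OF that])
  qed
  note lin = bilinear_maps_right[OF bil assms(5)]
  show ?thesis
    using assms(6) M assms(3)
  proof (rule generated_submodule_induct)
    show "y \<otimes>\<^bsub>M\<^esub> \<zero>\<^bsub>M\<^esub> \<in> ?I" using linear_maps_zero[OF lin M M] zero by simp
  next
    fix a b assume "a \<in> carrier M" "b \<in> carrier M" "y \<otimes>\<^bsub>M\<^esub> a \<in> ?I" "y \<otimes>\<^bsub>M\<^esub> b \<in> ?I"
    then show "y \<otimes>\<^bsub>M\<^esub> (a \<oplus>\<^bsub>M\<^esub> b) \<in> ?I"
      using linear_maps_add[OF lin] M.submoduleE(5)[OF I] by simp
  next
    fix a c assume "c \<in> carrier k" "a \<in> carrier M" "y \<otimes>\<^bsub>M\<^esub> a \<in> ?I"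
    then show "y \<otimes>\<^bsub>M\<^esub> (c \<odot>\<^bsub>M\<^esub> a) \<in> ?I"
      using linear_maps_smult[OF lin] M.submoduleE(4)[OF I] by simp
  qed (rule X)
qed

section \<open>Algebras given by a basis and linear relations\<close>

text \<open>
  The common form of the tensor product and of the shuffle algebra. For a tensor product of mere
  modules \<open>mul\<close> and \<open>e\<close> carry no meaning.
\<close>

definition presented_algebra ::
    "('k, 'm) ring_scheme \<Rightarrow> 's set \<Rightarrow> ('s \<Rightarrow> 's \<Rightarrow> 's multiset) \<Rightarrow> 's \<Rightarrow> ('s \<Rightarrow> 'k) set
      \<Rightarrow> ('k, ('s \<Rightarrow> 'k) set) module"
  where "presented_algebra k S mul e X =
    quotient_module (free_algebra k S mul e) (generated_submodule k (free_algebra k S mul e) X)"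

definition presented_class ::
    "('k, 'm) ring_scheme \<Rightarrow> 's set \<Rightarrow> ('s \<Rightarrow> 's \<Rightarrow> 's multiset) \<Rightarrow> 's \<Rightarrow> ('s \<Rightarrow> 'k) set
      \<Rightarrow> 's \<Rightarrow> ('s \<Rightarrow> 'k) set"
  where "presented_class k S mul e X s =
    generated_submodule k (free_algebra k S mul e) X +>\<^bsub>free_algebra k S mul e\<^esub> basis_elem k s"

lemmas presented_defs = presented_algebra_def presented_class_def

context
  fixes k :: "('k, 'm) ring_scheme" and S :: "'s set" and mul :: "'s \<Rightarrow> 's \<Rightarrow> 's multiset" and e :: 's
    and X :: "('s \<Rightarrow> 'k) set"
  assumes k: "cring k" and X: "X \<subseteq> carrier (free_algebra k S mul e)"
begin

private abbreviation (input) "F \<equiv> free_algebra k S mul e"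
private abbreviation (input) "I \<equiv> generated_submodule k F X"
private abbreviation (input) "Q \<equiv> presented_algebra k S mul e X"
private abbreviation (input) "cls \<equiv> presented_class k S mul e X"

lemma relations_submodule: "submodule I k F"
  by (rule generated_submodule_submodule[OF module_free_algebra[OF k] X])

lemma module_presented: "module k Q"
  unfolding presented_algebra_def
  by (rule module_quotient_module[OF module_free_algebra[OF k] relations_submodule])

lemma free_basis_closed: "s \<in> S \<Longrightarrow> basis_elem k s \<in> carrier F"
  by (simp add: presented_defs free_algebra_simps[OF k] basis_elem_closed[OF k])

lemma class_closed: "s \<in> S \<Longrightarrow> cls s \<in> carrier Q"
  by (simp add: presented_defs quotient_carrier[OF module_free_algebra[OF k] relations_submodule] free_basis_closed)

lemma generates_presented: "generates k Q ((\<lambda>s. cls s) ` S)"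
  using generates_quotient_module[OF module_free_algebra[OF k] relations_submodule
      generates_free_algebra[OF k]]
  by (simp add: presented_defs image_image)

text \<open>
  The linear extension of \<open>\<phi>\<close> to the free module kills the relations and so factors through the
  quotient. The condition is stated for any linear map with values \<open>\<phi>\<close> on the basis, which is all
  that is needed to evaluate it on a relation.
\<close>

lemma presented_universal:
  assumes "module k N" "\<phi> \<in> S \<rightarrow> carrier N"
    and "\<And>h x. \<lbrakk>h \<in> linear_maps k F N; \<And>s. s \<in> S \<Longrightarrow> h (basis_elem k s) = \<phi> s; x \<in> X\<rbrakk> \<Longrightarrow> h x = \<zero>\<^bsub>N\<^esub>"
  obtains g where "g \<in> linear_maps k Q N" "\<And>s. s \<in> S \<Longrightarrow> g (cls s) = \<phi> s"
proof -
  let ?h = "linear_extension k N \<phi>"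
  have h: "?h \<in> linear_maps k F N"
    unfolding linear_maps_free_algebra[OF k] by (rule linear_extension_linear[OF k assms(1,2)])
  have basis: "?h (basis_elem k s) = \<phi> s" if "s \<in> S" for s
    by (rule linear_extension_basis_elem[OF k assms(1,2) that])
  have "?h x = \<zero>\<^bsub>N\<^esub>" if "x \<in> I" for x
    by (rule linear_maps_vanish_generated[OF h module_free_algebra[OF k] assms(1) X _ that])
       (rule assms(3)[OF h basis])
  from quotient_module_universal[OF module_free_algebra[OF k] relations_submodule assms(1) h this]
  obtain g where "g \<in> linear_maps k Q N" "\<And>x. x \<in> carrier F \<Longrightarrow> g (I +>\<^bsub>F\<^esub> x) = ?h x"
    unfolding presented_algebra_def by blast
  with that show thesis using basis free_basis_closed by (simp add: presented_class_def)
qed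

lemma class_add_relation:
  assumes "basis_elem k r \<ominus>\<^bsub>F\<^esub> (basis_elem k s \<oplus>\<^bsub>F\<^esub> basis_elem k t) \<in> X"
    "r \<in> S" "s \<in> S" "t \<in> S"
  shows "cls r = cls s \<oplus>\<^bsub>Q\<^esub> cls t"
proof -
  interpret F: module k F by (rule module_free_algebra[OF k])
  note F = F.module_axioms
  have "cls r = I +>\<^bsub>F\<^esub> (basis_elem k s \<oplus>\<^bsub>F\<^esub> basis_elem k t)"
    using assms subset_generated_submodule[of X k F]
    by (simp only: presented_class_def, subst coset_eq_iff[OF F relations_submodule]) (auto simp: free_basis_closed)
  then show ?thesis
    using assms by (simp add: presented_defs quotient_add[OF F relations_submodule] free_basis_closed)
qed

lemma class_smult_relation:
  assumes "basis_elem k r \<ominus>\<^bsub>F\<^esub> (c \<odot>\<^bsub>F\<^esub> basis_elem k s) \<in> X" "c \<in> carrier k" "r \<in> S" "s \<in> S"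
  shows "cls r = c \<odot>\<^bsub>Q\<^esub> cls s"
proof -
  interpret F: module k F by (rule module_free_algebra[OF k])
  note F = F.module_axioms
  have "cls r = I +>\<^bsub>F\<^esub> (c \<odot>\<^bsub>F\<^esub> basis_elem k s)"
    using assms subset_generated_submodule[of X k F]
    by (simp only: presented_class_def, subst coset_eq_iff[OF F relations_submodule]) (auto simp: free_basis_closed)
  then show ?thesis
    using assms by (simp add: presented_defs quotient_smult[OF F relations_submodule] free_basis_closed)
qed

lemma algebra_presented:
  assumes "algebra k F"
    and "\<forall>x\<in>X. \<forall>s\<in>S. basis_elem k s \<otimes>\<^bsub>F\<^esub> x \<in> I"
  shows "algebra k Q" "\<one>\<^bsub>Q\<^esub> = cls e"
    and "s \<in> S \<Longrightarrow> t \<in> S \<Longrightarrow> cls s \<otimes>\<^bsub>Q\<^esub> cls t = I +>\<^bsub>F\<^esub> mset_vector k (mul s t)"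
proof -
  have "y \<otimes>\<^bsub>F\<^esub> x \<in> I" if "y \<in> carrier F" "x \<in> I" for x y
    by (rule generated_submodule_ideal[OF assms(1) generates_free_algebra[OF k] X _ that])
       (use assms(2) in auto)
  note alg = algebra_quotient_module[OF assms(1) relations_submodule this]
  show "algebra k Q" unfolding presented_algebra_def by (rule alg(1))
  show "\<one>\<^bsub>Q\<^esub> = cls e" using alg(3) by (simp add: presented_defs free_algebra_simps[OF k])
  show "cls s \<otimes>\<^bsub>Q\<^esub> cls t = I +>\<^bsub>F\<^esub> mset_vector k (mul s t)" if "s \<in> S" "t \<in> S"
    using that by (simp add: presented_defs alg(2) free_basis_closed free_algebra_mult_basis[OF k])
qed

end

section \<open>Tensor products\<close>

text \<open>
  A name for the generators of \<open>tensor_relations\<close>, which lets the tensor product be read as an algebra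
  given by a basis and linear relations.
\<close>

definition tensor_relators ::
    "('k, 'm) ring_scheme \<Rightarrow> ('k, 'a, 'n) module_scheme \<Rightarrow> ('k, 'b, 'l) module_scheme
      \<Rightarrow> ('a \<times> 'b \<Rightarrow> 'k) set"
  where "tensor_relators k M N =
    (let F = pairs_algebra k M N; e = basis_elem k in
      ({e (x \<oplus>\<^bsub>M\<^esub> x', y) \<ominus>\<^bsub>F\<^esub> (e (x, y) \<oplus>\<^bsub>F\<^esub> e (x', y)) | x x' y.
          x \<in> carrier M \<and> x' \<in> carrier M \<and> y \<in> carrier N} \<union>
       {e (x, y \<oplus>\<^bsub>N\<^esub> y') \<ominus>\<^bsub>F\<^esub> (e (x, y) \<oplus>\<^bsub>F\<^esub> e (x, y')) | x y y'.
          x \<in> carrier M \<and> y \<in> carrier N \<and> y' \<in> carrier N} \<union>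
       {e (c \<odot>\<^bsub>M\<^esub> x, y) \<ominus>\<^bsub>F\<^esub> (c \<odot>\<^bsub>F\<^esub> e (x, y)) | c x y.
          c \<in> carrier k \<and> x \<in> carrier M \<and> y \<in> carrier N} \<union>
       {e (x, c \<odot>\<^bsub>N\<^esub> y) \<ominus>\<^bsub>F\<^esub> (c \<odot>\<^bsub>F\<^esub> e (x, y)) | c x y.
          c \<in> carrier k \<and> x \<in> carrier M \<and> y \<in> carrier N}))"

lemma tensor_relations_eq:
  "tensor_relations k M N = generated_submodule k (pairs_algebra k M N) (tensor_relators k M N)"
  by (simp add: tensor_relations_def tensor_relators_def Let_def)

context
  fixes k :: "('k, 'm) ring_scheme" and M :: "('k, 'a, 'n) module_scheme"
    and N :: "('k, 'b, 'l) module_scheme"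
  assumes M: "module k M" and N: "module k N"
begin

interpretation M: module k M by (rule M)
interpretation N: module k N by (rule N)

private abbreviation (input) "e \<equiv> basis_elem k"
private abbreviation (input) "PA \<equiv> pairs_algebra k M N"
private abbreviation (input) "T \<equiv> tensor_product k M N"

lemmas pairs_algebra_as_free = pairs_algebra_def[of k M N]

interpretation F: module k "pairs_algebra k M N"
  unfolding pairs_algebra_def by (rule module_free_algebra[OF M.R.is_cring])

lemma pairs_basis_closed: "x \<in> carrier M \<Longrightarrow> y \<in> carrier N \<Longrightarrow> e (x, y) \<in> carrier PA"
  unfolding pairs_algebra_def
  by (simp add: free_algebra_simps[OF M.R.is_cring] basis_elem_closed[OF M.R.is_cring])

lemma tensor_relators_cases:
  assumes "r \<in> tensor_relators k M N"
  obtains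
    (add_left) x x' y where "x \<in> carrier M" "x' \<in> carrier M" "y \<in> carrier N"
      "r = e (x \<oplus>\<^bsub>M\<^esub> x', y) \<ominus>\<^bsub>PA\<^esub> (e (x, y) \<oplus>\<^bsub>PA\<^esub> e (x', y))"
  | (add_right) x y y' where "x \<in> carrier M" "y \<in> carrier N" "y' \<in> carrier N"
      "r = e (x, y \<oplus>\<^bsub>N\<^esub> y') \<ominus>\<^bsub>PA\<^esub> (e (x, y) \<oplus>\<^bsub>PA\<^esub> e (x, y'))"
  | (smult_left) c x y where "c \<in> carrier k" "x \<in> carrier M" "y \<in> carrier N"
      "r = e (c \<odot>\<^bsub>M\<^esub> x, y) \<ominus>\<^bsub>PA\<^esub> (c \<odot>\<^bsub>PA\<^esub> e (x, y))"
  | (smult_right) c x y where "c \<in> carrier k" "x \<in> carrier M" "y \<in> carrier N"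
      "r = e (x, c \<odot>\<^bsub>N\<^esub> y) \<ominus>\<^bsub>PA\<^esub> (c \<odot>\<^bsub>PA\<^esub> e (x, y))"
proof -
  let ?X1 = "{e (x \<oplus>\<^bsub>M\<^esub> x', y) \<ominus>\<^bsub>PA\<^esub> (e (x, y) \<oplus>\<^bsub>PA\<^esub> e (x', y)) | x x' y.
          x \<in> carrier M \<and> x' \<in> carrier M \<and> y \<in> carrier N}"
  let ?X2 = "{e (x, y \<oplus>\<^bsub>N\<^esub> y') \<ominus>\<^bsub>PA\<^esub> (e (x, y) \<oplus>\<^bsub>PA\<^esub> e (x, y')) | x y y'.
          x \<in> carrier M \<and> y \<in> carrier N \<and> y' \<in> carrier N}"
  let ?X3 = "{e (c \<odot>\<^bsub>M\<^esub> x, y) \<ominus>\<^bsub>PA\<^esub> (c \<odot>\<^bsub>PA\<^esub> e (x, y)) | c x y.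
          c \<in> carrier k \<and> x \<in> carrier M \<and> y \<in> carrier N}"
  let ?X4 = "{e (x, c \<odot>\<^bsub>N\<^esub> y) \<ominus>\<^bsub>PA\<^esub> (c \<odot>\<^bsub>PA\<^esub> e (x, y)) | c x y.
          c \<in> carrier k \<and> x \<in> carrier M \<and> y \<in> carrier N}"
  have "r \<in> ?X1 \<union> ?X2 \<union> ?X3 \<union> ?X4"
    using assms unfolding tensor_relators_def Let_def .
  then consider "r \<in> ?X1" | "r \<in> ?X2" | "r \<in> ?X3" | "r \<in> ?X4"
    unfolding Un_iff by argo
  then show thesis
  proof cases
    case 1
    then show thesis using add_left by (elim CollectE exE conjE)
  next
    case 2
    then show thesis using add_right by (elim CollectE exE conjE)
  next
    case 3
    then show thesis using smult_left by (elim CollectE exE conjE)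
  next
    case 4
    then show thesis using smult_right by (elim CollectE exE conjE)
  qed
qed

lemma tensor_relatorsI:
  "x \<in> carrier M \<Longrightarrow> x' \<in> carrier M \<Longrightarrow> y \<in> carrier N \<Longrightarrow>
    e (x \<oplus>\<^bsub>M\<^esub> x', y) \<ominus>\<^bsub>PA\<^esub> (e (x, y) \<oplus>\<^bsub>PA\<^esub> e (x', y)) \<in> tensor_relators k M N"
  "x \<in> carrier M \<Longrightarrow> y \<in> carrier N \<Longrightarrow> y' \<in> carrier N \<Longrightarrow>
    e (x, y \<oplus>\<^bsub>N\<^esub> y') \<ominus>\<^bsub>PA\<^esub> (e (x, y) \<oplus>\<^bsub>PA\<^esub> e (x, y')) \<in> tensor_relators k M N"
  "c \<in> carrier k \<Longrightarrow> x \<in> carrier M \<Longrightarrow> y \<in> carrier N \<Longrightarrow>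
    e (c \<odot>\<^bsub>M\<^esub> x, y) \<ominus>\<^bsub>PA\<^esub> (c \<odot>\<^bsub>PA\<^esub> e (x, y)) \<in> tensor_relators k M N"
  "c \<in> carrier k \<Longrightarrow> x \<in> carrier M \<Longrightarrow> y \<in> carrier N \<Longrightarrow>
    e (x, c \<odot>\<^bsub>N\<^esub> y) \<ominus>\<^bsub>PA\<^esub> (c \<odot>\<^bsub>PA\<^esub> e (x, y)) \<in> tensor_relators k M N"
  unfolding tensor_relators_def Let_def Un_iff mem_Collect_eq
  subgoal by (intro disjI1) (intro exI conjI; (rule refl | assumption))
  subgoal by (rule disjI1, rule disjI1, rule disjI2) (intro exI conjI; (rule refl | assumption))
  subgoal by (rule disjI1, rule disjI2) (intro exI conjI; (rule refl | assumption))
  subgoal by (rule disjI2) (intro exI conjI; (rule refl | assumption))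
  done

lemma tensor_relators_closed: "tensor_relators k M N \<subseteq> carrier PA"
proof
  fix r assume "r \<in> tensor_relators k M N"
  then show "r \<in> carrier PA"
    by (cases rule: tensor_relators_cases) (simp_all add: pairs_basis_closed)
qed

private lemmas presentation =
  M.R.is_cring tensor_relators_closed[unfolded pairs_algebra_as_free]
private lemmas unfold_tensor =
  presented_defs tensor_product_def tensor_relations_eq pairs_algebra_as_free tensor_def

lemma module_tensor_product: "module k T"
  using module_presented[OF presentation] by (simp add: unfold_tensor)

lemma generates_tensor_product:
  "generates k T ((\<lambda>(x, y). tensor k M N x y) ` (carrier M \<times> carrier N))"
  using generates_presented[OF presentation] by (simp add: unfold_tensor case_prod_unfold)

lemma tensor_bilinear: "tensor k M N \<in> bilinear_maps k M N T"
proof -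
  note relators = tensor_relatorsI[unfolded pairs_algebra_as_free]
  have closed: "tensor k M N x y \<in> carrier T" if "x \<in> carrier M" "y \<in> carrier N" for x y
    using class_closed[OF presentation, of "(x, y)"] that by (simp add: unfold_tensor)
  show ?thesis
  proof (intro bilinear_mapsI linear_mapsI closed)
    fix x y y' assume "x \<in> carrier M" "y \<in> carrier N" "y' \<in> carrier N"
    then show "tensor k M N x (y \<oplus>\<^bsub>N\<^esub> y') = tensor k M N x y \<oplus>\<^bsub>T\<^esub> tensor k M N x y'"
      using class_add_relation[OF presentation relators(2)] by (simp add: unfold_tensor)
  next
    fix x y c assume "x \<in> carrier M" "y \<in> carrier N" "c \<in> carrier k"
    then show "tensor k M N x (c \<odot>\<^bsub>N\<^esub> y) = c \<odot>\<^bsub>T\<^esub> tensor k M N x y"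
      using class_smult_relation[OF presentation relators(4)] by (simp add: unfold_tensor)
  next
    fix x x' y assume "x \<in> carrier M" "x' \<in> carrier M" "y \<in> carrier N"
    then show "tensor k M N (x \<oplus>\<^bsub>M\<^esub> x') y = tensor k M N x y \<oplus>\<^bsub>T\<^esub> tensor k M N x' y"
      using class_add_relation[OF presentation relators(1)] by (simp add: unfold_tensor)
  next
    fix x y c assume "y \<in> carrier N" "c \<in> carrier k" "x \<in> carrier M"
    then show "tensor k M N (c \<odot>\<^bsub>M\<^esub> x) y = c \<odot>\<^bsub>T\<^esub> tensor k M N x y"
      using class_smult_relation[OF presentation relators(3)] by (simp add: unfold_tensor)
  qed
qed

lemma tensor_universal:
  assumes "module k P" "B \<in> bilinear_maps k M N P"
  obtains g where "g \<in> linear_maps k T P"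
    "\<And>x y. x \<in> carrier M \<Longrightarrow> y \<in> carrier N \<Longrightarrow> g (tensor k M N x y) = B x y"
proof -
  interpret P: module k P by fact
  let ?\<phi> = "\<lambda>s. B (fst s) (snd s)"
  note closed = bilinear_maps_closed[OF assms(2)]
  note left = bilinear_maps_left[OF assms(2)] and right = bilinear_maps_right[OF assms(2)]
  have vanish: "h r = \<zero>\<^bsub>P\<^esub>"
    if h: "h \<in> linear_maps k PA P" and basis: "\<And>s. s \<in> carrier M \<times> carrier N \<Longrightarrow> h (e s) = ?\<phi> s"
      and r: "r \<in> tensor_relators k M N" for h r
  proof -
    have h_add: "h (p \<ominus>\<^bsub>PA\<^esub> (q \<oplus>\<^bsub>PA\<^esub> q')) = h p \<ominus>\<^bsub>P\<^esub> (h q \<oplus>\<^bsub>P\<^esub> h q')"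
      if "p \<in> carrier PA" "q \<in> carrier PA" "q' \<in> carrier PA" for p q q'
      using that linear_maps_minus[OF h F.module_axioms assms(1)] linear_maps_add[OF h] by simp
    have h_smult: "h (p \<ominus>\<^bsub>PA\<^esub> (c \<odot>\<^bsub>PA\<^esub> q)) = h p \<ominus>\<^bsub>P\<^esub> (c \<odot>\<^bsub>P\<^esub> h q)"
      if "p \<in> carrier PA" "q \<in> carrier PA" "c \<in> carrier k" for p q c
      using that linear_maps_minus[OF h F.module_axioms assms(1)] linear_maps_smult[OF h] by simp
    have self: "x \<ominus>\<^bsub>P\<^esub> x = \<zero>\<^bsub>P\<^esub>" if "x \<in> carrier P" for x
      using that by (simp add: P.minus_eq P.r_neg)
    from r show ?thesis
    proof (cases rule: tensor_relators_cases)
      case (add_left x x' y)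
      then show ?thesis
        using linear_maps_add[OF left, of y x x']
        by (simp add: h_add pairs_basis_closed basis self closed)
    next
      case (add_right x y y')
      then show ?thesis
        using linear_maps_add[OF right, of x y y']
        by (simp add: h_add pairs_basis_closed basis self closed)
    next
      case (smult_left c x y)
      then show ?thesis
        using linear_maps_smult[OF left, of y c x]
        by (simp add: h_smult pairs_basis_closed basis self closed)
    next
      case (smult_right c x y)
      then show ?thesis
        using linear_maps_smult[OF right, of x c y]
        by (simp add: h_smult pairs_basis_closed basis self closed)
    qed
  qed
  have "?\<phi> \<in> carrier M \<times> carrier N \<rightarrow> carrier P" using closed by auto
  then show thesis
  proof (rule presented_universal[OF presentation assms(1)])
    fix g
    assume g: "g \<in> linear_maps k (presented_algebra k (carrier M \<times> carrier N)
        (\<lambda>u v. {#(fst u \<otimes>\<^bsub>M\<^esub> fst v, snd u \<otimes>\<^bsub>N\<^esub> snd v)#}) (\<one>\<^bsub>M\<^esub>, \<one>\<^bsub>N\<^esub>) (tensor_relators k M N)) P"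
      and eq: "\<And>s. s \<in> carrier M \<times> carrier N \<Longrightarrow> g (presented_class k (carrier M \<times> carrier N)
        (\<lambda>u v. {#(fst u \<otimes>\<^bsub>M\<^esub> fst v, snd u \<otimes>\<^bsub>N\<^esub> snd v)#}) (\<one>\<^bsub>M\<^esub>, \<one>\<^bsub>N\<^esub>) (tensor_relators k M N) s)
        = ?\<phi> s"
    show thesis
    proof (rule that)
      show "g \<in> linear_maps k T P" using g by (simp add: unfold_tensor)
      fix x y assume "x \<in> carrier M" "y \<in> carrier N"
      then show "g (tensor k M N x y) = B x y" using eq[of "(x, y)"] by (simp add: unfold_tensor)
    qed
  qed (rule vanish[unfolded pairs_algebra_as_free])
qed

end

text \<open>
  The tensors \<open>x \<otimes> y\<close> with \<open>y \<in> Y\<close> fixed depend linearly on \<open>x\<close>, hence lie in the span of those with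
  \<open>x \<in> X\<close>; the same argument in the second variable then gives all tensors.
\<close>

lemma generates_tensor_product_generators:
  assumes "module k M" "module k N" "generates k M X" "generates k N Y"
  shows "generates k (tensor_product k M N) ((\<lambda>(x, y). tensor k M N x y) ` (X \<times> Y))"
proof -
  let ?T = "tensor_product k M N" and ?t = "tensor k M N"
  let ?G = "(\<lambda>(x, y). ?t x y) ` (X \<times> Y)"
  let ?H = "generated_submodule k ?T ?G"
  note T = module_tensor_product[OF assms(1,2)] and bil = tensor_bilinear[OF assms(1,2)]
  interpret T: module k ?T by (rule T)
  have XY: "X \<subseteq> carrier M" "Y \<subseteq> carrier N" using assms(3,4) by (auto simp: generates_def)
  have G: "?G \<subseteq> carrier ?T"
    using XY bilinear_maps_closed[OF bil] by (simp add: image_subset_iff subset_eq)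
  have H: "submodule ?H k ?T" by (rule generated_submodule_submodule[OF T G])
  have zero: "\<zero>\<^bsub>?T\<^esub> \<in> ?H" using subgroup.one_closed[OF submodule.axioms(1)[OF H]] by simp
  have in_H: "?t x y \<in> ?H" if "x \<in> X" "y \<in> Y" for x y
    using that by (intro subsetD[OF subset_generated_submodule] image_eqI[where x = "(x, y)"]) auto
  have left: "?t x y \<in> ?H" if "x \<in> carrier M" "y \<in> Y" for x y
  proof -
    note lin = bilinear_maps_left[OF bil subsetD[OF XY(2) that(2)]]
    from assms(3,1) that(1) show ?thesis
    proof (induction x rule: generates_induct)
      case zero
      then show ?case using linear_maps_zero[OF lin assms(1) T] \<open>\<zero>\<^bsub>?T\<^esub> \<in> ?H\<close> by simp
    next
      case (add a b)
      then show ?case using linear_maps_add[OF lin] T.submoduleE(5)[OF H] by simp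
    next
      case (smult c a)
      then show ?case using linear_maps_smult[OF lin] T.submoduleE(4)[OF H] by simp
    qed (rule in_H[OF _ that(2)])
  qed
  have right: "?t x y \<in> ?H" if "x \<in> carrier M" "y \<in> carrier N" for x y
  proof -
    note lin = bilinear_maps_right[OF bil that(1)]
    from assms(4,2) that(2) show ?thesis
    proof (induction y rule: generates_induct)
      case zero
      then show ?case using linear_maps_zero[OF lin assms(2) T] \<open>\<zero>\<^bsub>?T\<^esub> \<in> ?H\<close> by simp
    next
      case (add a b)
      then show ?case using linear_maps_add[OF lin] T.submoduleE(5)[OF H] by simp
    next
      case (smult c a)
      then show ?case using linear_maps_smult[OF lin] T.submoduleE(4)[OF H] by simp
    qed (rule left[OF that(1)])
  qed
  have "generated_submodule k ?T ((\<lambda>(x, y). ?t x y) ` (carrier M \<times> carrier N)) \<subseteq> ?H"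
    by (rule generated_submodule_minimal[OF H]) (use right in \<open>simp add: image_subset_iff\<close>)
  then show ?thesis
    using generates_tensor_product[OF assms(1,2)] G unfolding generates_def by (meson subset_trans)
qed

context
  fixes k :: "('k, 'm) ring_scheme" and M :: "('k, 'a, 'n) module_scheme"
    and N :: "('k, 'b, 'l) module_scheme"
  assumes M: "algebra k M" and N: "algebra k N"
begin

interpretation M: algebra k M by (rule M)
interpretation N: algebra k N by (rule N)

lemma algebra_pairs_algebra: "algebra k (pairs_algebra k M N)"
  unfolding pairs_algebra_def
  by (rule algebra_free_algebra[OF M.R_cring])
     (auto simp: M.m_assoc N.m_assoc M.m_comm N.m_comm M.m_lcomm N.m_lcomm)

text \<open>
  Multiplying a relation of bilinearity by a basis element \<open>(a, b)\<close> gives another one, with \<open>a x\<close> and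
  \<open>b y\<close> in place of \<open>x\<close> and \<open>y\<close>, because multiplication by \<open>a\<close> and by \<open>b\<close> is linear.
\<close>

lemma algebra_tensor_product:
  shows "algebra k (tensor_product k M N)"
    and "\<one>\<^bsub>tensor_product k M N\<^esub> = tensor k M N \<one>\<^bsub>M\<^esub> \<one>\<^bsub>N\<^esub>"
    and "x \<in> carrier M \<Longrightarrow> y \<in> carrier N \<Longrightarrow> x' \<in> carrier M \<Longrightarrow> y' \<in> carrier N \<Longrightarrow>
      tensor k M N x y \<otimes>\<^bsub>tensor_product k M N\<^esub> tensor k M N x' y' =
      tensor k M N (x \<otimes>\<^bsub>M\<^esub> x') (y \<otimes>\<^bsub>N\<^esub> y')"
proof -
  let ?F = "pairs_algebra k M N" and ?e = "basis_elem k"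
  let ?I = "generated_submodule k ?F (tensor_relators k M N)"
  note mods = M.module N.module
  interpret F: algebra k ?F by (rule algebra_pairs_algebra)
  note basis = pairs_basis_closed[OF mods]
  have mult_basis: "?e (a, b) \<otimes>\<^bsub>?F\<^esub> ?e (x, y) = ?e (a \<otimes>\<^bsub>M\<^esub> x, b \<otimes>\<^bsub>N\<^esub> y)"
    if "a \<in> carrier M" "b \<in> carrier N" "x \<in> carrier M" "y \<in> carrier N" for a b x y
    using that by (simp add: pairs_algebra_def free_algebra_mult_basis[OF M.R_cring]
        mset_vector_single[OF M.R_cring])
  have ideal: "\<forall>r\<in>tensor_relators k M N. \<forall>s\<in>carrier M \<times> carrier N. ?e s \<otimes>\<^bsub>?F\<^esub> r \<in> ?I"
  proof (intro ballI)
    fix r s assume r: "r \<in> tensor_relators k M N" and s: "s \<in> carrier M \<times> carrier N"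
    obtain a b where ab: "s = (a, b)" "a \<in> carrier M" "b \<in> carrier N" using s by auto
    note e = basis[OF ab(2,3)]
    note lin = bilinear_maps_right[OF bilinear_maps_mult[OF F.algebra_axioms] e]
    have lin_add: "?e (a, b) \<otimes>\<^bsub>?F\<^esub> (p \<ominus>\<^bsub>?F\<^esub> (q \<oplus>\<^bsub>?F\<^esub> q')) =
        ?e (a, b) \<otimes>\<^bsub>?F\<^esub> p \<ominus>\<^bsub>?F\<^esub> (?e (a, b) \<otimes>\<^bsub>?F\<^esub> q \<oplus>\<^bsub>?F\<^esub> ?e (a, b) \<otimes>\<^bsub>?F\<^esub> q')"
      if "p \<in> carrier ?F" "q \<in> carrier ?F" "q' \<in> carrier ?F" for p q q'
      using that linear_maps_minus[OF lin F.module F.module] linear_maps_add[OF lin] by simp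
    have lin_smult: "?e (a, b) \<otimes>\<^bsub>?F\<^esub> (p \<ominus>\<^bsub>?F\<^esub> (c \<odot>\<^bsub>?F\<^esub> q)) =
        ?e (a, b) \<otimes>\<^bsub>?F\<^esub> p \<ominus>\<^bsub>?F\<^esub> (c \<odot>\<^bsub>?F\<^esub> (?e (a, b) \<otimes>\<^bsub>?F\<^esub> q))"
      if "p \<in> carrier ?F" "q \<in> carrier ?F" "c \<in> carrier k" for p q c
      using that linear_maps_minus[OF lin F.module F.module] linear_maps_smult[OF lin] by simp
    note M_lin = bilinear_maps_right[OF bilinear_maps_mult[OF M] ab(2)]
    note N_lin = bilinear_maps_right[OF bilinear_maps_mult[OF N] ab(3)]
    have "?e (a, b) \<otimes>\<^bsub>?F\<^esub> r \<in> tensor_relators k M N"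
      using mods r
    proof (cases rule: tensor_relators_cases)
      case (add_left x x' y)
      then show ?thesis
        using ab tensor_relatorsI(1)[OF mods, of "a \<otimes>\<^bsub>M\<^esub> x" "a \<otimes>\<^bsub>M\<^esub> x'" "b \<otimes>\<^bsub>N\<^esub> y"]
          linear_maps_add[OF M_lin]
        by (simp add: lin_add basis mult_basis)
    next
      case (add_right x y y')
      then show ?thesis
        using ab tensor_relatorsI(2)[OF mods, of "a \<otimes>\<^bsub>M\<^esub> x" "b \<otimes>\<^bsub>N\<^esub> y" "b \<otimes>\<^bsub>N\<^esub> y'"]
          linear_maps_add[OF N_lin]
        by (simp add: lin_add basis mult_basis)
    next
      case (smult_left c x y)
      then show ?thesis
        using ab tensor_relatorsI(3)[OF mods, of c "a \<otimes>\<^bsub>M\<^esub> x" "b \<otimes>\<^bsub>N\<^esub> y"]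
          linear_maps_smult[OF M_lin]
        by (simp add: lin_smult basis mult_basis)
    next
      case (smult_right c x y)
      then show ?thesis
        using ab tensor_relatorsI(4)[OF mods, of c "a \<otimes>\<^bsub>M\<^esub> x" "b \<otimes>\<^bsub>N\<^esub> y"]
          linear_maps_smult[OF N_lin]
        by (simp add: lin_smult basis mult_basis)
    qed
    then show "?e s \<otimes>\<^bsub>?F\<^esub> r \<in> ?I"
      unfolding ab(1) by (rule subsetD[OF subset_generated_submodule])
  qed
  note presentation = M.R_cring tensor_relators_closed[OF mods, unfolded pairs_algebra_def]
    algebra_pairs_algebra[unfolded pairs_algebra_def] ideal[unfolded pairs_algebra_def]
  note alg = algebra_presented[OF presentation]
  note unfold_tensor = presented_defs tensor_product_def tensor_relations_eq pairs_algebra_def tensor_def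
  show "algebra k (tensor_product k M N)" using alg(1) by (simp add: unfold_tensor)
  show "\<one>\<^bsub>tensor_product k M N\<^esub> = tensor k M N \<one>\<^bsub>M\<^esub> \<one>\<^bsub>N\<^esub>" using alg(2) by (simp add: unfold_tensor)
  show "tensor k M N x y \<otimes>\<^bsub>tensor_product k M N\<^esub> tensor k M N x' y' =
      tensor k M N (x \<otimes>\<^bsub>M\<^esub> x') (y \<otimes>\<^bsub>N\<^esub> y')"
    if "x \<in> carrier M" "y \<in> carrier N" "x' \<in> carrier M" "y' \<in> carrier N"
  proof -
    let ?mul = "\<lambda>u v. {#(fst u \<otimes>\<^bsub>M\<^esub> fst v, snd u \<otimes>\<^bsub>N\<^esub> snd v)#}"
    let ?S = "carrier M \<times> carrier N" and ?R = "tensor_relators k M N" and ?u = "(\<one>\<^bsub>M\<^esub>, \<one>\<^bsub>N\<^esub>)"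
    have T: "tensor_product k M N = presented_algebra k ?S ?mul ?u ?R"
      by (simp add: unfold_tensor)
    have t: "tensor k M N a b = presented_class k ?S ?mul ?u ?R (a, b)" for a b
      by (simp add: unfold_tensor)
    have "(x, y) \<in> ?S" "(x', y') \<in> ?S" using that by auto
    note alg(3)[OF this]
    also have "mset_vector k (?mul (x, y) (x', y')) = basis_elem k (x \<otimes>\<^bsub>M\<^esub> x', y \<otimes>\<^bsub>N\<^esub> y')"
      by (simp add: mset_vector_single[OF M.R_cring])
    finally show ?thesis
      unfolding T t presented_class_def .
  qed
qed

end

section \<open>Shuffles of words\<close>

lemma shuffle_Nil_right [simp]: "shuffle xs [] = {#xs#}"
  by (cases xs) auto

lemma shuffle_commute: "shuffle xs ys = shuffle ys xs"
  by (induction xs ys rule: shuffle.induct) (auto simp: add.commute)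

lemma set_shuffle: "w \<in># shuffle xs ys \<Longrightarrow> set w = set xs \<union> set ys"
  by (induction xs ys arbitrary: w rule: shuffle.induct) auto

lemma shuffle_in_lists:
  "xs \<in> lists A \<Longrightarrow> ys \<in> lists A \<Longrightarrow> set_mset (shuffle xs ys) \<subseteq> lists A"
  by (rule subsetI) (simp add: lists_eq_set set_shuffle)

text \<open>
  The recursion of the shuffle product, summed over the words of a multiset that all begin with the
  same letter.
\<close>

lemma sum_shuffle_Cons_left:
  "\<Sum>\<^sub># (image_mset (\<lambda>a. shuffle a (z # zs)) (image_mset ((#) x) M)) =
    image_mset ((#) x) (\<Sum>\<^sub># (image_mset (\<lambda>a. shuffle a (z # zs)) M)) +
    image_mset ((#) z) (\<Sum>\<^sub># (image_mset (\<lambda>a. shuffle a zs) (image_mset ((#) x) M)))"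
  by (induction M) (auto simp: ac_simps)

lemma sum_shuffle_Cons_right:
  "\<Sum>\<^sub># (image_mset (shuffle (x # xs)) (image_mset ((#) y) M)) =
    image_mset ((#) x) (\<Sum>\<^sub># (image_mset (shuffle xs) (image_mset ((#) y) M))) +
    image_mset ((#) y) (\<Sum>\<^sub># (image_mset (shuffle (x # xs)) M))"
  by (induction M) (auto simp: ac_simps)

text \<open>
  Both sides split into three parts according to the first letter, which comes from one of the three
  words; the induction hypothesis for the word that has lost a letter identifies the parts.
\<close>

lemma shuffle_assoc:
  "\<Sum>\<^sub># (image_mset (\<lambda>a. shuffle a zs) (shuffle xs ys)) = \<Sum>\<^sub># (image_mset (shuffle xs) (shuffle ys zs))"
proof (induction xs arbitrary: ys zs)
  case Nil
  show ?case by (simp add: image_mset.compositionality)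
next
  case (Cons x xs)
  show ?case
  proof (induction ys arbitrary: zs)
    case (Cons y ys)
    show ?case
    proof (induction zs)
      case (Cons z zs)
      let ?L = "\<lambda>zs M. \<Sum>\<^sub># (image_mset (\<lambda>a. shuffle a zs) M)"
      let ?R = "\<lambda>xs M. \<Sum>\<^sub># (image_mset (shuffle xs) M)"
      have "?L (z # zs) (shuffle (x # xs) (y # ys)) =
          image_mset ((#) x) (?L (z # zs) (shuffle xs (y # ys))) +
          image_mset ((#) y) (?L (z # zs) (shuffle (x # xs) ys)) +
          image_mset ((#) z) (?L zs (shuffle (x # xs) (y # ys)))"
        unfolding shuffle.simps(3)[of x xs y ys] image_mset_union sum_mset.union
          sum_shuffle_Cons_left by (simp add: ac_simps)
      also have "\<dots> = image_mset ((#) x) (?R xs (shuffle (y # ys) (z # zs))) +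
          image_mset ((#) y) (?R (x # xs) (shuffle ys (z # zs))) +
          image_mset ((#) z) (?R (x # xs) (shuffle (y # ys) zs))"
        by (simp only: Cons.IH \<open>\<And>ys zs. ?L zs (shuffle xs ys) = ?R xs (shuffle ys zs)\<close>
            \<open>\<And>zs. ?L zs (shuffle (x # xs) ys) = ?R (x # xs) (shuffle ys zs)\<close>)
      also have "\<dots> = ?R (x # xs) (shuffle (y # ys) (z # zs))"
        unfolding shuffle.simps(3)[of y ys z zs] image_mset_union sum_mset.union
          sum_shuffle_Cons_right by (simp add: ac_simps)
      finally show ?case .
    qed simp
  qed simp
qed

text \<open>
  In a shuffle of \<open>w\<close> with \<open>us @ [z] @ vs\<close> the letter \<open>z\<close> occurs once as itself, and the words \<open>p\<close> and
  \<open>q\<close> around it are determined by the way of shuffling. The multiset \<open>C\<close> of these pairs is the same for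
  all \<open>z\<close>, which makes the sum of the shuffles linear in \<open>z\<close>.
\<close>

lemma shuffle_insert_letter:
  obtains C where "\<And>p q. (p, q) \<in># C \<Longrightarrow> set p \<union> set q \<subseteq> set w \<union> set us \<union> set vs"
    and "\<And>z. shuffle w (us @ [z] @ vs) = image_mset (\<lambda>(p, q). p @ [z] @ q) C"
proof -
  let ?ctx = "\<lambda>w us C. (\<forall>p q. (p, q) \<in># C \<longrightarrow> set p \<union> set q \<subseteq> set w \<union> set us \<union> set vs) \<and>
      (\<forall>z. shuffle w (us @ [z] @ vs) = image_mset (\<lambda>(p, q). p @ [z] @ q) C)"
  have "\<exists>C. ?ctx w us C"
  proof (induction w arbitrary: us)
    case Nil
    show ?case by (rule exI[of _ "{#(us, vs)#}"]) auto
  next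
    case (Cons a w)
    note outer = Cons.IH
    show ?case
    proof (induction us)
      case Nil
      obtain C where C: "?ctx w [] C" using outer by blast
      have "?ctx (a # w) [] (image_mset (\<lambda>(p, q). (a # p, q)) C + image_mset (Pair []) (shuffle (a # w) vs))"
        using C by (auto simp: image_mset.compositionality comp_def case_prod_unfold dest: set_shuffle) blast+
      then show ?case by blast
    next
      case (Cons b us)
      then obtain C where C: "?ctx (a # w) us C" by blast
      obtain C' where C': "?ctx w (b # us) C'" using outer by blast
      have "?ctx (a # w) (b # us)
          (image_mset (\<lambda>(p, q). (a # p, q)) C' + image_mset (\<lambda>(p, q). (b # p, q)) C)"
        using C C' by (fastforce simp: image_mset.compositionality comp_def case_prod_unfold)
      then show ?case by blast
    qed
  qed
  then show thesis using that by blast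
qed

section \<open>The shuffle algebra of a module\<close>

text \<open>
  A name for the generators of \<open>multilinear_relations\<close>, which lets the shuffle algebra be read as an
  algebra given by a basis and linear relations.
\<close>

definition multilinear_relators ::
    "('k, 'm) ring_scheme \<Rightarrow> ('k, 'v, 'n) module_scheme \<Rightarrow> ('v list \<Rightarrow> 'k) set"
  where "multilinear_relators k V =
    (let F = words_algebra k V; e = basis_elem k in
      ({e (us @ [x \<oplus>\<^bsub>V\<^esub> y] @ vs) \<ominus>\<^bsub>F\<^esub> (e (us @ [x] @ vs) \<oplus>\<^bsub>F\<^esub> e (us @ [y] @ vs)) | us vs x y.
          us \<in> lists (carrier V) \<and> vs \<in> lists (carrier V) \<and> x \<in> carrier V \<and> y \<in> carrier V} \<union>
       {e (us @ [c \<odot>\<^bsub>V\<^esub> x] @ vs) \<ominus>\<^bsub>F\<^esub> (c \<odot>\<^bsub>F\<^esub> e (us @ [x] @ vs)) | us vs c x.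
          us \<in> lists (carrier V) \<and> vs \<in> lists (carrier V) \<and> c \<in> carrier k \<and> x \<in> carrier V}))"

context
  fixes k :: "('k, 'm) ring_scheme" and V :: "('k, 'v, 'n) module_scheme"
  assumes V: "module k V"
begin

interpretation V: module k V by (rule V)

private abbreviation (input) "S \<equiv> lists (carrier V)"
private abbreviation (input) "\<epsilon> \<equiv> basis_elem k"
private abbreviation (input) "W \<equiv> words_algebra k V"
private abbreviation (input) "rels \<equiv> multilinear_relators k V"
private abbreviation (input) "word \<equiv> word_tensor k V"

lemma algebra_words_algebra: "algebra k W"
  unfolding words_algebra_def
  by (rule algebra_free_algebra[OF V.R.is_cring])
     (auto simp: shuffle_assoc in_lists_conv_set dest: set_shuffle intro: shuffle_commute)

interpretation W: algebra k "words_algebra k V" by (rule algebra_words_algebra)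

lemma words_basis_closed: "w \<in> S \<Longrightarrow> \<epsilon> w \<in> carrier W"
  unfolding words_algebra_def
  by (simp add: free_algebra_simps[OF V.R.is_cring] basis_elem_closed[OF V.R.is_cring])

lemma multilinear_relators_cases:
  assumes "r \<in> rels"
  obtains
    (add) us vs x y where "us \<in> S" "vs \<in> S" "x \<in> carrier V" "y \<in> carrier V"
      "r = \<epsilon> (us @ [x \<oplus>\<^bsub>V\<^esub> y] @ vs) \<ominus>\<^bsub>W\<^esub> (\<epsilon> (us @ [x] @ vs) \<oplus>\<^bsub>W\<^esub> \<epsilon> (us @ [y] @ vs))"
  | (smult) us vs c x where "us \<in> S" "vs \<in> S" "c \<in> carrier k" "x \<in> carrier V"
      "r = \<epsilon> (us @ [c \<odot>\<^bsub>V\<^esub> x] @ vs) \<ominus>\<^bsub>W\<^esub> (c \<odot>\<^bsub>W\<^esub> \<epsilon> (us @ [x] @ vs))"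
proof -
  let ?X1 = "{\<epsilon> (us @ [x \<oplus>\<^bsub>V\<^esub> y] @ vs) \<ominus>\<^bsub>W\<^esub> (\<epsilon> (us @ [x] @ vs) \<oplus>\<^bsub>W\<^esub> \<epsilon> (us @ [y] @ vs)) | us vs x y.
          us \<in> S \<and> vs \<in> S \<and> x \<in> carrier V \<and> y \<in> carrier V}"
  let ?X2 = "{\<epsilon> (us @ [c \<odot>\<^bsub>V\<^esub> x] @ vs) \<ominus>\<^bsub>W\<^esub> (c \<odot>\<^bsub>W\<^esub> \<epsilon> (us @ [x] @ vs)) | us vs c x.
          us \<in> S \<and> vs \<in> S \<and> c \<in> carrier k \<and> x \<in> carrier V}"
  have "r \<in> ?X1 \<union> ?X2"
    using assms unfolding multilinear_relators_def Let_def .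
  then show thesis
  proof
    assume "r \<in> ?X1"
    then show thesis using add by (elim CollectE exE conjE)
  next
    assume "r \<in> ?X2"
    then show thesis using smult by (elim CollectE exE conjE)
  qed
qed

lemma multilinear_relatorsI:
  "us \<in> S \<Longrightarrow> vs \<in> S \<Longrightarrow> x \<in> carrier V \<Longrightarrow> y \<in> carrier V \<Longrightarrow>
    \<epsilon> (us @ [x \<oplus>\<^bsub>V\<^esub> y] @ vs) \<ominus>\<^bsub>W\<^esub> (\<epsilon> (us @ [x] @ vs) \<oplus>\<^bsub>W\<^esub> \<epsilon> (us @ [y] @ vs)) \<in> rels"
  "us \<in> S \<Longrightarrow> vs \<in> S \<Longrightarrow> c \<in> carrier k \<Longrightarrow> x \<in> carrier V \<Longrightarrow>
    \<epsilon> (us @ [c \<odot>\<^bsub>V\<^esub> x] @ vs) \<ominus>\<^bsub>W\<^esub> (c \<odot>\<^bsub>W\<^esub> \<epsilon> (us @ [x] @ vs)) \<in> rels"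
  unfolding multilinear_relators_def Let_def Un_iff mem_Collect_eq
  subgoal by (rule disjI1) (intro exI conjI; (rule refl | assumption))
  subgoal by (rule disjI2) (intro exI conjI; (rule refl | assumption))
  done

lemma multilinear_relators_closed: "rels \<subseteq> carrier W"
proof
  fix r assume "r \<in> rels"
  then show "r \<in> carrier W"
    by (cases rule: multilinear_relators_cases) (simp_all add: words_basis_closed)
qed

private lemmas words_presentation =
  V.R.is_cring multilinear_relators_closed[unfolded words_algebra_def]

lemma Sh_presented: "Sh k V = presented_algebra k S shuffle [] rels"
  by (simp add: Sh_def presented_algebra_def multilinear_relations_def multilinear_relators_def
      words_algebra_def Let_def)

lemma word_tensor_presented: "word = presented_class k S shuffle [] rels"
  by (rule ext) (simp add: word_tensor_def presented_class_def multilinear_relations_def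
      multilinear_relators_def words_algebra_def Let_def)

lemma module_Sh: "module k (Sh k V)"
  unfolding Sh_presented by (rule module_presented[OF words_presentation])

lemma word_tensor_closed: "w \<in> S \<Longrightarrow> word w \<in> carrier (Sh k V)"
  unfolding Sh_presented word_tensor_presented by (rule class_closed[OF words_presentation])

lemma generates_Sh: "generates k (Sh k V) (word ` S)"
  using generates_presented[OF words_presentation] unfolding Sh_presented word_tensor_presented .

lemma word_tensor_add:
  assumes "us \<in> S" "vs \<in> S" "x \<in> carrier V" "y \<in> carrier V"
  shows "word (us @ [x \<oplus>\<^bsub>V\<^esub> y] @ vs) = word (us @ [x] @ vs) \<oplus>\<^bsub>Sh k V\<^esub> word (us @ [y] @ vs)"
  unfolding Sh_presented word_tensor_presented
  by (rule class_add_relation[OF words_presentation])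
     (use multilinear_relatorsI(1)[OF assms] assms in \<open>simp_all add: words_algebra_def\<close>)

lemma word_tensor_smult:
  assumes "us \<in> S" "vs \<in> S" "c \<in> carrier k" "x \<in> carrier V"
  shows "word (us @ [c \<odot>\<^bsub>V\<^esub> x] @ vs) = c \<odot>\<^bsub>Sh k V\<^esub> word (us @ [x] @ vs)"
  unfolding Sh_presented word_tensor_presented
  by (rule class_smult_relation[OF words_presentation])
     (use multilinear_relatorsI(2)[OF assms] assms in \<open>simp_all add: words_algebra_def\<close>)

lemma Sh_universal:
  assumes "module k N" "\<And>w. w \<in> S \<Longrightarrow> \<phi> w \<in> carrier N"
    and add: "\<And>us vs x y. us \<in> S \<Longrightarrow> vs \<in> S \<Longrightarrow> x \<in> carrier V \<Longrightarrow> y \<in> carrier V \<Longrightarrow>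
      \<phi> (us @ [x \<oplus>\<^bsub>V\<^esub> y] @ vs) = \<phi> (us @ [x] @ vs) \<oplus>\<^bsub>N\<^esub> \<phi> (us @ [y] @ vs)"
    and smult: "\<And>us vs c x. us \<in> S \<Longrightarrow> vs \<in> S \<Longrightarrow> c \<in> carrier k \<Longrightarrow> x \<in> carrier V \<Longrightarrow>
      \<phi> (us @ [c \<odot>\<^bsub>V\<^esub> x] @ vs) = c \<odot>\<^bsub>N\<^esub> \<phi> (us @ [x] @ vs)"
  obtains g where "g \<in> linear_maps k (Sh k V) N" "\<And>w. w \<in> S \<Longrightarrow> g (word w) = \<phi> w"
proof -
  interpret N: module k N by fact
  have self: "x \<ominus>\<^bsub>N\<^esub> x = \<zero>\<^bsub>N\<^esub>" if "x \<in> carrier N" for x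
    using that by (simp add: N.minus_eq N.r_neg)
  have vanish: "h r = \<zero>\<^bsub>N\<^esub>"
    if h: "h \<in> linear_maps k W N" and basis: "\<And>w. w \<in> S \<Longrightarrow> h (\<epsilon> w) = \<phi> w" and r: "r \<in> rels" for h r
    using r
  proof (cases rule: multilinear_relators_cases)
    case (add us vs x y)
    then have "h r = \<phi> (us @ [x \<oplus>\<^bsub>V\<^esub> y] @ vs) \<ominus>\<^bsub>N\<^esub> (\<phi> (us @ [x] @ vs) \<oplus>\<^bsub>N\<^esub> \<phi> (us @ [y] @ vs))"
      by (simp add: linear_maps_minus[OF h W.module assms(1)] linear_maps_add[OF h]
          words_basis_closed basis)
    with add show ?thesis by (simp only: assms(3)) (simp add: self assms(2))
  next
    case (smult us vs c x)
    then have "h r = \<phi> (us @ [c \<odot>\<^bsub>V\<^esub> x] @ vs) \<ominus>\<^bsub>N\<^esub> (c \<odot>\<^bsub>N\<^esub> \<phi> (us @ [x] @ vs))"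
      by (simp add: linear_maps_minus[OF h W.module assms(1)] linear_maps_smult[OF h]
          words_basis_closed basis)
    with smult show ?thesis by (simp only: assms(4)) (simp add: self assms(2))
  qed
  have "\<phi> \<in> S \<rightarrow> carrier N" using assms(2) by simp
  then show thesis
  proof (rule presented_universal[OF words_presentation assms(1)])
    fix g assume "g \<in> linear_maps k (presented_algebra k S shuffle [] rels) N"
      "\<And>w. w \<in> S \<Longrightarrow> g (presented_class k S shuffle [] rels w) = \<phi> w"
    then show thesis
      by (intro that[of g]) (simp_all add: Sh_presented word_tensor_presented)
  qed (rule vanish[unfolded words_algebra_def])
qed

lemma word_tensor_linear_in_letter:
  assumes "us \<in> S" "vs \<in> S"
  shows "(\<lambda>z. word (us @ [z] @ vs)) \<in> linear_maps k V (Sh k V)"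
  by (rule linear_mapsI)
     (use assms in \<open>simp_all only: word_tensor_add word_tensor_smult\<close>, simp add: word_tensor_closed)

private abbreviation (input) "word_sum m \<equiv> multilinear_relations k V +>\<^bsub>W\<^esub> mset_vector k m"

lemma multilinear_relations_eq: "multilinear_relations k V = generated_submodule k W rels"
  by (simp add: multilinear_relations_def multilinear_relators_def Let_def)

lemma multilinear_relations_submodule: "submodule (multilinear_relations k V) k W"
  unfolding multilinear_relations_eq
  by (rule generated_submodule_submodule[OF W.module multilinear_relators_closed])

lemma words_vector_closed: "set_mset m \<subseteq> S \<Longrightarrow> mset_vector k m \<in> carrier W"
  by (simp add: words_algebra_def free_algebra_simps[OF V.R.is_cring] mset_vector_closed[OF V.R.is_cring])

lemma word_sum_empty: "word_sum {#} = \<zero>\<^bsub>Sh k V\<^esub>"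
  using mset_vector_empty[OF V.R.is_cring, where S = S]
  by (simp add: Sh_def words_algebra_def free_algebra_simps[OF V.R.is_cring]
      quotient_zero[OF W.module multilinear_relations_submodule, unfolded words_algebra_def])

lemma word_sum_single: "word_sum {#v#} = word v"
  by (simp add: word_tensor_def mset_vector_single[OF V.R.is_cring])

lemma word_sum_add:
  assumes "set_mset m \<subseteq> S" "set_mset m' \<subseteq> S"
  shows "word_sum (m + m') = word_sum m \<oplus>\<^bsub>Sh k V\<^esub> word_sum m'"
proof -
  have "mset_vector k (m + m') = mset_vector k m \<oplus>\<^bsub>W\<^esub> mset_vector k m'"
    using mset_vector_add[OF V.R.is_cring, where S = S and m = m and m' = m']
    by (simp add: words_algebra_def free_algebra_simps[OF V.R.is_cring])
  then show ?thesis
    using assms unfolding Sh_def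
    by (simp add: quotient_add[OF W.module multilinear_relations_submodule] words_vector_closed)
qed

lemma word_sum_add_mset:
  assumes "v \<in> S" "set_mset m \<subseteq> S"
  shows "word_sum (add_mset v m) = word v \<oplus>\<^bsub>Sh k V\<^esub> word_sum m"
  using word_sum_add[of "{#v#}" m] assms by (simp add: word_sum_single)

lemma word_sum_linear_in_letter:
  assumes "\<And>p q. (p, q) \<in># C \<Longrightarrow> p \<in> S \<and> q \<in> S"
  shows "(\<lambda>z. word_sum (image_mset (\<lambda>(p, q). p @ [z] @ q) C)) \<in> linear_maps k V (Sh k V)"
  using assms
proof (induction C)
  case empty
  interpret Sh: module k "Sh k V" by (rule module_Sh)
  show ?case unfolding image_mset_empty word_sum_empty by (rule linear_mapsI) auto
next
  case (add pq C)
  obtain p q where pq: "pq = (p, q)" by (cases pq)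
  have S: "p \<in> S" "q \<in> S" "\<And>p q. (p, q) \<in># C \<Longrightarrow> p \<in> S \<and> q \<in> S"
    using add.prems pq by auto
  show ?case
  proof (rule linear_maps_cong[OF linear_maps_plus[OF word_tensor_linear_in_letter[OF S(1,2)]
          add.IH[OF S(3)] module_Sh] V])
    fix z assume z: "z \<in> carrier V"
    have "set_mset (image_mset (\<lambda>(p, q). p @ [z] @ q) C) \<subseteq> S"
      using S(3) z by (force simp: subset_iff)
    then show "word_sum (image_mset (\<lambda>(p, q). p @ [z] @ q) (add_mset pq C))
        = word (p @ [z] @ q) \<oplus>\<^bsub>Sh k V\<^esub> word_sum (image_mset (\<lambda>(p, q). p @ [z] @ q) C)"
      using S(1,2) z by (simp add: pq word_sum_add_mset)
  qed
qed

lemma words_mult_basis: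
  "v \<in> S \<Longrightarrow> w \<in> S \<Longrightarrow> \<epsilon> v \<otimes>\<^bsub>W\<^esub> \<epsilon> w = mset_vector k (shuffle v w)"
  by (simp add: words_algebra_def free_algebra_mult_basis[OF V.R.is_cring])

lemma shuffle_vector_closed:
  "v \<in> S \<Longrightarrow> w \<in> S \<Longrightarrow> mset_vector k (shuffle v w) \<in> carrier W"
  by (rule words_vector_closed) (auto simp: in_lists_conv_set dest: set_shuffle)

text \<open>
  The product of the word \<open>w\<close> with a relation is the relation of additivity or homogeneity for the
  map that sends \<open>z\<close> to the sum of the shuffles of \<open>w\<close> and \<open>us @ [z] @ vs\<close>. It lies in the submodule of
  relations exactly if this map is additive or homogeneous modulo relations, and there it is a sum
  of maps that only exchange one letter of a word.
\<close>

lemma words_relators_ideal: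
  "\<forall>r\<in>rels. \<forall>w\<in>S. \<epsilon> w \<otimes>\<^bsub>W\<^esub> r \<in> multilinear_relations k V"
proof (intro ballI)
  fix r w assume r: "r \<in> rels" and w: "w \<in> S"
  note lin = bilinear_maps_right[OF bilinear_maps_mult[OF algebra_words_algebra]
      words_basis_closed[OF w]]
  have shuffle_linear: "(\<lambda>z. word_sum (shuffle w (us @ [z] @ vs))) \<in> linear_maps k V (Sh k V)"
    if "us \<in> S" "vs \<in> S" for us vs
  proof -
    obtain C where C: "\<And>p q. (p, q) \<in># C \<Longrightarrow> set p \<union> set q \<subseteq> set w \<union> set us \<union> set vs"
      "\<And>z. shuffle w (us @ [z] @ vs) = image_mset (\<lambda>(p, q). p @ [z] @ q) C"
      using shuffle_insert_letter[of w us vs] by metis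
    have "p \<in> S \<and> q \<in> S" if "(p, q) \<in># C" for p q
      using C(1)[OF that] w \<open>us \<in> S\<close> \<open>vs \<in> S\<close> by (auto simp: in_lists_conv_set)
    then show ?thesis unfolding C(2) by (rule word_sum_linear_in_letter)
  qed
  note quot = quotient_add[OF W.module multilinear_relations_submodule, folded Sh_def]
    quotient_smult[OF W.module multilinear_relations_submodule, folded Sh_def]
  note coset = coset_eq_iff[OF W.module multilinear_relations_submodule]
  from r show "\<epsilon> w \<otimes>\<^bsub>W\<^esub> r \<in> multilinear_relations k V"
  proof (cases rule: multilinear_relators_cases)
    case (add us vs x y)
    let ?m = "\<lambda>z. mset_vector k (shuffle w (us @ [z] @ vs))"
    have closed: "?m z \<in> carrier W" if "z \<in> carrier V" for z
      using that add w by (intro shuffle_vector_closed) auto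
    have "multilinear_relations k V +>\<^bsub>W\<^esub> ?m (x \<oplus>\<^bsub>V\<^esub> y) = multilinear_relations k V +>\<^bsub>W\<^esub> (?m x \<oplus>\<^bsub>W\<^esub> ?m y)"
      using linear_maps_add[OF shuffle_linear[OF add(1,2)] add(3,4)] closed add(3,4)
      by (simp only: quot)
    then have "?m (x \<oplus>\<^bsub>V\<^esub> y) \<ominus>\<^bsub>W\<^esub> (?m x \<oplus>\<^bsub>W\<^esub> ?m y) \<in> multilinear_relations k V"
      using closed add(3,4) by (subst (asm) coset) auto
    moreover have "\<epsilon> w \<otimes>\<^bsub>W\<^esub> r = ?m (x \<oplus>\<^bsub>V\<^esub> y) \<ominus>\<^bsub>W\<^esub> (?m x \<oplus>\<^bsub>W\<^esub> ?m y)"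
      using add w
      by (simp add: linear_maps_minus[OF lin W.module W.module] linear_maps_add[OF lin]
          words_basis_closed words_mult_basis)
    ultimately show ?thesis by simp
  next
    case (smult us vs c x)
    let ?m = "\<lambda>z. mset_vector k (shuffle w (us @ [z] @ vs))"
    have closed: "?m z \<in> carrier W" if "z \<in> carrier V" for z
      using that smult w by (intro shuffle_vector_closed) auto
    have "multilinear_relations k V +>\<^bsub>W\<^esub> ?m (c \<odot>\<^bsub>V\<^esub> x) = multilinear_relations k V +>\<^bsub>W\<^esub> (c \<odot>\<^bsub>W\<^esub> ?m x)"
      using linear_maps_smult[OF shuffle_linear[OF smult(1,2)] smult(3,4)] closed smult(3,4)
      by (simp only: quot)
    then have "?m (c \<odot>\<^bsub>V\<^esub> x) \<ominus>\<^bsub>W\<^esub> (c \<odot>\<^bsub>W\<^esub> ?m x) \<in> multilinear_relations k V"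
      using closed smult(3,4) by (subst (asm) coset) auto
    moreover have "\<epsilon> w \<otimes>\<^bsub>W\<^esub> r = ?m (c \<odot>\<^bsub>V\<^esub> x) \<ominus>\<^bsub>W\<^esub> (c \<odot>\<^bsub>W\<^esub> ?m x)"
      using smult w
      by (simp add: linear_maps_minus[OF lin W.module W.module] linear_maps_smult[OF lin]
          words_basis_closed words_mult_basis)
    ultimately show ?thesis by simp
  qed
qed

lemma algebra_Sh:
  shows "algebra k (Sh k V)" and "\<one>\<^bsub>Sh k V\<^esub> = word []"
    and "v \<in> S \<Longrightarrow> w \<in> S \<Longrightarrow> word v \<otimes>\<^bsub>Sh k V\<^esub> word w = word_sum (shuffle v w)"
proof -
  note alg = algebra_presented[OF words_presentation algebra_words_algebra[unfolded words_algebra_def]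
      words_relators_ideal[unfolded multilinear_relations_eq words_algebra_def]]
  show "algebra k (Sh k V)" unfolding Sh_presented by (rule alg(1))
  show "\<one>\<^bsub>Sh k V\<^esub> = word []" unfolding Sh_presented word_tensor_presented by (rule alg(2))
  show "word v \<otimes>\<^bsub>Sh k V\<^esub> word w = word_sum (shuffle v w)" if "v \<in> S" "w \<in> S"
    using alg(3)[OF that]
    unfolding Sh_presented word_tensor_presented multilinear_relations_eq words_algebra_def .
qed

end

text \<open>
  The map \<open>v \<otimes> s \<mapsto> v\<cdot>s\<close> that puts the letter \<open>v\<close> in front. Any two bilinear maps with this property
  agree on the carriers.
\<close>

definition Sh_cons ::
    "('k, 'm) ring_scheme \<Rightarrow> ('k, 'v, 'n) module_scheme \<Rightarrow> 'v \<Rightarrow> ('v list \<Rightarrow> 'k) set \<Rightarrow> ('v list \<Rightarrow> 'k) set"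
  where "Sh_cons k V = (SOME C. C \<in> bilinear_maps k V (Sh k V) (Sh k V) \<and>
    (\<forall>v\<in>carrier V. \<forall>w\<in>lists (carrier V). C v (word_tensor k V w) = word_tensor k V (v # w)))"

context
  fixes k :: "('k, 'm) ring_scheme" and V :: "('k, 'v, 'n) module_scheme"
  assumes V: "module k V"
begin

interpretation V: module k V by (rule V)
interpretation Sh: algebra k "Sh k V" by (rule algebra_Sh(1)[OF V])

private abbreviation (input) "L \<equiv> lists (carrier V)"
private abbreviation (input) "tens \<equiv> word_tensor k V"
private abbreviation (input) "cons \<equiv> Sh_cons k V"

text \<open>
  For a fixed letter \<open>v\<close> the universal property gives a linear map on the shuffle algebra. Linearity
  in \<open>v\<close> is clear on words, which generate.
\<close>

lemma Sh_cons_exists: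
  "\<exists>C. C \<in> bilinear_maps k V (Sh k V) (Sh k V) \<and> (\<forall>v\<in>carrier V. \<forall>w\<in>L. C v (tens w) = tens (v # w))"
proof -
  have "\<exists>g. g \<in> linear_maps k (Sh k V) (Sh k V) \<and> (\<forall>w\<in>L. g (tens w) = tens (v # w))"
    if v: "v \<in> carrier V" for v
  proof (rule Sh_universal[OF V Sh.module, where \<phi> = "\<lambda>w. tens (v # w)"])
    fix w assume "w \<in> L"
    then show "tens (v # w) \<in> carrier (Sh k V)" using v by (simp add: word_tensor_closed[OF V])
  next
    fix us vs x y assume "us \<in> L" "vs \<in> L" "x \<in> carrier V" "y \<in> carrier V"
    then show "tens (v # us @ [x \<oplus>\<^bsub>V\<^esub> y] @ vs)
        = tens (v # us @ [x] @ vs) \<oplus>\<^bsub>Sh k V\<^esub> tens (v # us @ [y] @ vs)"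
      using v word_tensor_add[OF V, of "v # us" vs x y] by simp
  next
    fix us vs c x assume "us \<in> L" "vs \<in> L" "c \<in> carrier k" "x \<in> carrier V"
    then show "tens (v # us @ [c \<odot>\<^bsub>V\<^esub> x] @ vs) = c \<odot>\<^bsub>Sh k V\<^esub> tens (v # us @ [x] @ vs)"
      using v word_tensor_smult[OF V, of "v # us" vs c x] by simp
  qed blast
  then obtain C where C: "\<And>v. v \<in> carrier V \<Longrightarrow> C v \<in> linear_maps k (Sh k V) (Sh k V)"
    "\<And>v w. v \<in> carrier V \<Longrightarrow> w \<in> L \<Longrightarrow> C v (tens w) = tens (v # w)"
    by metis
  have "(\<lambda>s v. C v s) \<in> bilinear_maps k (Sh k V) V (Sh k V)"
  proof (rule bilinear_maps_from_generators[OF generates_Sh[OF V] Sh.module V Sh.module])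
    fix s assume "s \<in> tens ` L"
    then obtain w where w: "w \<in> L" "s = tens w" by blast
    have "(\<lambda>v. tens ([] @ [v] @ w)) \<in> linear_maps k V (Sh k V)"
      using w by (intro word_tensor_linear_in_letter[OF V]) auto
    then show "(\<lambda>v. C v s) \<in> linear_maps k V (Sh k V)"
      by (rule linear_maps_cong[OF _ V]) (use w C in simp)
  qed (rule C(1))
  then have "C \<in> bilinear_maps k V (Sh k V) (Sh k V)" by (rule bilinear_maps_flip)
  then show ?thesis using C(2) by blast
qed

lemma Sh_cons_bilinear: "cons \<in> bilinear_maps k V (Sh k V) (Sh k V)"
  and Sh_cons_word: "v \<in> carrier V \<Longrightarrow> w \<in> L \<Longrightarrow> cons v (tens w) = tens (v # w)"
  using someI_ex[OF Sh_cons_exists] unfolding Sh_cons_def by auto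

text \<open>
  On words this is the third defining equation of \<open>shuffle\<close>.
\<close>

lemma Sh_cons_shuffle:
  assumes "v \<in> carrier V" "w \<in> carrier V" "s \<in> carrier (Sh k V)" "t \<in> carrier (Sh k V)"
  shows "cons v s \<otimes>\<^bsub>Sh k V\<^esub> cons w t =
    cons v (s \<otimes>\<^bsub>Sh k V\<^esub> cons w t) \<oplus>\<^bsub>Sh k V\<^esub> cons w (cons v s \<otimes>\<^bsub>Sh k V\<^esub> t)"
proof -
  let ?H = "Sh k V"
  let ?sum = "\<lambda>m. multilinear_relations k V +>\<^bsub>words_algebra k V\<^esub> mset_vector k m"
  note H = Sh.module
  note consv = bilinear_maps_right[OF Sh_cons_bilinear assms(1)]
    and consw = bilinear_maps_right[OF Sh_cons_bilinear assms(2)]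
  have sum_cons: "cons x (?sum m) = ?sum (image_mset ((#) x) m)"
    if "x \<in> carrier V" "set_mset m \<subseteq> L" for x m
    using that(2)
  proof (induction m)
    case empty
    show ?case
      using linear_maps_zero[OF bilinear_maps_right[OF Sh_cons_bilinear that(1)] H H]
      by (simp add: word_sum_empty[OF V])
  next
    case (add u m)
    have "?sum m \<in> carrier ?H"
      using add.prems quotient_carrier[OF algebra.module[OF algebra_words_algebra[OF V]]
          multilinear_relations_submodule[OF V]] words_vector_closed[OF V]
      by (simp add: Sh_def)
    moreover have "set_mset (image_mset ((#) x) m) \<subseteq> L"
      using add.prems that(1) by (simp add: subset_eq)
    ultimately show ?case
      using add that(1) linear_maps_add[OF bilinear_maps_right[OF Sh_cons_bilinear that(1)]]
      by (simp add: word_sum_add_mset[OF V] Sh_cons_word word_tensor_closed[OF V])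
  qed
  have words: "cons v (tens a) \<otimes>\<^bsub>?H\<^esub> cons w (tens b) =
      cons v (tens a \<otimes>\<^bsub>?H\<^esub> cons w (tens b)) \<oplus>\<^bsub>?H\<^esub> cons w (cons v (tens a) \<otimes>\<^bsub>?H\<^esub> tens b)"
    if "a \<in> L" "b \<in> L" for a b
  proof -
    have sets: "set_mset (shuffle a (w # b)) \<subseteq> L" "set_mset (shuffle (v # a) b) \<subseteq> L"
      using assms that by (simp_all add: shuffle_in_lists)
    then have "set_mset (image_mset ((#) v) (shuffle a (w # b))) \<subseteq> L"
      "set_mset (image_mset ((#) w) (shuffle (v # a) b)) \<subseteq> L"
      using assms by (simp_all add: subset_eq)
    with sets assms that show ?thesis
      by (simp add: Sh_cons_word algebra_Sh(3)[OF V] sum_cons word_sum_add[OF V])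
  qed
  show ?thesis
    by (rule rota_baxter_from_generators[OF algebra_Sh(1)[OF V] generates_Sh[OF V] consv consw _
        assms(3,4)]) (use words in blast)
qed

end

section \<open>Homomorphisms from the shuffle algebra\<close>

text \<open>
  The source of multilinearity in the fold over a word: in \<open>B u\<^sub>1 (\<dots> (B u\<^sub>n (B z r)))\<close> the letter \<open>z\<close> is acted upon by the letters in
  front of it.
\<close>

lemma foldr_linear:
  assumes "B \<in> bilinear_maps k V M M" "us \<in> lists (carrier V)"
  shows "foldr B us \<in> linear_maps k M M"
  using assms(2)
proof (induction us)
  case Nil
  then show ?case by (simp add: linear_maps_def)
next
  case (Cons u us)
  have "(\<lambda>x. B u (foldr B us x)) \<in> linear_maps k M M"
    using Cons by (intro linear_maps_compose[OF bilinear_maps_right[OF assms(1)]]) auto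
  then show ?case by (simp add: comp_def)
qed

lemma Sh_fold:
  assumes "module k V" "module k M" and B: "B \<in> bilinear_maps k V M M" and m: "m \<in> carrier M"
  obtains g where "g \<in> linear_maps k (Sh k V) M" "g (word_tensor k V []) = m"
    "\<And>v s. v \<in> carrier V \<Longrightarrow> s \<in> carrier (Sh k V) \<Longrightarrow> g (Sh_cons k V v s) = B v (g s)"
proof -
  interpret V: module k V by fact
  interpret M: module k M by fact
  let ?\<phi> = "\<lambda>w. foldr B w m"
  have closed: "?\<phi> w \<in> carrier M" if "w \<in> lists (carrier V)" for w
    using linear_maps_closed[OF foldr_linear[OF B that] m] .
  obtain g where g: "g \<in> linear_maps k (Sh k V) M"
    "\<And>w. w \<in> lists (carrier V) \<Longrightarrow> g (word_tensor k V w) = ?\<phi> w"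
  proof (rule Sh_universal[OF assms(1,2), where \<phi> = ?\<phi>])
    fix us vs x y
    assume *: "us \<in> lists (carrier V)" "vs \<in> lists (carrier V)" "x \<in> carrier V" "y \<in> carrier V"
    note lin = bilinear_maps_left[OF B closed[OF *(2)]]
    show "?\<phi> (us @ [x \<oplus>\<^bsub>V\<^esub> y] @ vs) = ?\<phi> (us @ [x] @ vs) \<oplus>\<^bsub>M\<^esub> ?\<phi> (us @ [y] @ vs)"
      using * linear_maps_add[OF lin] linear_maps_closed[OF lin]
      by (simp add: linear_maps_add[OF foldr_linear[OF B *(1)]])
  next
    fix us vs c x
    assume *: "us \<in> lists (carrier V)" "vs \<in> lists (carrier V)" "c \<in> carrier k" "x \<in> carrier V"
    note lin = bilinear_maps_left[OF B closed[OF *(2)]]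
    show "?\<phi> (us @ [c \<odot>\<^bsub>V\<^esub> x] @ vs) = c \<odot>\<^bsub>M\<^esub> ?\<phi> (us @ [x] @ vs)"
      using * linear_maps_smult[OF lin] linear_maps_closed[OF lin]
      by (simp add: linear_maps_smult[OF foldr_linear[OF B *(1)]])
  qed (use closed in auto)
  note Sh = module_Sh[OF assms(1)]
  show thesis
  proof (rule that[OF g(1)])
    show "g (word_tensor k V []) = m" using g(2)[of "[]"] by simp
    fix v s assume v: "v \<in> carrier V" and s: "s \<in> carrier (Sh k V)"
    show "g (Sh_cons k V v s) = B v (g s)"
    proof (rule linear_maps_eq_on_generators[OF generates_Sh[OF assms(1)] Sh assms(2)
          linear_maps_compose[OF g(1) bilinear_maps_right[OF Sh_cons_bilinear[OF assms(1)] v]]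
          linear_maps_compose[OF bilinear_maps_right[OF B v] g(1)] _ s])
      fix x assume "x \<in> word_tensor k V ` lists (carrier V)"
      then obtain w where "w \<in> lists (carrier V)" "x = word_tensor k V w" by blast
      then show "g (Sh_cons k V v x) = B v (g x)"
        using v g(2) Sh_cons_word[OF assms(1) v] by simp
    qed
  qed
qed

text \<open>
  On words the claim follows by induction on both words: the shuffle recursion on the left and the
  assumed identity for \<open>B\<close> on the right reduce the product of two words to products in which one of
  them has lost its first letter.
\<close>

lemma Sh_fold_hom:
  assumes "module k V" "algebra k R" and B: "B \<in> bilinear_maps k V R R"
    and rota_baxter: "\<And>u v x y. \<lbrakk>u \<in> carrier V; v \<in> carrier V; x \<in> carrier R; y \<in> carrier R\<rbrakk> \<Longrightarrow>
      B u x \<otimes>\<^bsub>R\<^esub> B v y = B u (x \<otimes>\<^bsub>R\<^esub> B v y) \<oplus>\<^bsub>R\<^esub> B v (B u x \<otimes>\<^bsub>R\<^esub> y)"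
  obtains g where "g \<in> algebra_homs k (Sh k V) R"
    "\<And>v s. v \<in> carrier V \<Longrightarrow> s \<in> carrier (Sh k V) \<Longrightarrow> g (Sh_cons k V v s) = B v (g s)"
proof -
  interpret V: module k V by fact
  interpret R: algebra k R by fact
  interpret H: algebra k "Sh k V" by (rule algebra_Sh(1)[OF assms(1)])
  let ?w = "word_tensor k V" and ?H = "Sh k V" and ?C = "Sh_cons k V"
  note one = algebra_Sh(2)[OF assms(1)]
  obtain g where g: "g \<in> linear_maps k ?H R" "g (?w []) = \<one>\<^bsub>R\<^esub>"
    and cons: "\<And>v s. v \<in> carrier V \<Longrightarrow> s \<in> carrier ?H \<Longrightarrow> g (?C v s) = B v (g s)"
    using Sh_fold[OF assms(1) R.module B R.one_closed] by metis
  note wd = word_tensor_closed[OF assms(1)]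
  note closed = linear_maps_closed[OF g(1)]
  have mult: "g (?w v \<otimes>\<^bsub>?H\<^esub> ?w w) = g (?w v) \<otimes>\<^bsub>R\<^esub> g (?w w)"
    if "v \<in> lists (carrier V)" "w \<in> lists (carrier V)" for v w
    using that
  proof (induction v w rule: shuffle.induct)
    case (1 ys)
    then show ?case using closed[OF wd[OF 1(2)]] wd[OF 1(2)] g(2) by (simp flip: one)
  next
    case (2 x xs)
    then show ?case using closed[OF wd[OF 2(1)]] wd[OF 2(1)] g(2) by (simp flip: one)
  next
    case (3 x xs y ys)
    then have letters: "x \<in> carrier V" "y \<in> carrier V" "xs \<in> lists (carrier V)" "ys \<in> lists (carrier V)"
      by auto
    note bil = Sh_cons_bilinear[OF assms(1)]
    have words: "?w (x # xs) = ?C x (?w xs)" "?w (y # ys) = ?C y (?w ys)"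
      using letters Sh_cons_word[OF assms(1)] by simp_all
    let ?s = "?w xs" and ?t = "?w ys"
    have st: "?s \<in> carrier ?H" "?t \<in> carrier ?H" "?C x ?s \<in> carrier ?H" "?C y ?t \<in> carrier ?H"
      using letters wd by (auto intro: bilinear_maps_closed[OF bil])
    have IH: "g (?s \<otimes>\<^bsub>?H\<^esub> ?C y ?t) = g ?s \<otimes>\<^bsub>R\<^esub> B y (g ?t)"
      "g (?C x ?s \<otimes>\<^bsub>?H\<^esub> ?t) = B x (g ?s) \<otimes>\<^bsub>R\<^esub> g ?t"
      using 3 letters st by (simp_all add: words cons)
    have "g (?C x ?s \<otimes>\<^bsub>?H\<^esub> ?C y ?t) = g (?C x (?s \<otimes>\<^bsub>?H\<^esub> ?C y ?t) \<oplus>\<^bsub>?H\<^esub> ?C y (?C x ?s \<otimes>\<^bsub>?H\<^esub> ?t))"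
      using Sh_cons_shuffle[OF assms(1)] letters st by simp
    also have "\<dots> = g (?C x (?s \<otimes>\<^bsub>?H\<^esub> ?C y ?t)) \<oplus>\<^bsub>R\<^esub> g (?C y (?C x ?s \<otimes>\<^bsub>?H\<^esub> ?t))"
      using letters st by (intro linear_maps_add[OF g(1)] bilinear_maps_closed[OF bil]) auto
    also have "\<dots> = B x (g ?s \<otimes>\<^bsub>R\<^esub> B y (g ?t)) \<oplus>\<^bsub>R\<^esub> B y (B x (g ?s) \<otimes>\<^bsub>R\<^esub> g ?t)"
      using letters st by (simp add: cons IH)
    also have "\<dots> = B x (g ?s) \<otimes>\<^bsub>R\<^esub> B y (g ?t)"
      using letters st closed by (simp add: rota_baxter)
    finally show ?case using letters st by (simp add: words cons)
  qed
  have "g \<in> algebra_homs k ?H R"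
    by (rule algebra_homs_from_generators[OF H.algebra_axioms assms(2) generates_Sh[OF assms(1)] g(1)])
       (use g(2) mult in \<open>auto simp: one\<close>)
  then show thesis using cons by (rule that)
qed

section \<open>The matching Rota-Baxter algebra\<close>

context
  fixes k :: "('k, 'm) ring_scheme" and \<Omega> :: "'w set" and A :: "('k, 'a, 'n) module_scheme"
  assumes A: "algebra k A"
begin

interpretation A: algebra k A by (rule A)

private abbreviation (input) "V \<equiv> sha_letters k \<Omega> A"
private abbreviation (input) "H \<equiv> Sh k (sha_letters k \<Omega> A)"
private abbreviation (input) "letter \<omega> a \<equiv> tensor k (free_module k \<Omega>) A (basis_elem k \<omega>) a"
private abbreviation (input) "ten \<equiv> tensor k A (Sh k (sha_letters k \<Omega> A))"
private abbreviation (input) "wd \<equiv> word_tensor k (sha_letters k \<Omega> A)"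

lemma module_sha_letters: "module k V"
  unfolding sha_letters_def
  by (rule module_tensor_product[OF module_free_module[OF A.R_cring] A.module])

lemma letter_closed: "\<omega> \<in> \<Omega> \<Longrightarrow> a \<in> carrier A \<Longrightarrow> letter \<omega> a \<in> carrier V"
  unfolding sha_letters_def
  by (rule bilinear_maps_closed[OF tensor_bilinear[OF module_free_module[OF A.R_cring] A.module]])
     (simp_all add: basis_elem_closed[OF A.R_cring])

lemma letter_linear: "\<omega> \<in> \<Omega> \<Longrightarrow> (\<lambda>a. letter \<omega> a) \<in> linear_maps k A V"
  unfolding sha_letters_def
  by (rule bilinear_maps_right[OF tensor_bilinear[OF module_free_module[OF A.R_cring] A.module]])
     (simp add: basis_elem_closed[OF A.R_cring])

text \<open>
  This allows one to treat an arbitrary letter as if it were of the form \<open>\<omega> \<otimes> a\<close>.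
\<close>

lemma generates_sha_letters: "generates k V ((\<lambda>(\<omega>, a). letter \<omega> a) ` (\<Omega> \<times> carrier A))"
proof -
  have image_eq: "(\<lambda>(p, a). t p a) ` (g ` \<Omega> \<times> B) = (\<lambda>(\<omega>, a). t (g \<omega>) a) ` (\<Omega> \<times> B)"
    for t :: "_ \<Rightarrow> 'a \<Rightarrow> 'z" and g :: "'w \<Rightarrow> 'w \<Rightarrow> 'k" and B
    by force
  show ?thesis
    using generates_tensor_product_generators[OF module_free_module[OF A.R_cring] A.module
        generates_free_module[OF A.R_cring, of \<Omega>] generates_carrier]
    unfolding image_eq sha_letters_def .
qed

lemma algebra_sha_words: "algebra k H"
  by (rule algebra_Sh(1)[OF module_sha_letters])

interpretation H: algebra k "Sh k (sha_letters k \<Omega> A)" by (rule algebra_sha_words)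

lemma algebra_Sha: "algebra k (Sha k \<Omega> A)"
  unfolding Sha_def by (rule algebra_tensor_product(1)[OF A algebra_sha_words])

interpretation Sha: algebra k "Sha k \<Omega> A" by (rule algebra_Sha)

lemma Sha_one: "\<one>\<^bsub>Sha k \<Omega> A\<^esub> = ten \<one>\<^bsub>A\<^esub> \<one>\<^bsub>H\<^esub>"
  unfolding Sha_def by (rule algebra_tensor_product(2)[OF A algebra_sha_words])

lemma Sha_mult:
  "a \<in> carrier A \<Longrightarrow> s \<in> carrier H \<Longrightarrow> b \<in> carrier A \<Longrightarrow> t \<in> carrier H \<Longrightarrow>
    ten a s \<otimes>\<^bsub>Sha k \<Omega> A\<^esub> ten b t = ten (a \<otimes>\<^bsub>A\<^esub> b) (s \<otimes>\<^bsub>H\<^esub> t)"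
  unfolding Sha_def by (rule algebra_tensor_product(3)[OF A algebra_sha_words])

lemma Sha_tensor_bilinear: "ten \<in> bilinear_maps k A H (Sha k \<Omega> A)"
  unfolding Sha_def by (rule tensor_bilinear[OF A.module H.module])

lemma generates_Sha: "generates k (Sha k \<Omega> A) ((\<lambda>(a, s). ten a s) ` (carrier A \<times> carrier H))"
  unfolding Sha_def by (rule generates_tensor_product[OF A.module H.module])

lemma generates_Sha_words:
  "generates k (Sha k \<Omega> A) ((\<lambda>(a, s). ten a s) ` (carrier A \<times> wd ` lists (carrier V)))"
  unfolding Sha_def
  by (rule generates_tensor_product_generators[OF A.module H.module generates_carrier
        generates_Sh[OF module_sha_letters]])

lemma sha_operator_exists:
  assumes "\<omega> \<in> \<Omega>"
  obtains P where "P \<in> linear_maps k (Sha k \<Omega> A) (Sha k \<Omega> A)"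
    "\<And>a s. a \<in> carrier A \<Longrightarrow> s \<in> carrier H \<Longrightarrow> P (ten a s) = ten \<one>\<^bsub>A\<^esub> (Sh_cons k V (letter \<omega> a) s)"
proof -
  note cons = Sh_cons_bilinear[OF module_sha_letters]
  note ten_one = bilinear_maps_right[OF Sha_tensor_bilinear A.one_closed]
  have "(\<lambda>a s. ten \<one>\<^bsub>A\<^esub> (Sh_cons k V (letter \<omega> a) s)) \<in> bilinear_maps k A H (Sha k \<Omega> A)"
    by (intro bilinear_mapsI linear_maps_compose[OF ten_one] bilinear_maps_right[OF cons]
        linear_maps_compose[OF bilinear_maps_left[OF cons] letter_linear[OF assms]]
        letter_closed[OF assms])
  from tensor_universal[OF A.module H.module Sha.module this]
  show thesis unfolding Sha_def[symmetric] using that by blast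
qed

text \<open>
  The operator is defined by its values on the tensors of words. Since these generate, it agrees with
  the map \<open>a \<otimes> s \<mapsto> 1 \<otimes> (\<omega> \<otimes> a)\<cdot>s\<close> provided by the universal property of the tensor product, and this
  gives its values on all \<open>a \<otimes> s\<close>.
\<close>

lemma sha_operator_properties:
  assumes "\<omega> \<in> \<Omega>"
  shows "sha_operator k \<Omega> A \<omega> \<in> linear_maps k (Sha k \<Omega> A) (Sha k \<Omega> A)"
    and "a \<in> carrier A \<Longrightarrow> s \<in> carrier H \<Longrightarrow>
      sha_operator k \<Omega> A \<omega> (ten a s) = ten \<one>\<^bsub>A\<^esub> (Sh_cons k V (letter \<omega> a) s)"
proof -
  let ?S = "Sha k \<Omega> A"
  note V = module_sha_letters
  obtain P where P: "P \<in> linear_maps k ?S ?S"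
    "\<And>a s. a \<in> carrier A \<Longrightarrow> s \<in> carrier H \<Longrightarrow> P (ten a s) = ten \<one>\<^bsub>A\<^esub> (Sh_cons k V (letter \<omega> a) s)"
    using sha_operator_exists[OF assms] by metis
  let ?P = "restrict P (carrier ?S)"
  have P': "?P \<in> linear_maps k ?S ?S"
    by (rule linear_maps_cong[OF P(1) Sha.module]) simp
  have tensor: "?P (ten a s) = ten \<one>\<^bsub>A\<^esub> (Sh_cons k V (letter \<omega> a) s)"
    if "a \<in> carrier A" "s \<in> carrier H" for a s
    using that P(2) bilinear_maps_closed[OF Sha_tensor_bilinear] by simp
  have words: "?P (ten a (wd vs)) = ten \<one>\<^bsub>A\<^esub> (wd (letter \<omega> a # vs))"
    if "a \<in> carrier A" "vs \<in> lists (carrier V)" for a vs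
    using that letter_closed[OF assms] tensor word_tensor_closed[OF V] Sh_cons_word[OF V] by simp
  have eq: "sha_operator k \<Omega> A \<omega> = ?P"
    unfolding sha_operator_def sha_tensor_def
  proof (rule the_equality, intro conjI ballI)
    fix Q assume Q: "Q \<in> extensional (carrier ?S) \<and> Q \<in> linear_maps k ?S ?S \<and>
      (\<forall>a\<in>carrier A. \<forall>vs\<in>lists (carrier V). Q (ten a (wd vs)) = ten \<one>\<^bsub>A\<^esub> (wd (letter \<omega> a # vs)))"
    show "Q = ?P"
    proof (rule extensionalityI[of _ "carrier ?S"])
      fix x assume "x \<in> carrier ?S"
      then show "Q x = ?P x"
      proof (rule linear_maps_eq_on_generators[OF generates_Sha_words Sha.module Sha.module _ P', rotated 2])
        show "Q \<in> linear_maps k ?S ?S" using Q by simp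
        fix y assume "y \<in> (\<lambda>(a, s). ten a s) ` (carrier A \<times> wd ` lists (carrier V))"
        then obtain a vs where "a \<in> carrier A" "vs \<in> lists (carrier V)" "y = ten a (wd vs)" by auto
        then show "Q y = ?P y" using Q words by metis
      qed
    qed (use Q in auto)
  qed (use P' words in \<open>auto simp del: restrict_apply\<close>)
  show "sha_operator k \<Omega> A \<omega> \<in> linear_maps k ?S ?S" unfolding eq by (rule P')
  show "sha_operator k \<Omega> A \<omega> (ten a s) = ten \<one>\<^bsub>A\<^esub> (Sh_cons k V (letter \<omega> a) s)"
    if "a \<in> carrier A" "s \<in> carrier H"
    unfolding eq by (rule tensor[OF that])
qed

text \<open>
  For \<open>x = a \<otimes> s\<close> and \<open>y = b \<otimes> t\<close> the three terms of the identity have the form \<open>1 \<otimes> u\<close>, and the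
  second components are related by \<open>Sh_cons_shuffle\<close> for the letters \<open>\<alpha> \<otimes> a\<close> and \<open>\<beta> \<otimes> b\<close>.
\<close>

lemma Sha_matching_rota_baxter: "comm_matching_rota_baxter_algebra k \<Omega> (Sha k \<Omega> A) (sha_operator k \<Omega> A)"
proof (intro comm_matching_rota_baxter_algebra.intro algebra_Sha
    comm_matching_rota_baxter_algebra_axioms.intro)
  fix \<omega> assume "\<omega> \<in> \<Omega>"
  then show "sha_operator k \<Omega> A \<omega> \<in> linear_maps k (Sha k \<Omega> A) (Sha k \<Omega> A)"
    by (rule sha_operator_properties(1))
next
  let ?S = "Sha k \<Omega> A" and ?P = "sha_operator k \<Omega> A"
  note V = module_sha_letters
  fix \<alpha> \<beta> x y
  assume \<alpha>: "\<alpha> \<in> \<Omega>" and \<beta>: "\<beta> \<in> \<Omega>" and xy: "x \<in> carrier ?S" "y \<in> carrier ?S"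
  show "?P \<alpha> x \<otimes>\<^bsub>?S\<^esub> ?P \<beta> y = ?P \<alpha> (x \<otimes>\<^bsub>?S\<^esub> ?P \<beta> y) \<oplus>\<^bsub>?S\<^esub> ?P \<beta> (?P \<alpha> x \<otimes>\<^bsub>?S\<^esub> y)"
  proof (rule rota_baxter_from_generators[OF algebra_Sha generates_Sha sha_operator_properties(1)[OF \<alpha>]
        sha_operator_properties(1)[OF \<beta>] _ xy])
    fix x y assume "x \<in> (\<lambda>(a, s). ten a s) ` (carrier A \<times> carrier H)"
      "y \<in> (\<lambda>(a, s). ten a s) ` (carrier A \<times> carrier H)"
    then obtain a s b t where a: "a \<in> carrier A" "s \<in> carrier H" and x: "x = ten a s"
      and b: "b \<in> carrier A" "t \<in> carrier H" and y: "y = ten b t" by auto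
    let ?u = "letter \<alpha> a" and ?v = "letter \<beta> b" and ?C = "Sh_cons k V"
    have u: "?u \<in> carrier V" and v: "?v \<in> carrier V" using letter_closed \<alpha> \<beta> a b by simp_all
    note Cu = linear_maps_closed[OF bilinear_maps_right[OF Sh_cons_bilinear[OF V] u]]
      and Cv = linear_maps_closed[OF bilinear_maps_right[OF Sh_cons_bilinear[OF V] v]]
    note P\<alpha> = sha_operator_properties(2)[OF \<alpha>] and P\<beta> = sha_operator_properties(2)[OF \<beta>]
    have "?P \<alpha> x \<otimes>\<^bsub>?S\<^esub> ?P \<beta> y = ten \<one>\<^bsub>A\<^esub> (?C ?u s \<otimes>\<^bsub>H\<^esub> ?C ?v t)"
      using a b Cu Cv by (simp add: x y P\<alpha> P\<beta> Sha_mult)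
    also have "\<dots> = ten \<one>\<^bsub>A\<^esub> (?C ?u (s \<otimes>\<^bsub>H\<^esub> ?C ?v t)) \<oplus>\<^bsub>?S\<^esub> ten \<one>\<^bsub>A\<^esub> (?C ?v (?C ?u s \<otimes>\<^bsub>H\<^esub> t))"
      using a b Cu Cv
      by (simp add: Sh_cons_shuffle[OF V u v]
          linear_maps_add[OF bilinear_maps_right[OF Sha_tensor_bilinear A.one_closed]])
    also have "\<dots> = ?P \<alpha> (x \<otimes>\<^bsub>?S\<^esub> ?P \<beta> y) \<oplus>\<^bsub>?S\<^esub> ?P \<beta> (?P \<alpha> x \<otimes>\<^bsub>?S\<^esub> y)"
      using a b Cu Cv by (simp add: x y P\<alpha> P\<beta> Sha_mult)
    finally show "?P \<alpha> x \<otimes>\<^bsub>?S\<^esub> ?P \<beta> y = ?P \<alpha> (x \<otimes>\<^bsub>?S\<^esub> ?P \<beta> y) \<oplus>\<^bsub>?S\<^esub> ?P \<beta> (?P \<alpha> x \<otimes>\<^bsub>?S\<^esub> y)" .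
  qed
qed

lemma sha_embedding_hom: "sha_embedding k \<Omega> A \<in> algebra_homs k A (Sha k \<Omega> A)"
proof -
  have "sha_embedding k \<Omega> A \<in> linear_maps k A (Sha k \<Omega> A)"
    using bilinear_maps_left[OF Sha_tensor_bilinear H.one_closed] by (simp add: sha_embedding_def[abs_def])
  then show ?thesis
    by (rule algebra_homs_from_generators[OF A algebra_Sha generates_carrier])
       (simp_all add: sha_embedding_def Sha_one Sha_mult)
qed

section \<open>The universal property\<close>

context
  fixes R :: "('k, 'r, 'l) module_scheme" and P :: "'w \<Rightarrow> 'r \<Rightarrow> 'r" and f :: "'a \<Rightarrow> 'r"
  assumes R: "comm_matching_rota_baxter_algebra k \<Omega> R P" and f: "f \<in> algebra_homs k A R"
begin

interpretation R: comm_matching_rota_baxter_algebra k \<Omega> R P by (rule R)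
interpretation Sha: comm_matching_rota_baxter_algebra k \<Omega> "Sha k \<Omega> A" "sha_operator k \<Omega> A"
  by (rule Sha_matching_rota_baxter)

lemma f_linear: "f \<in> linear_maps k A R"
  and f_one: "f \<one>\<^bsub>A\<^esub> = \<one>\<^bsub>R\<^esub>"
  and f_mult: "a \<in> carrier A \<Longrightarrow> b \<in> carrier A \<Longrightarrow> f (a \<otimes>\<^bsub>A\<^esub> b) = f a \<otimes>\<^bsub>R\<^esub> f b"
  using f by (auto simp: algebra_homs_def ring_hom_def)

lemmas f_closed = linear_maps_closed[OF f_linear]

text \<open>
  For fixed \<open>r\<close> the map \<open>(\<omega>, a) \<mapsto> P\<^sub>\<omega> (f a r)\<close> is linear in \<open>a\<close>, hence extends to a bilinear map on
  \<open>k\<Omega> \<times> A\<close> and to a linear map on the letters. Linearity in \<open>r\<close> is visible on the letters \<open>\<omega> \<otimes> a\<close>.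
\<close>

lemma letter_action_exists:
  obtains B where "B \<in> bilinear_maps k V R R"
    "\<And>\<omega> a r. \<omega> \<in> \<Omega> \<Longrightarrow> a \<in> carrier A \<Longrightarrow> r \<in> carrier R \<Longrightarrow> B (letter \<omega> a) r = P \<omega> (f a \<otimes>\<^bsub>R\<^esub> r)"
proof -
  note k = A.R_cring
  note F = module_free_module[OF k, of \<Omega>] and V = module_sha_letters
  note mult = bilinear_maps_mult[OF R.algebra_axioms]
  have "\<exists>h. h \<in> linear_maps k V R \<and> (\<forall>\<omega>\<in>\<Omega>. \<forall>a\<in>carrier A. h (letter \<omega> a) = P \<omega> (f a \<otimes>\<^bsub>R\<^esub> r))"
    if r: "r \<in> carrier R" for r
  proof -
    \<comment> \<open>the extension of \<open>(\<omega>, a) \<mapsto> P\<^sub>\<omega> (f a r)\<close> to \<open>k\<Omega> \<times> A\<close>\<close>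
    let ?b = "\<lambda>p a. linear_extension k R (\<lambda>\<omega>. P \<omega> (f a \<otimes>\<^bsub>R\<^esub> r)) p"
    have P_lin: "(\<lambda>a. P \<omega> (f a \<otimes>\<^bsub>R\<^esub> r)) \<in> linear_maps k A R" if "\<omega> \<in> \<Omega>" for \<omega>
      by (intro linear_maps_compose[OF R.operator_linear[OF that]]
          linear_maps_compose[OF bilinear_maps_left[OF mult r] f_linear])
    have \<phi>: "(\<lambda>\<omega>. P \<omega> (f a \<otimes>\<^bsub>R\<^esub> r)) \<in> \<Omega> \<rightarrow> carrier R" if "a \<in> carrier A" for a
      using linear_maps_closed[OF P_lin that] by simp
    have basis: "?b (basis_elem k \<omega>) a = P \<omega> (f a \<otimes>\<^bsub>R\<^esub> r)" if "\<omega> \<in> \<Omega>" "a \<in> carrier A" for \<omega> a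
      by (rule linear_extension_basis_elem[OF k R.module \<phi>[OF that(2)] that(1)])
    have "?b \<in> bilinear_maps k (free_module k \<Omega>) A R"
    proof (rule bilinear_maps_from_generators[OF generates_free_module[OF k] F A.module R.module])
      fix a assume "a \<in> carrier A"
      then show "(\<lambda>p. ?b p a) \<in> linear_maps k (free_module k \<Omega>) R"
        by (intro linear_extension_linear[OF k R.module] \<phi>)
    next
      fix p assume "p \<in> basis_elem k ` \<Omega>"
      then obtain \<omega> where \<omega>: "\<omega> \<in> \<Omega>" "p = basis_elem k \<omega>" by blast
      show "?b p \<in> linear_maps k A R"
        by (rule linear_maps_cong[OF P_lin[OF \<omega>(1)] A.module]) (use \<omega> basis in simp)
    qed
    then obtain h where "h \<in> linear_maps k V R"
      "\<And>p a. p \<in> carrier (free_module k \<Omega>) \<Longrightarrow> a \<in> carrier A \<Longrightarrow> h (tensor k (free_module k \<Omega>) A p a) = ?b p a"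
      using tensor_universal[OF F A.module R.module] unfolding sha_letters_def by metis
    then show ?thesis using basis basis_elem_closed[OF k] by metis
  qed
  then obtain h where h: "\<And>r. r \<in> carrier R \<Longrightarrow> h r \<in> linear_maps k V R"
    "\<And>r \<omega> a. r \<in> carrier R \<Longrightarrow> \<omega> \<in> \<Omega> \<Longrightarrow> a \<in> carrier A \<Longrightarrow> h r (letter \<omega> a) = P \<omega> (f a \<otimes>\<^bsub>R\<^esub> r)"
    by metis
  have "(\<lambda>v r. h r v) \<in> bilinear_maps k V R R"
  proof (rule bilinear_maps_from_generators[OF generates_sha_letters V R.module R.module])
    fix v assume "v \<in> (\<lambda>(\<omega>, a). letter \<omega> a) ` (\<Omega> \<times> carrier A)"
    then obtain \<omega> a where v: "\<omega> \<in> \<Omega>" "a \<in> carrier A" "v = letter \<omega> a" by auto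
    have "(\<lambda>r. P \<omega> (f a \<otimes>\<^bsub>R\<^esub> r)) \<in> linear_maps k R R"
      using v by (intro linear_maps_compose[OF R.operator_linear] bilinear_maps_right[OF mult] f_closed)
    then show "(\<lambda>r. h r v) \<in> linear_maps k R R"
      by (rule linear_maps_cong[OF _ R.module]) (use v h in simp)
  qed (rule h(1))
  then show thesis by (rule that) (rule h(2))
qed

text \<open>
  The identity that \<open>Sh_fold_hom\<close> asks of the action of the letters is, for the letters \<open>\<alpha> \<otimes> a\<close> and
  \<open>\<beta> \<otimes> b\<close>, the matching Rota-Baxter identity of \<open>R\<close> for the arguments \<open>f a x\<close> and \<open>f b y\<close>; here
  commutativity of \<open>R\<close> is used to move \<open>f b\<close> to the front.
\<close>

lemma Sha_hom_exists:
  obtains g where "g \<in> matching_rota_baxter_homs k \<Omega> (Sha k \<Omega> A) (sha_operator k \<Omega> A) R P"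
    "\<And>a. a \<in> carrier A \<Longrightarrow> g (sha_embedding k \<Omega> A a) = f a"
proof -
  let ?S = "Sha k \<Omega> A" and ?C = "Sh_cons k V"
  note V = module_sha_letters
  note mult = bilinear_maps_mult[OF R.algebra_axioms]
  obtain B where B: "B \<in> bilinear_maps k V R R"
    and B_letter: "\<And>\<omega> a r. \<omega> \<in> \<Omega> \<Longrightarrow> a \<in> carrier A \<Longrightarrow> r \<in> carrier R \<Longrightarrow> B (letter \<omega> a) r = P \<omega> (f a \<otimes>\<^bsub>R\<^esub> r)"
    using letter_action_exists by metis
  note B_closed = bilinear_maps_closed[OF B]
  note B_left = bilinear_maps_left[OF B] and B_right = bilinear_maps_right[OF B]
  have P_closed: "P \<omega> x \<in> carrier R" if "\<omega> \<in> \<Omega>" "x \<in> carrier R" for \<omega> x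
    using linear_maps_closed[OF R.operator_linear] that .
  have rota_baxter: "B u x \<otimes>\<^bsub>R\<^esub> B v y = B u (x \<otimes>\<^bsub>R\<^esub> B v y) \<oplus>\<^bsub>R\<^esub> B v (B u x \<otimes>\<^bsub>R\<^esub> y)"
    if uv: "u \<in> carrier V" "v \<in> carrier V" and xy: "x \<in> carrier R" "y \<in> carrier R" for u v x y
  proof -
    have bil1: "(\<lambda>u v. B u x \<otimes>\<^bsub>R\<^esub> B v y) \<in> bilinear_maps k V V R"
      by (intro bilinear_mapsI linear_maps_compose[OF bilinear_maps_right[OF mult] B_left]
          linear_maps_compose[OF bilinear_maps_left[OF mult] B_left] B_closed xy)
    have bil2: "(\<lambda>u v. B u (x \<otimes>\<^bsub>R\<^esub> B v y)) \<in> bilinear_maps k V V R"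
      by (intro bilinear_mapsI linear_maps_compose[OF B_right]
          linear_maps_compose[OF bilinear_maps_right[OF mult] B_left] B_left B_closed xy R.m_closed)
    have bil3: "(\<lambda>u v. B v (B u x \<otimes>\<^bsub>R\<^esub> y)) \<in> bilinear_maps k V V R"
      by (intro bilinear_mapsI linear_maps_compose[OF B_right]
          linear_maps_compose[OF bilinear_maps_left[OF mult] B_left] B_left B_closed xy R.m_closed)
    have bil4: "(\<lambda>u v. B u (x \<otimes>\<^bsub>R\<^esub> B v y) \<oplus>\<^bsub>R\<^esub> B v (B u x \<otimes>\<^bsub>R\<^esub> y)) \<in> bilinear_maps k V V R"
      by (intro bilinear_mapsI linear_maps_plus R.module bilinear_maps_right[OF bil2]
          bilinear_maps_right[OF bil3] bilinear_maps_left[OF bil2] bilinear_maps_left[OF bil3])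
    show ?thesis
    proof (rule bilinear_maps_eq_on_generators[OF generates_sha_letters
          generates_sha_letters V V R.module bil1 bil4 _ uv])
      fix u v assume "u \<in> (\<lambda>(\<omega>, a). letter \<omega> a) ` (\<Omega> \<times> carrier A)"
        "v \<in> (\<lambda>(\<omega>, a). letter \<omega> a) ` (\<Omega> \<times> carrier A)"
      then obtain \<alpha> a \<beta> b where u: "\<alpha> \<in> \<Omega>" "a \<in> carrier A" "u = letter \<alpha> a"
        and v: "\<beta> \<in> \<Omega>" "b \<in> carrier A" "v = letter \<beta> b" by auto
      have fab: "f a \<in> carrier R" "f b \<in> carrier R" using f_closed u v by simp_all
      let ?x = "f a \<otimes>\<^bsub>R\<^esub> x" and ?y = "f b \<otimes>\<^bsub>R\<^esub> y"
      have closed: "?x \<in> carrier R" "?y \<in> carrier R" "P \<alpha> ?x \<in> carrier R" "P \<beta> ?y \<in> carrier R"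
        using fab xy u v P_closed by simp_all
      have "P \<alpha> ?x \<otimes>\<^bsub>R\<^esub> P \<beta> ?y = P \<alpha> (?x \<otimes>\<^bsub>R\<^esub> P \<beta> ?y) \<oplus>\<^bsub>R\<^esub> P \<beta> (P \<alpha> ?x \<otimes>\<^bsub>R\<^esub> ?y)"
        using u v closed by (intro R.matching_rota_baxter)
      moreover have "?x \<otimes>\<^bsub>R\<^esub> P \<beta> ?y = f a \<otimes>\<^bsub>R\<^esub> (x \<otimes>\<^bsub>R\<^esub> P \<beta> ?y)"
        using fab xy closed by (simp add: R.m_assoc)
      moreover have "P \<alpha> ?x \<otimes>\<^bsub>R\<^esub> ?y = f b \<otimes>\<^bsub>R\<^esub> (P \<alpha> ?x \<otimes>\<^bsub>R\<^esub> y)"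
        using fab xy closed by (simp add: R.m_lcomm)
      ultimately show "B u x \<otimes>\<^bsub>R\<^esub> B v y = B u (x \<otimes>\<^bsub>R\<^esub> B v y) \<oplus>\<^bsub>R\<^esub> B v (B u x \<otimes>\<^bsub>R\<^esub> y)"
        using u v xy closed by (simp add: B_letter)
    qed
  qed
  obtain h where h: "h \<in> algebra_homs k H R"
    and h_cons: "\<And>v s. v \<in> carrier V \<Longrightarrow> s \<in> carrier H \<Longrightarrow> h (?C v s) = B v (h s)"
  proof (rule Sh_fold_hom[OF V R.algebra_axioms B])
    fix h assume "h \<in> algebra_homs k H R"
      "\<And>v s. v \<in> carrier V \<Longrightarrow> s \<in> carrier H \<Longrightarrow> h (?C v s) = B v (h s)"
    then show thesis by (rule that)
  qed (rule rota_baxter)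
  have h_linear: "h \<in> linear_maps k H R" and h_one: "h \<one>\<^bsub>H\<^esub> = \<one>\<^bsub>R\<^esub>"
    and h_mult: "\<And>s t. s \<in> carrier H \<Longrightarrow> t \<in> carrier H \<Longrightarrow> h (s \<otimes>\<^bsub>H\<^esub> t) = h s \<otimes>\<^bsub>R\<^esub> h t"
    using h by (auto simp: algebra_homs_def ring_hom_def)
  note h_closed = linear_maps_closed[OF h_linear]
  have "(\<lambda>a s. f a \<otimes>\<^bsub>R\<^esub> h s) \<in> bilinear_maps k A H R"
    by (intro bilinear_mapsI linear_maps_compose[OF bilinear_maps_right[OF mult] h_linear]
        linear_maps_compose[OF bilinear_maps_left[OF mult] f_linear] f_closed h_closed)
  then obtain g where g: "g \<in> linear_maps k ?S R"
    and g_tensor: "\<And>a s. a \<in> carrier A \<Longrightarrow> s \<in> carrier H \<Longrightarrow> g (ten a s) = f a \<otimes>\<^bsub>R\<^esub> h s"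
    using tensor_universal[OF A.module H.module R.module] unfolding Sha_def by metis
  have "g \<in> algebra_homs k ?S R"
  proof (rule algebra_homs_from_generators[OF Sha.algebra_axioms R.algebra_axioms generates_Sha g])
    show "g \<one>\<^bsub>?S\<^esub> = \<one>\<^bsub>R\<^esub>" by (simp add: Sha_one g_tensor f_one h_one)
    fix x y assume "x \<in> (\<lambda>(a, s). ten a s) ` (carrier A \<times> carrier H)"
      "y \<in> (\<lambda>(a, s). ten a s) ` (carrier A \<times> carrier H)"
    then obtain a s b t where "a \<in> carrier A" "s \<in> carrier H" "x = ten a s"
      "b \<in> carrier A" "t \<in> carrier H" "y = ten b t" by auto
    then show "g (x \<otimes>\<^bsub>?S\<^esub> y) = g x \<otimes>\<^bsub>R\<^esub> g y"
      using f_closed h_closed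
      by (simp add: Sha_mult g_tensor f_mult h_mult R.m_assoc R.m_lcomm)
  qed
  moreover have "g (sha_operator k \<Omega> A \<omega> x) = P \<omega> (g x)" if \<omega>: "\<omega> \<in> \<Omega>" and x: "x \<in> carrier ?S" for \<omega> x
  proof (rule linear_maps_eq_on_generators[OF generates_Sha Sha.module R.module
        linear_maps_compose[OF g Sha.operator_linear[OF \<omega>]]
        linear_maps_compose[OF R.operator_linear[OF \<omega>] g] _ x])
    fix y assume "y \<in> (\<lambda>(a, s). ten a s) ` (carrier A \<times> carrier H)"
    then obtain a s where y: "a \<in> carrier A" "s \<in> carrier H" "y = ten a s" by auto
    have u: "letter \<omega> a \<in> carrier V" by (rule letter_closed[OF \<omega> y(1)])
    have "?C (letter \<omega> a) s \<in> carrier H"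
      by (rule bilinear_maps_closed[OF Sh_cons_bilinear[OF V] u y(2)])
    then show "g (sha_operator k \<Omega> A \<omega> y) = P \<omega> (g y)"
      using \<omega> y u f_closed h_closed P_closed
      by (simp add: sha_operator_properties(2)[OF \<omega>] g_tensor h_cons B_letter f_one)
  qed
  ultimately have "g \<in> matching_rota_baxter_homs k \<Omega> ?S (sha_operator k \<Omega> A) R P"
    by (simp add: matching_rota_baxter_homs_def)
  moreover have "g (sha_embedding k \<Omega> A a) = f a" if "a \<in> carrier A" for a
    using that f_closed by (simp add: sha_embedding_def g_tensor h_one)
  ultimately show thesis by (rule that)
qed

text \<open>
  A homomorphism is known on \<open>a \<otimes> s\<close> once it is known on \<open>j a\<close> and on \<open>1 \<otimes> s\<close>, and it is known on
  \<open>1 \<otimes> (\<omega> \<otimes> a)\<cdot>s = P\<^sub>\<omega> (a \<otimes> s)\<close> once it is known on \<open>a \<otimes> s\<close>. In the induction on words the first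
  letter is arbitrary; by linearity it may be taken of the form \<open>\<omega> \<otimes> a\<close>.
\<close>

lemma Sha_hom_unique:
  assumes g: "g \<in> matching_rota_baxter_homs k \<Omega> (Sha k \<Omega> A) (sha_operator k \<Omega> A) R P"
    and h: "h \<in> matching_rota_baxter_homs k \<Omega> (Sha k \<Omega> A) (sha_operator k \<Omega> A) R P"
    and eq: "\<And>a. a \<in> carrier A \<Longrightarrow> g (sha_embedding k \<Omega> A a) = h (sha_embedding k \<Omega> A a)"
    and x: "x \<in> carrier (Sha k \<Omega> A)"
  shows "g x = h x"
proof -
  let ?S = "Sha k \<Omega> A" and ?j = "sha_embedding k \<Omega> A" and ?P = "sha_operator k \<Omega> A"
  note V = module_sha_letters
  note tensor = Sha_tensor_bilinear
  note one_tensor = bilinear_maps_right[OF tensor A.one_closed]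
  have hom: "q \<in> linear_maps k ?S R" "q \<one>\<^bsub>?S\<^esub> = \<one>\<^bsub>R\<^esub>"
    "\<And>x y. x \<in> carrier ?S \<Longrightarrow> y \<in> carrier ?S \<Longrightarrow> q (x \<otimes>\<^bsub>?S\<^esub> y) = q x \<otimes>\<^bsub>R\<^esub> q y"
    "\<And>\<omega> x. \<omega> \<in> \<Omega> \<Longrightarrow> x \<in> carrier ?S \<Longrightarrow> q (?P \<omega> x) = P \<omega> (q x)"
    if "q \<in> matching_rota_baxter_homs k \<Omega> ?S ?P R P" for q
    using that by (auto simp: matching_rota_baxter_homs_def algebra_homs_def ring_hom_def)
  note g = hom[OF g] and h = hom[OF h]
  have wd: "wd w \<in> carrier H" if "w \<in> lists (carrier V)" for w
    using word_tensor_closed[OF V that] .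
  have factor: "ten a s = ?j a \<otimes>\<^bsub>?S\<^esub> ten \<one>\<^bsub>A\<^esub> s" "?j a \<in> carrier ?S" "ten \<one>\<^bsub>A\<^esub> s \<in> carrier ?S"
    if "a \<in> carrier A" "s \<in> carrier H" for a s
    using that bilinear_maps_closed[OF tensor] by (simp_all add: sha_embedding_def Sha_mult)
  have words: "g (ten \<one>\<^bsub>A\<^esub> (wd w)) = h (ten \<one>\<^bsub>A\<^esub> (wd w))" if "w \<in> lists (carrier V)" for w
    using that
  proof (induction w)
    case Nil
    show ?case using g(2) h(2) by (simp add: Sha_one algebra_Sh(2)[OF V])
  next
    case (Cons v w)
    then have w: "w \<in> lists (carrier V)" and v: "v \<in> carrier V" by auto
    have lin: "(\<lambda>v. q (ten \<one>\<^bsub>A\<^esub> (Sh_cons k V v (wd w)))) \<in> linear_maps k V R"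
      if "q \<in> linear_maps k ?S R" for q
      by (intro linear_maps_compose[OF that] linear_maps_compose[OF one_tensor]
          bilinear_maps_left[OF Sh_cons_bilinear[OF V] wd[OF w]])
    have "g (ten \<one>\<^bsub>A\<^esub> (Sh_cons k V v (wd w))) = h (ten \<one>\<^bsub>A\<^esub> (Sh_cons k V v (wd w)))"
    proof (rule linear_maps_eq_on_generators[OF generates_sha_letters V R.module
          lin[OF g(1)] lin[OF h(1)] _ v])
      fix u assume "u \<in> (\<lambda>(\<omega>, a). letter \<omega> a) ` (\<Omega> \<times> carrier A)"
      then obtain \<omega> a where u: "\<omega> \<in> \<Omega>" "a \<in> carrier A" "u = letter \<omega> a" by auto
      have cons: "ten \<one>\<^bsub>A\<^esub> (Sh_cons k V u (wd w)) = ?P \<omega> (?j a \<otimes>\<^bsub>?S\<^esub> ten \<one>\<^bsub>A\<^esub> (wd w))"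
        using u factor(1)[OF u(2) wd[OF w]] sha_operator_properties(2)[OF u(1,2) wd[OF w]] by simp
      have step: "q (ten \<one>\<^bsub>A\<^esub> (Sh_cons k V u (wd w))) = P \<omega> (q (?j a) \<otimes>\<^bsub>R\<^esub> q (ten \<one>\<^bsub>A\<^esub> (wd w)))"
        if "q \<in> matching_rota_baxter_homs k \<Omega> ?S ?P R P" for q
        unfolding cons
        using hom(4)[OF that u(1)] hom(3)[OF that] factor(2,3)[OF u(2) wd[OF w]] by simp
      show "g (ten \<one>\<^bsub>A\<^esub> (Sh_cons k V u (wd w))) = h (ten \<one>\<^bsub>A\<^esub> (Sh_cons k V u (wd w)))"
        using step[OF assms(1)] step[OF assms(2)] eq[OF u(2)] Cons.IH by simp
    qed
    then show ?case using Sh_cons_word[OF V v w] by simp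
  qed
  show ?thesis
  proof (rule linear_maps_eq_on_generators[OF generates_Sha_words Sha.module R.module g(1) h(1) _ x])
    fix y assume "y \<in> (\<lambda>(a, s). ten a s) ` (carrier A \<times> wd ` lists (carrier V))"
    then obtain a w where y: "a \<in> carrier A" "w \<in> lists (carrier V)" "y = ten a (wd w)" by auto
    have split: "q y = q (?j a) \<otimes>\<^bsub>R\<^esub> q (ten \<one>\<^bsub>A\<^esub> (wd w))"
      if "q \<in> matching_rota_baxter_homs k \<Omega> ?S ?P R P" for q
      using y factor[OF y(1) wd[OF y(2)]] hom(3)[OF that] by simp
    show "g y = h y"
      using split[OF assms(1)] split[OF assms(2)] eq[OF y(1)] words[OF y(2)] by simp
  qed
qed

end

end

theorem theorem2p6:
  fixes k :: "('k, 'm) ring_scheme" and \<Omega> :: "'w set" and A :: "('k, 'a, 'n) module_scheme"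
  assumes "cring k" and "\<Omega> \<noteq> {}" and "algebra k A"
  shows "comm_matching_rota_baxter_algebra k \<Omega> (Sha k \<Omega> A) (sha_operator k \<Omega> A) \<and>
    sha_embedding k \<Omega> A \<in> algebra_homs k A (Sha k \<Omega> A) \<and>
    (\<forall>(R :: ('k, 'r, 'l) module_scheme) P f.
      comm_matching_rota_baxter_algebra k \<Omega> R P \<longrightarrow> f \<in> algebra_homs k A R \<longrightarrow>
      (\<exists>!g. g \<in> extensional (carrier (Sha k \<Omega> A)) \<and>
         g \<in> matching_rota_baxter_homs k \<Omega> (Sha k \<Omega> A) (sha_operator k \<Omega> A) R P \<and>
         (\<forall>a\<in>carrier A. f a = g (sha_embedding k \<Omega> A a))))"
proof (intro conjI allI impI)
  note A = assms(3)
  show Sha: "comm_matching_rota_baxter_algebra k \<Omega> (Sha k \<Omega> A) (sha_operator k \<Omega> A)"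
    by (rule Sha_matching_rota_baxter[OF A])
  show j: "sha_embedding k \<Omega> A \<in> algebra_homs k A (Sha k \<Omega> A)"
    by (rule sha_embedding_hom[OF A])
  fix R :: "('k, 'r, 'l) module_scheme" and P f
  assume R: "comm_matching_rota_baxter_algebra k \<Omega> R P" and f: "f \<in> algebra_homs k A R"
  let ?S = "Sha k \<Omega> A" and ?P = "sha_operator k \<Omega> A" and ?j = "sha_embedding k \<Omega> A"
  interpret Sha: comm_matching_rota_baxter_algebra k \<Omega> ?S ?P by (rule Sha)
  obtain g where g: "g \<in> matching_rota_baxter_homs k \<Omega> ?S ?P R P"
    "\<And>a. a \<in> carrier A \<Longrightarrow> g (?j a) = f a"
    using Sha_hom_exists[OF A R f] by metis
  have j_closed: "?j a \<in> carrier ?S" if "a \<in> carrier A" for a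
    using j that by (auto simp: algebra_homs_def ring_hom_def)
  have P_closed: "?P \<omega> x \<in> carrier ?S" if "\<omega> \<in> \<Omega>" "x \<in> carrier ?S" for \<omega> x
    using linear_maps_closed[OF Sha.operator_linear] that .
  \<comment> \<open>restricting to the carrier makes the homomorphism unique as a function\<close>
  have restrict: "restrict g (carrier ?S) \<in> matching_rota_baxter_homs k \<Omega> ?S ?P R P"
    using g(1) P_closed
    by (auto simp: matching_rota_baxter_homs_def algebra_homs_def ring_hom_def linear_maps_def)
  show "\<exists>!g. g \<in> extensional (carrier ?S) \<and> g \<in> matching_rota_baxter_homs k \<Omega> ?S ?P R P \<and>
      (\<forall>a\<in>carrier A. f a = g (?j a))"
  proof (rule ex1I[of _ "restrict g (carrier ?S)"])
    show "restrict g (carrier ?S) \<in> extensional (carrier ?S) \<and>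
        restrict g (carrier ?S) \<in> matching_rota_baxter_homs k \<Omega> ?S ?P R P \<and>
        (\<forall>a\<in>carrier A. f a = restrict g (carrier ?S) (?j a))"
      using restrict j_closed g(2) by simp
    fix h assume h: "h \<in> extensional (carrier ?S) \<and> h \<in> matching_rota_baxter_homs k \<Omega> ?S ?P R P \<and>
      (\<forall>a\<in>carrier A. f a = h (?j a))"
    show "h = restrict g (carrier ?S)"
    proof (rule extensionalityI[of _ "carrier ?S"])
      fix x assume x: "x \<in> carrier ?S"
      have "h x = g x"
        by (rule Sha_hom_unique[OF A R f _ g(1) _ x]) (use h g(2) in auto)
      then show "h x = restrict g (carrier ?S) x" using x by simp
    qed (use h in auto)
  qed
qed

end
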